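(* Let $\mathcal{H}$ be a Hilbert space of dimension at least two, $R>0$, and let $A\subset\mathcal{H}$ be an $R$-proximally smooth set containing distinct points $a$ and $b$ with $|a-b|<2R$. Then the shortest curve $\gamma$ in $A$ between $a$ and $b$ exists and is unique (up to reparametrization). Its image is an $R$-proximally smooth set, and its length is at most $2R\arcsin\frac{|a-b|}{2R}$. Moreover, any minimizing sequence converges to the shortest curve in the sense of second-order variation: if $\gamma_i$, $i\in\mathbb{N}$, are curves in $A$ connecting $a$ to $b$ with $\operatorname{length}\gamma_i\to\rho_A(a,b)$ and all the curves $\gamma_i,\gamma$ are represented by their standard parametrizations (started at $a$), then $\mathrm{V}_2(\gamma_i-\gamma)\to0$ as $i\to\infty$.
   Context: $\operatorname{dist}(x,A)=\inf_{y\in A}|x-y|$. A set $A$ is $R$-proximally smooth if it is closed and $x\mapsto \operatorname{dist}(x,A)$ is continuously differentiable on $\{x: 0<\operatorname{dist}(x,A)<R\}$. A curve is a continuous map from a non-degenerate segment; its length is its total variation; it is rectifiable if the length is finite. $\rho_A(a,b)$ is the infimum of the lengths of all curves in $A$ connecting $a$ and $b$ ($+\infty$ if there is no rectifiable one). The standard parametrization of a rectifiable curve is the one by $[0,1]$ such that the part of the curve between parameters $0$ and $t$ has length $t\cdot\operatorname{length}\gamma$. For $f\colon[0,1]\to\mathcal{H}$, $$\mathrm{V}_2(f)=\sup_{0=t_0<\dots<t_n=1}\left(\sum_{k=1}^n\frac{|f(t_k)-f(t_{k-1})|^2}{t_k-t_{k-1}}\right)^{1/2}.$$ *)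

theory Defs
  imports "HOL-Analysis.Analysis"
begin

definition proximally_smooth :: "real \<Rightarrow> 'a::real_inner set \<Rightarrow> bool" where
  "proximally_smooth R A \<longleftrightarrow> closed A \<and>
    (\<exists>D :: 'a \<Rightarrow> 'a \<Rightarrow>\<^sub>L real.
      (\<forall>x \<in> {x. 0 < infdist x A \<and> infdist x A < R}.
        ((\<lambda>y. infdist y A) has_derivative blinfun_apply (D x)) (at x)) \<and>
      continuous_on {x. 0 < infdist x A \<and> infdist x A < R} D)"

definition subdivision :: "real \<Rightarrow> real \<Rightarrow> nat \<Rightarrow> (nat \<Rightarrow> real) \<Rightarrow> bool" where
  "subdivision c d n t \<longleftrightarrow> t 0 = c \<and> t n = d \<and> strict_mono_on {..n} t"

text \<open>Total variation of \<open>f\<close> on \<open>{c..d}\<close>. For \<open>c = d\<close> the only subdivision has \<open>n = 0\<close>,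
  and the value is \<open>0\<close>.\<close>

definition curve_length :: "real \<Rightarrow> real \<Rightarrow> (real \<Rightarrow> 'a::real_normed_vector) \<Rightarrow> ennreal" where
  "curve_length c d f =
    (SUP (n, t) \<in> {(n, t). subdivision c d n t}.
      ennreal (\<Sum>k<n. norm (f (t (Suc k)) - f (t k))))"

definition V2 :: "(real \<Rightarrow> 'a::real_normed_vector) \<Rightarrow> ennreal" where
  "V2 f =
    (SUP (n, t) \<in> {(n, t). subdivision 0 1 n t}.
      ennreal (sqrt (\<Sum>k<n. (norm (f (t (Suc k)) - f (t k)))\<^sup>2 / (t (Suc k) - t k))))"

text \<open>A curve is a function on \<open>real\<close> together with the end points \<open>c < d\<close> of its parameter
  interval; its values outside \<open>{c..d}\<close> are irrelevant.\<close>

definition curve_connecting ::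
  "'a::real_normed_vector set \<Rightarrow> 'a \<Rightarrow> 'a \<Rightarrow> real \<Rightarrow> real \<Rightarrow> (real \<Rightarrow> 'a) \<Rightarrow> bool" where
  "curve_connecting A a b c d f \<longleftrightarrow>
    c < d \<and> continuous_on {c..d} f \<and> f ` {c..d} \<subseteq> A \<and> f c = a \<and> f d = b"

text \<open>The infimum is \<open>top\<close> (infinity) when no curve of finite length connects the points.\<close>

definition intrinsic_dist :: "'a::real_normed_vector set \<Rightarrow> 'a \<Rightarrow> 'a \<Rightarrow> ennreal" where
  "intrinsic_dist A a b =
    (INF (c, d, f) \<in> {(c, d, f). curve_connecting A a b c d f}. curve_length c d f)"

definition shortest_curve ::
  "'a::real_normed_vector set \<Rightarrow> 'a \<Rightarrow> 'a \<Rightarrow> real \<Rightarrow> real \<Rightarrow> (real \<Rightarrow> 'a) \<Rightarrow> bool" where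
  "shortest_curve A a b c d f \<longleftrightarrow>
    curve_connecting A a b c d f \<and> curve_length c d f = intrinsic_dist A a b"

text \<open>The curve \<open>g\<close> on \<open>{c..d}\<close> arises from the curve \<open>f\<close> on \<open>{c'..d'}\<close> by an
  orientation-preserving change of parameter. The change of parameter need not be injective,
  since \<open>g\<close> may be constant on subintervals.\<close>

definition reparametrization ::
  "real \<Rightarrow> real \<Rightarrow> (real \<Rightarrow> 'a) \<Rightarrow> real \<Rightarrow> real \<Rightarrow> (real \<Rightarrow> 'a) \<Rightarrow> bool" where
  "reparametrization c d g c' d' f \<longleftrightarrow>
    (\<exists>\<phi>. continuous_on {c..d} \<phi> \<and> mono_on {c..d} \<phi> \<and> \<phi> c = c' \<and> \<phi> d = d' \<and>
      (\<forall>s\<in>{c..d}. g s = f (\<phi> s)))"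

definition standard_parametrization ::
  "(real \<Rightarrow> 'a::real_normed_vector) \<Rightarrow> real \<Rightarrow> real \<Rightarrow> (real \<Rightarrow> 'a) \<Rightarrow> bool" where
  "standard_parametrization s c d g \<longleftrightarrow>
    curve_length c d g < top \<and> reparametrization c d g 0 1 s \<and>
    (\<forall>t\<in>{0..1}. curve_length 0 t s = ennreal t * curve_length c d g)"

end

theory Submission
  imports Defs "HOL-Real_Asymp.Real_Asymp"
begin

text \<open>
  Differentiability of the distance function yields, at each point \<open>x\<close> with \<open>dist(x, A) < R\<close>, a projection
  \<open>p\<close> satisfying \<open>(x - p) \<bullet> (y - p) \<le> |x - p| |y - p|\<^sup>2 / 2R\<close> for all \<open>y \<in> A\<close>; conversely this inequality makes
  the projection Lipschitz and the distance function continuously differentiable. Repeatedly replacing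
  a pair of points by a projected equidistant point shows that \<open>a\<close> and \<open>b\<close> are joined within \<open>A\<close> by paths
  almost as short as an arc of radius \<open>R\<close>; in particular their intrinsic distance is less than \<open>\<pi> R\<close>.

  Let \<open>\<sigma>\<close> and \<open>\<tau>\<close> be nearly shortest curves with constant speed at most \<open>M < \<pi> R\<close> and \<open>g = \<sigma> - \<tau>\<close>. Projecting
  \<open>(1 - s) \<sigma> + s \<tau>\<close> back to \<open>A\<close> gives a curve whose length is at most
  \<open>M - (s / 2M) (\<integral> |g'|\<^sup>2 - (M / R)\<^sup>2 \<integral> |g|\<^sup>2) + O(s\<^sup>2)\<close>. As \<open>M / R < \<pi>\<close>, Wirtinger's inequality makes the
  bracket comparable to \<open>\<integral> |g'|\<^sup>2\<close>, which must therefore be small. This single estimate gives existence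
  (minimizing sequences are Cauchy), uniqueness, and convergence in second-order variation.

  A shortest curve stays in each ball of radius \<open>r < R\<close> containing its end points, since an excursion
  would be longer than an arc of radius \<open>r\<close>. Applied to its subarcs, this gives the projection
  inequality for the image of the curve.
\<close>

section \<open>Proximal smoothness and projections\<close>

text \<open>Closed balls of a Hilbert space need not be compact, so no subsequence argument yields a
  shortest curve; convexity has to be used in quantitative form. The integrals of the overview never
  occur formally, since the curves are only Lipschitz. Each inequality is proved on a parameter
  interval of length h with an error O(h^2), and bisection removes the error. What survives is the
  sum of |g(v) - g(u)|^2 / (v - u) over a subdivision, which is the sum inside \<open>V2\<close>.
  The number pi R has two origins that must match: it is the length of a half circle of radius R,
  kept out of reach by the strict inequality |a - b| < 2R, and it is the speed at which Wirtinger's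
  inequality on the unit interval stops being effective. The gain of the first variation is linear
  in s and its error is quadratic. So s is fixed first, as a small multiple of the desired accuracy,
  and the admissible excess length \<eta> afterwards. Both depend only on R, on a bound \<kappa> <
  pi for the speed divided by R and on the accuracy, not on the curves.\<close>

definition prox_regular :: "real \<Rightarrow> 'a::real_inner set \<Rightarrow> bool" where
  "prox_regular R A \<longleftrightarrow> closed A \<and> A \<noteq> {} \<and>
    (\<forall>x. infdist x A < R \<longrightarrow> (\<exists>p\<in>A. norm (x - p) = infdist x A \<and>
      (\<forall>y\<in>A. (x - p) \<bullet> (y - p) \<le> norm (x - p) * (norm (y - p))\<^sup>2 / (2 * R))))"

lemma infdist_le_norm: "y \<in> A \<Longrightarrow> infdist x A \<le> norm (x - y)"
  using infdist_le[of y A x] by (simp add: dist_norm)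

lemma infdist_lipschitz: "\<bar>infdist x A - infdist y A\<bar> \<le> norm (x - y)"
  by (metis infdist_triangle_abs dist_norm)

lemma infdist_approx:
  assumes "A \<noteq> {}" "e > 0"
  shows "\<exists>y\<in>A. norm (x - y) < infdist x A + e"
proof (rule ccontr)
  assume "\<not> ?thesis"
  then have *: "\<And>y. y \<in> A \<Longrightarrow> infdist x A + e \<le> dist x y" by (force simp: dist_norm not_less)
  have "infdist x A + e \<le> infdist x A"
    unfolding infdist_notempty[OF assms(1)] 
    by (rule cINF_greatest) (use assms * in \<open>auto simp: infdist_notempty\<close>)
  then show False using assms by simp
qed

lemma norm_scale_sub:
  fixes u :: "'a::real_normed_vector"
  assumes "norm u = 1" "0 \<le> t" "t \<le> r"
  shows "norm (t *\<^sub>R u - r *\<^sub>R u) = r - t"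
proof -
  have "t *\<^sub>R u - r *\<^sub>R u = (t - r) *\<^sub>R u" by (simp add: scaleR_diff_left)
  then show ?thesis using assms by simp
qed

text \<open>Along a minimizing sequence the unit directions towards \<open>A\<close> have derivative tending to
  \<open>-1\<close>, the least possible value, and strict convexity of the norm makes them converge.\<close>

lemma infdist_derivative_imp_projection:
  fixes A :: "'a::{real_inner, complete_space} set"
  assumes A: "closed A" "A \<noteq> {}" and d0: "0 < infdist x A"
    and D: "((\<lambda>y. infdist y A) has_derivative D) (at x)"
  obtains v p where "norm v = 1" "p \<in> A" "x = p + infdist x A *\<^sub>R v" "D v = 1"
proof -
  define d where "d = infdist x A"
  interpret bounded_linear D using D by (rule has_derivative_bounded_linear)
  have est: "\<exists>\<delta>>0. \<forall>h. norm h < \<delta> \<longrightarrow> \<bar>infdist (x + h) A - d - D h\<bar> \<le> e * norm h" if "e > 0" for e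
  proof -
    from D[unfolded has_derivative_within_alt] that obtain \<delta> where "\<delta> > 0"
      "\<And>y. norm (y - x) < \<delta> \<Longrightarrow> norm (infdist y A - infdist x A - D (y - x)) \<le> e * norm (y - x)"
      by auto
    then show ?thesis unfolding d_def
      by (intro exI[of _ \<delta>]) (metis add_diff_cancel_left' real_norm_def)
  qed
  have Dle: "\<bar>D w\<bar> \<le> norm w" for w
  proof (rule field_le_epsilon)
    fix e :: real assume e: "e > 0"
    define e' where "e' = e / (norm w + 1)"
    have "e' > 0" using e by (simp add: e'_def add_nonneg_pos)
    from est[OF this] obtain \<delta> where \<delta>: "\<delta> > 0"
      "\<And>h. norm h < \<delta> \<Longrightarrow> \<bar>infdist (x + h) A - d - D h\<bar> \<le> e' * norm h" by auto
    define t where "t = \<delta> / (2 * (norm w + 1))"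
    have t: "t > 0" using \<delta> by (simp add: t_def add_nonneg_pos)
    have "norm (t *\<^sub>R w) = \<delta> * (norm w / (2 * (norm w + 1)))"
      using t \<delta>(1) by (simp add: t_def abs_of_pos)
    also have "\<dots> < \<delta> * 1" using \<delta>(1) 
      by (intro mult_strict_left_mono) (auto simp: divide_simps add_nonneg_pos intro: add_nonneg_pos)
    finally have "norm (t *\<^sub>R w) < \<delta>" by simp
    then have "\<bar>infdist (x + t *\<^sub>R w) A - d - D (t *\<^sub>R w)\<bar> \<le> e' * norm (t *\<^sub>R w)" by (rule \<delta>(2))
    moreover have "\<bar>infdist (x + t *\<^sub>R w) A - d\<bar> \<le> norm (t *\<^sub>R w)"
      unfolding d_def using infdist_lipschitz[of "x + t *\<^sub>R w" A x] by simp
    ultimately have "\<bar>D (t *\<^sub>R w)\<bar> \<le> (1 + e') * norm (t *\<^sub>R w)" by (simp add: algebra_simps)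
    then have "t * \<bar>D w\<bar> \<le> t * ((1 + e') * norm w)" using t by (simp add: scale abs_mult mult_ac)
    then have "\<bar>D w\<bar> \<le> (1 + e') * norm w" using t by simp
    also have "\<dots> = norm w + e * (norm w / (norm w + 1))" by (simp add: e'_def algebra_simps)
    also have "\<dots> \<le> norm w + e * 1"
      using e by (intro add_left_mono mult_left_mono) (auto simp: divide_simps add_nonneg_pos)
    also have "\<dots> = norm w + e" by simp
    finally show "\<bar>D w\<bar> \<le> norm w + e" .
  qed
  define t where "t = (\<lambda>n::nat. 1 / (real n + 1))"
  have t_pos: "t n > 0" for n by (simp add: t_def add_nonneg_pos)
  have t0: "t \<longlonglongrightarrow> 0" unfolding t_def using LIMSEQ_inverse_real_of_nat by (simp add: inverse_eq_divide add.commute)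
  \<comment> \<open>The accuracy has to be o(\<open>t n\<close>), because it will be divided by the
    step length \<open>t n\<close>.\<close>
  have "\<exists>y\<in>A. norm (x - y) < d + (t n)\<^sup>2" for n
    unfolding d_def using infdist_approx[OF A(2), of "(t n)\<^sup>2" x] t_pos[of n] by simp
  then obtain y where y: "\<And>n. y n \<in> A" "\<And>n. norm (x - y n) < d + (t n)\<^sup>2" by metis
  define r where "r = (\<lambda>n. norm (x - y n))"
  have rd: "r n \<ge> d" for n unfolding r_def d_def using y infdist_le_norm by blast
  have dpos: "d > 0" using d0 by (simp add: d_def)
  define u where "u = (\<lambda>n. (y n - x) /\<^sub>R r n)"
  have rpos: "r n > 0" for n using rd[of n] dpos by simp
  have nu: "norm (u n) = 1" for n using rpos[of n] by (simp add: u_def r_def norm_minus_commute)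
  have yu: "y n = x + r n *\<^sub>R u n" for n using rpos[of n] by (simp add: u_def)
  \<comment> \<open>Walking the distance \<open>t n\<close> towards the almost nearest point
    \<open>y n\<close> shortens the distance to \<open>A\<close> by almost
    \<open>t n\<close>.\<close>
  have Du: "\<forall>\<^sub>F n in sequentially. D (u n) \<le> -1 + e" if "e > 0" for e
  proof -
    from est[of "e/2"] that obtain \<delta> where \<delta>: "\<delta> > 0"
      "\<And>h. norm h < \<delta> \<Longrightarrow> \<bar>infdist (x + h) A - d - D h\<bar> \<le> (e/2) * norm h" by auto
    have "\<forall>\<^sub>F n in sequentially. t n < min (min \<delta> d) (e/2)"
      using t0 \<delta>(1) dpos that by (intro order_tendstoD) auto
    then show ?thesis
    proof eventually_elim
      case (elim n)
      have "norm (t n *\<^sub>R u n) = t n" using nu[of n] t_pos[of n] by simp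
      then have "\<bar>infdist (x + t n *\<^sub>R u n) A - d - D (t n *\<^sub>R u n)\<bar> \<le> (e/2) * t n"
        using \<delta>(2)[of "t n *\<^sub>R u n"] elim by (metis min_less_iff_conj)
      then have "D (t n *\<^sub>R u n) \<le> infdist (x + t n *\<^sub>R u n) A - d + (e/2) * t n" by linarith
      also have "infdist (x + t n *\<^sub>R u n) A \<le> norm (x + t n *\<^sub>R u n - y n)"
        using y infdist_le_norm by blast
      also have "\<dots> = r n - t n" unfolding yu
        using norm_scale_sub[of "u n" "t n" "r n"] nu[of n] t_pos[of n] elim rd[of n] by simp
      also have "r n \<le> d + (t n)\<^sup>2" using y(2)[of n] by (simp add: r_def)
      finally have "t n * D (u n) \<le> t n * (t n - 1 + e/2)" by (simp add: scale algebra_simps power2_eq_square)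
      then have "D (u n) \<le> t n - 1 + e / 2" using t_pos[of n] by simp
      then show ?case using elim by simp
    qed
  qed
  have "Cauchy u"
  proof (rule metric_CauchyI)
    fix e :: real assume e: "e > 0"
    define e' where "e' = min 1 (e\<^sup>2 / 16)"
    have e': "e' > 0" "e' \<le> 1" "e' \<le> e\<^sup>2/16" using e by (auto simp: e'_def)
    from Du[OF e'(1)] obtain N where N: "\<And>n. n \<ge> N \<Longrightarrow> D (u n) \<le> -1 + e'"
      by (auto simp: eventually_sequentially)
    show "\<exists>N. \<forall>m\<ge>N. \<forall>n\<ge>N. dist (u m) (u n) < e"
    proof (intro exI[of _ N] allI impI)
      fix m n assume mn: "m \<ge> N" "n \<ge> N"
      have "norm (u m + u n) \<ge> - D (u m + u n)" using Dle[of "u m + u n"] by simp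
      then have ge: "norm (u m + u n) \<ge> 2 - 2 * e'" using N[OF mn(1)] N[OF mn(2)] by (simp add: add)
      have "(norm (u m + u n))\<^sup>2 + (norm (u m - u n))\<^sup>2 = 4"
        using nu[of m] nu[of n] by (simp add: power2_norm_eq_inner inner_add inner_diff inner_commute norm_eq_1)
      moreover have "(norm (u m + u n))\<^sup>2 \<ge> (2 - 2 * e')\<^sup>2" using ge e' by (intro power_mono) auto
      moreover have "(2 - 2 * e')\<^sup>2 = 4 - 8 * e' + 4 * e'\<^sup>2" by (simp add: power2_eq_square algebra_simps)
      ultimately have "(norm (u m - u n))\<^sup>2 \<le> 8 * e'" using e' by (smt (verit) zero_le_power2)
      also have "\<dots> < e\<^sup>2" using e' zero_less_power[OF e, of 2] by linarith
      finally show "dist (u m) (u n) < e" using e by (simp add: dist_norm power_less_imp_less_base)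
    qed
  qed
  then obtain u0 where u0: "u \<longlonglongrightarrow> u0" using Cauchy_convergent convergent_def by blast
  have "r \<longlonglongrightarrow> d"
  proof (rule tendsto_sandwich)
    show "\<forall>\<^sub>F n in sequentially. d \<le> r n" using rd by simp
    show "\<forall>\<^sub>F n in sequentially. r n \<le> d + (t n)\<^sup>2" using y(2) by (simp add: r_def less_imp_le)
    show "(\<lambda>n. d + (t n)\<^sup>2) \<longlonglongrightarrow> d" using tendsto_add[OF tendsto_const tendsto_power[OF t0, of 2]] by simp
  qed simp
  then have ylim: "y \<longlonglongrightarrow> x + d *\<^sub>R u0" using u0 unfolding yu by (intro tendsto_intros)
  then have pA: "x + d *\<^sub>R u0 \<in> A" using A(1) y(1) closed_sequentially by blast
  have nu0: "norm u0 = 1" using tendsto_norm[OF u0] by (simp add: nu LIMSEQ_const_iff)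
  have Dlim: "(\<lambda>n. D (u n)) \<longlonglongrightarrow> D u0" using u0 by (rule tendsto)
  have "D u0 \<le> -1"
  proof (rule field_le_epsilon)
    fix e :: real assume "e > 0"
    show "D u0 \<le> -1 + e" using tendsto_upperbound[OF Dlim Du[OF \<open>e > 0\<close>]] by simp
  qed
  moreover have "D u0 \<ge> -1" using Dle[of u0] nu0 by (simp add: abs_le_iff)
  ultimately have "D (- u0) = 1" by (simp add: neg)
  then show thesis using that[of "-u0" "x + d *\<^sub>R u0"] nu0 pA by (simp add: d_def)
qed

text \<open>A variational principle in the manner of Ekeland and Caristi. Read
  \<open>y \<in> S z\<close> as an order in which \<open>y\<close> lies above \<open>z\<close>:
  completeness yields a maximal element above \<open>x\<close>, and by \<open>step\<close> a maximal
  element has reached the level \<open>b\<close>. The guaranteed rate of gain \<open>c\<close>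
  bounds the distance covered.\<close>

lemma bounded_increasing_climb:
  fixes f :: "'a::complete_space \<Rightarrow> real"
  assumes c: "c > 0" and cont: "continuous_on UNIV f" and x: "f x \<le> b"
    and step: "\<And>z. f x \<le> f z \<Longrightarrow> f z < b \<Longrightarrow> \<exists>y. f z < f y \<and> f y \<le> b \<and> c * dist z y \<le> f y - f z"
  shows "\<exists>z. f z = b \<and> c * dist x z \<le> b - f x"
proof -
  define S where "S z = {y. f y \<le> b \<and> c * dist z y \<le> f y - f z}" for z
  have self: "z \<in> S z" if "f z \<le> b" for z using that by (simp add: S_def)
  have mono: "f z \<le> f y" if "y \<in> S z" for y z
  proof -
    have "0 \<le> c * dist z y" using c by simp
    then show ?thesis using that by (simp add: S_def)
  qed
  have trans: "y' \<in> S z" if "y \<in> S z" "y' \<in> S y" for y y' z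
  proof -
    have "c * dist z y' \<le> c * dist z y + c * dist y y'" 
      using c dist_triangle[of z y' y] by (metis distrib_left mult_le_cancel_left_pos)
    then show ?thesis using that by (simp add: S_def)
  qed
  have bdd: "bdd_above (f ` S z)" for z by (rule bdd_aboveI[of _ b]) (auto simp: S_def)
  \<comment> \<open>Greedy choice: the supremum need not be attained, so the successor takes at
    least half of the gain still possible.\<close>
  have "\<exists>y. y \<in> S z \<and> f y \<ge> (Sup (f ` S z) + f z) / 2" if z: "f z \<le> b" for z
  proof (cases "Sup (f ` S z) > f z")
    case True
    then have "(Sup (f ` S z) + f z) / 2 < Sup (f ` S z)" by simp
    then obtain y where "y \<in> S z" "(Sup (f ` S z) + f z) / 2 < f y"
      using less_cSup_iff[OF _ bdd, of z "(Sup (f ` S z) + f z) / 2"] self[OF z] by blast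
    then show ?thesis by (intro exI[of _ y]) simp
  next
    case False
    then show ?thesis using self[OF z] by (intro exI[of _ z]) simp
  qed
  then obtain g where g: "\<And>z. f z \<le> b \<Longrightarrow> g z \<in> S z"
    "\<And>z. f z \<le> b \<Longrightarrow> f (g z) \<ge> (Sup (f ` S z) + f z) / 2" by metis
  define w where "w n = (g ^^ n) x" for n
  have wS: "w (Suc n) = g (w n)" for n by (simp add: w_def)
  have wb: "f (w n) \<le> b" for n
  proof (induction n)
    case 0 then show ?case using x by (simp add: w_def)
  next
    case (Suc n) then show ?case using g(1)[OF Suc] by (simp add: wS S_def)
  qed
  have wmono: "w m \<in> S (w n)" if "n \<le> m" for m n
    using that
  proof (induction m rule: dec_induct)
    case base then show ?case using self wb by blast
  next
    case (step m) then show ?case using trans g(1)[OF wb] wS by metis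
  qed
  have inc: "incseq (\<lambda>n. f (w n))" using mono wmono by (auto simp: incseq_def)
  obtain l where l: "(\<lambda>n. f (w n)) \<longlonglongrightarrow> l"
    using incseq_convergent[OF inc] wb by metis
  have "Cauchy w"
  proof (rule metric_CauchyI)
    fix e :: real assume e: "e > 0"
    from LIMSEQ_imp_Cauchy[OF l] c e obtain N where N: "\<And>m n. m \<ge> N \<Longrightarrow> n \<ge> N \<Longrightarrow> dist (f (w m)) (f (w n)) < c * e"
      by (metis metric_CauchyD mult_pos_pos)
    have *: "dist (w n) (w m) < e" if "N \<le> n" "n \<le> m" for m n
    proof -
      have "c * dist (w n) (w m) \<le> f (w m) - f (w n)" using wmono[OF that(2)] by (simp add: S_def)
      also have "\<dots> < c * e" using N[of m n] that by (simp add: dist_real_def)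
      finally show ?thesis using c by simp
    qed
    show "\<exists>N. \<forall>m\<ge>N. \<forall>n\<ge>N. dist (w m) (w n) < e"
      using * by (intro exI[of _ N]) (metis dist_commute nle_le)
  qed
  then obtain z where z: "w \<longlonglongrightarrow> z" using Cauchy_convergent convergent_def by blast
  have fz: "(\<lambda>n. f (w n)) \<longlonglongrightarrow> f z"
    using cont z continuous_on_tendsto_compose[of UNIV f w z] by auto
  then have lz: "l = f z" using l LIMSEQ_unique by blast
  have zS: "z \<in> S (w n)" for n
  proof -
    have "f z \<le> b" using fz wb by (intro LIMSEQ_le_const2) auto
    moreover have "c * dist (w n) z \<le> f z - f (w n)"
    proof (rule LIMSEQ_le)
      show "(\<lambda>m. c * dist (w n) (w m)) \<longlonglongrightarrow> c * dist (w n) z" by (intro tendsto_intros z)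
      show "(\<lambda>m. f (w m) - f (w n)) \<longlonglongrightarrow> f z - f (w n)" by (intro tendsto_intros fz)
      show "\<exists>N. \<forall>m\<ge>N. c * dist (w n) (w m) \<le> f (w m) - f (w n)"
        using wmono by (auto simp: S_def)
    qed
    ultimately show ?thesis by (simp add: S_def)
  qed
  have zx: "z \<in> S x" using zS[of 0] by (simp add: w_def)
  have "f z = b"
  proof (rule ccontr)
    assume "f z \<noteq> b"
    then have "f z < b" using zx by (simp add: S_def)
    then obtain y where y: "f z < f y" "f y \<le> b" "c * dist z y \<le> f y - f z"
      using step[of z] mono[OF zx] by blast
    then have "y \<in> S z" by (simp add: S_def)
    then have yS: "y \<in> S (w n)" for n using trans zS by blast
    \<comment> \<open>If \<open>z\<close> could be improved to \<open>y\<close>, each step would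
      have gained at least half of what was missing to \<open>f y\<close>, so the limit value
      \<open>f z\<close> would be at least \<open>f y\<close>.\<close>
    have "f (w (Suc n)) \<ge> (f y + f (w n)) / 2" for n
      using g(2)[OF wb, of n] cSup_upper[OF imageI[OF yS[of n], of f] bdd] by (simp add: wS)
    then have "f z \<ge> (f y + f z) / 2"
      using LIMSEQ_Suc[OF fz] by (intro LIMSEQ_le[of "\<lambda>n. (f y + f (w n)) / 2"]) (auto intro!: tendsto_intros fz)
    then show False using y by simp
  qed
  then show ?thesis using zx by (auto simp: S_def)
qed

lemma norm_add_scale_unit_sq:
  fixes z v :: "'a::real_inner"
  assumes "norm v = 1"
  shows "(norm (z + t *\<^sub>R v))\<^sup>2 = (norm z)\<^sup>2 + 2 * t * (z \<bullet> v) + t\<^sup>2"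
  using assms unfolding power2_norm_eq_inner
  by (simp add: inner_add algebra_simps inner_commute norm_eq_1 power2_eq_square)

text \<open>The distance grows at unit rate along the gradient, so one can climb from \<open>x\<close> to the level
  \<open>r\<close> along a path of length at most \<open>(r - infdist x A) / (1 - \<eta>)\<close>. As \<open>\<eta> \<rightarrow> 0\<close>, the triangle inequality
  becomes an equality, which forces the end point towards the ray from \<open>p\<close> through \<open>x\<close>.\<close>

lemma infdist_on_normal_ray:
  fixes A :: "'a::{real_inner, complete_space} set"
  assumes A: "closed A" "A \<noteq> {}"
    and diff: "\<And>y. 0 < infdist y A \<Longrightarrow> infdist y A < R \<Longrightarrow> \<exists>D. ((\<lambda>y. infdist y A) has_derivative D) (at y)"
    and x: "0 < infdist x A" "infdist x A < r" "r < R"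
    and v: "norm v = 1" "p \<in> A" "x = p + infdist x A *\<^sub>R v"
  shows "infdist (p + r *\<^sub>R v) A = r"
proof -
  define d where "d = infdist x A"
  define L where "L = r - d"
  have L: "L > 0" "d > 0" using x by (auto simp: L_def d_def)
  have climb: "\<exists>z. infdist z A = r \<and> (1 - \<eta>) * norm (z - x) \<le> L" if \<eta>: "0 < \<eta>" "\<eta> < 1" for \<eta>
  proof -
    have "\<exists>z. infdist z A = r \<and> (1 - \<eta>) * dist x z \<le> r - infdist x A"
    proof (rule bounded_increasing_climb)
      show "continuous_on UNIV (\<lambda>x. infdist x A)" by (intro continuous_intros)
      fix z assume z: "infdist x A \<le> infdist z A" "infdist z A < r"
      then have z': "0 < infdist z A" "infdist z A < R" using x by auto
      from diff[OF this] obtain D where D: "((\<lambda>y. infdist y A) has_derivative D) (at z)" by blast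
      from infdist_derivative_imp_projection[OF A z'(1) D] obtain u q
        where u: "norm u = 1" "D u = 1" by metis
      interpret bounded_linear D using D by (rule has_derivative_bounded_linear)
      from D[unfolded has_derivative_within_alt] \<eta> obtain \<delta> where \<delta>: "\<delta> > 0"
        "\<And>y. norm (y - z) < \<delta> \<Longrightarrow> norm (infdist y A - infdist z A - D (y - z)) \<le> \<eta> * norm (y - z)"
        by auto
      \<comment> \<open>The first bound keeps \<open>y\<close> where the linearization is valid. The
        second prevents overshooting the level \<open>r\<close>, since the distance function is
        1-Lipschitz.\<close>
      define t where "t = min (\<delta> / 2) (r - infdist z A)"
      have t: "0 < t" "t < \<delta>" "t \<le> r - infdist z A" using \<delta> z by (auto simp: t_def)
      define y where "y = z + t *\<^sub>R u"
      have nyz: "norm (y - z) = t" using t u by (simp add: y_def)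
      have "D (y - z) = t" using u by (simp add: y_def scale)
      with \<delta>(2)[of y] nyz t have "\<bar>infdist y A - infdist z A - t\<bar> \<le> \<eta> * t" by simp
      then have ge: "infdist y A - infdist z A \<ge> (1 - \<eta>) * t" by (simp add: algebra_simps abs_le_iff)
      have "0 < (1 - \<eta>) * t" using \<eta> t by simp
      moreover have "infdist y A \<le> infdist z A + t"
        using infdist_lipschitz[of y A z] nyz by simp
      ultimately show "\<exists>y. infdist z A < infdist y A \<and> infdist y A \<le> r \<and> (1 - \<eta>) * dist z y \<le> infdist y A - infdist z A"
        using ge t nyz by (intro exI[of _ y]) (simp add: dist_norm norm_minus_commute)
    qed (use \<eta> x in auto)
    then show ?thesis by (auto simp: L_def d_def dist_norm norm_minus_commute)
  qed
  define \<eta> where "\<eta> n = 1 / (real n + 2)" for n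
  have \<eta>: "0 < \<eta> n" "\<eta> n < 1" for n by (auto simp: \<eta>_def)
  have \<eta>0: "\<eta> \<longlonglongrightarrow> 0" unfolding \<eta>_def by real_asymp
  obtain z where z: "\<And>n. infdist (z n) A = r" "\<And>n. (1 - \<eta> n) * norm (z n - x) \<le> L"
    using climb[OF \<eta>] by metis
  \<comment> \<open>In the triangle \<open>p\<close>, \<open>x\<close>, \<open>z n\<close> two sides
    are \<open>d\<close> and at most \<open>L / (1 - \<eta> n)\<close>, while the third is at least
    \<open>r = d + L\<close>. The triangle is almost degenerate, which puts \<open>z n - x\<close>
    close to \<open>L *\<^sub>R v\<close>.\<close>
  have bound: "(norm (z n - x - L *\<^sub>R v))\<^sup>2 \<le> ((L / (1 - \<eta> n))\<^sup>2 - L\<^sup>2) * (1 + L / d)" for n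
  proof -
    define y where "y = z n - x"
    have "norm y \<le> L / (1 - \<eta> n)" using z(2)[of n] \<eta>[of n] by (simp add: y_def field_simps)
    then have y: "(norm y)\<^sup>2 \<le> (L / (1 - \<eta> n))\<^sup>2" by (intro power_mono) auto
    have "r \<le> norm (z n - p)" using z(1)[of n] infdist_le_norm[OF v(2), of "z n"] by simp
    also have "z n - p = y + d *\<^sub>R v" using v(3) by (simp add: y_def d_def algebra_simps)
    finally have "L + d \<le> norm (y + d *\<^sub>R v)" by (simp add: L_def)
    then have "(L + d)\<^sup>2 \<le> (norm (y + d *\<^sub>R v))\<^sup>2" using L by (intro power_mono) auto
    then have "L * (L + 2 * d) - (norm y)\<^sup>2 \<le> 2 * d * (y \<bullet> v)"
      unfolding norm_add_scale_unit_sq[OF v(1)] by (simp add: power2_eq_square algebra_simps)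
    then have "(L / d) * (L * (L + 2 * d) - (norm y)\<^sup>2) \<le> (L / d) * (2 * d * (y \<bullet> v))"
      using L by (intro mult_left_mono) auto
    moreover have "(L / d) * (2 * d * (y \<bullet> v)) = 2 * L * (y \<bullet> v)" using L by simp
    moreover have "(norm (y - L *\<^sub>R v))\<^sup>2 = (norm y)\<^sup>2 - 2 * L * (y \<bullet> v) + L\<^sup>2"
      using norm_add_scale_unit_sq[OF v(1), of y "-L"] by simp
    moreover have "(norm y)\<^sup>2 - (L / d) * (L * (L + 2 * d) - (norm y)\<^sup>2) + L\<^sup>2 = ((norm y)\<^sup>2 - L\<^sup>2) * (1 + L / d)"
      using L by (simp add: field_simps power2_eq_square)
    ultimately have "(norm (y - L *\<^sub>R v))\<^sup>2 \<le> ((norm y)\<^sup>2 - L\<^sup>2) * (1 + L / d)" by linarith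
    also have "\<dots> \<le> ((L / (1 - \<eta> n))\<^sup>2 - L\<^sup>2) * (1 + L / d)"
      using y L by (intro mult_right_mono) auto
    finally show ?thesis by (simp add: y_def)
  qed
  have "(\<lambda>n. ((L / (1 - \<eta> n))\<^sup>2 - L\<^sup>2) * (1 + L / d)) \<longlonglongrightarrow> ((L / (1 - 0))\<^sup>2 - L\<^sup>2) * (1 + L / d)"
    by (intro tendsto_intros \<eta>0) auto
  then have lim: "(\<lambda>n. ((L / (1 - \<eta> n))\<^sup>2 - L\<^sup>2) * (1 + L / d)) \<longlonglongrightarrow> 0" by simp
  have "(\<lambda>n. (norm (z n - x - L *\<^sub>R v))\<^sup>2) \<longlonglongrightarrow> 0"
    by (rule tendsto_sandwich[OF _ _ tendsto_const lim]) (use bound in auto)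
  then have "(\<lambda>n. sqrt ((norm (z n - x - L *\<^sub>R v))\<^sup>2)) \<longlonglongrightarrow> sqrt 0" by (intro tendsto_intros)
  then have "(\<lambda>n. norm (z n - x - L *\<^sub>R v)) \<longlonglongrightarrow> 0" by simp
  then have "(\<lambda>n. z n - x - L *\<^sub>R v) \<longlonglongrightarrow> 0" by (simp add: tendsto_norm_zero_iff)
  then have "(\<lambda>n. (z n - x - L *\<^sub>R v) + (x + L *\<^sub>R v)) \<longlonglongrightarrow> 0 + (x + L *\<^sub>R v)" by (intro tendsto_intros)
  then have "z \<longlonglongrightarrow> x + L *\<^sub>R v" by simp
  also have "x + L *\<^sub>R v = p + r *\<^sub>R v" using v(3) by (simp add: L_def d_def algebra_simps)
  finally have "(\<lambda>n. infdist (z n) A) \<longlonglongrightarrow> infdist (p + r *\<^sub>R v) A" by (rule tendsto_infdist)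
  then show ?thesis using z(1) by (simp add: LIMSEQ_const_iff)
qed

text \<open>Geometrically, the open ball of radius \<open>R\<close> that touches \<open>A\<close> at
  \<open>p\<close> on the side of \<open>x\<close> misses \<open>A\<close>. For radii
  \<open>r < R\<close> this holds because the centre on the normal ray has distance exactly
  \<open>r\<close> from \<open>A\<close>; then \<open>r\<close> tends to \<open>R\<close>.\<close>

lemma proximally_smooth_imp_prox_regular:
  fixes A :: "'a::{real_inner, complete_space} set"
  assumes "proximally_smooth R A" "A \<noteq> {}" and R: "R > 0"
  shows "prox_regular R A"
  unfolding prox_regular_def
proof (intro conjI allI impI)
  show A: "closed A" "A \<noteq> {}" using assms by (auto simp: proximally_smooth_def)
  have diff: "\<exists>D. ((\<lambda>y. infdist y A) has_derivative D) (at y)" if "0 < infdist y A" "infdist y A < R" for y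
    using assms(1) that unfolding proximally_smooth_def by blast
  fix x assume xR: "infdist x A < R"
  show "\<exists>p\<in>A. norm (x - p) = infdist x A \<and>
      (\<forall>y\<in>A. (x - p) \<bullet> (y - p) \<le> norm (x - p) * (norm (y - p))\<^sup>2 / (2 * R))"
  proof (cases "infdist x A = 0")
    case True
    then have "x \<in> A" using A by (simp add: in_closed_iff_infdist_zero)
    then show ?thesis by (intro bexI[of _ x]) auto
  next
    case False
    then have x0: "0 < infdist x A" using infdist_nonneg[of x A] by simp
    from diff[OF x0 xR] obtain D where D: "((\<lambda>y. infdist y A) has_derivative D) (at x)" by blast
    obtain v p where v: "norm v = 1" "p \<in> A" "x = p + infdist x A *\<^sub>R v"
      using infdist_derivative_imp_projection[OF A x0 D] by metis
    have xp: "x - p = infdist x A *\<^sub>R v" using v(3) by (simp add: algebra_simps)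
    have nxp: "norm (x - p) = infdist x A" using xp v(1) x0 by simp
    have ineq: "v \<bullet> (y - p) \<le> (norm (y - p))\<^sup>2 / (2 * R)" if y: "y \<in> A" for y
    proof -
      have "2 * r * (v \<bullet> (y - p)) \<le> (norm (y - p))\<^sup>2" if r: "infdist x A < r" "r < R" for r
      proof -
        have "r = infdist (p + r *\<^sub>R v) A" using infdist_on_normal_ray[OF A diff x0 r v] by simp
        also have "\<dots> \<le> norm (p + r *\<^sub>R v - y)" using y by (rule infdist_le_norm)
        also have "\<dots> = norm ((p - y) + r *\<^sub>R v)" by (simp add: algebra_simps)
        finally have "r\<^sup>2 \<le> (norm ((p - y) + r *\<^sub>R v))\<^sup>2" using r x0 by (intro power_mono) auto
        then have "0 \<le> (norm (p - y))\<^sup>2 + 2 * r * ((p - y) \<bullet> v)" by (simp add: norm_add_scale_unit_sq[OF v(1)])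
        then show ?thesis by (simp add: norm_minus_commute inner_commute inner_diff algebra_simps)
      qed
      then have ev: "\<forall>\<^sub>F r in at_left R. 2 * r * (v \<bullet> (y - p)) \<le> (norm (y - p))\<^sup>2"
        using eventually_at_left_real[OF xR] by (auto elim!: eventually_mono)
      have "((\<lambda>r. 2 * r * (v \<bullet> (y - p))) \<longlongrightarrow> 2 * R * (v \<bullet> (y - p))) (at_left R)"
        by (intro tendsto_intros)
      from tendsto_upperbound[OF this ev] have "2 * R * (v \<bullet> (y - p)) \<le> (norm (y - p))\<^sup>2" by simp
      then show ?thesis using R by (simp add: field_simps)
    qed
    show ?thesis
    proof (intro bexI[of _ p] conjI ballI)
      fix y assume "y \<in> A"
      have "infdist x A * (v \<bullet> (y - p)) \<le> infdist x A * ((norm (y - p))\<^sup>2 / (2 * R))"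
        using ineq[OF \<open>y \<in> A\<close>] x0 by (intro mult_left_mono) auto
      then show "(x - p) \<bullet> (y - p) \<le> norm (x - p) * (norm (y - p))\<^sup>2 / (2 * R)"
        unfolding nxp unfolding xp by simp
    qed (use nxp v in auto)
  qed
qed

section \<open>The projection: Lipschitz continuity, and the distance of a chord from the
  set\<close>

definition proj :: "'a::real_inner set \<Rightarrow> real \<Rightarrow> 'a \<Rightarrow> 'a" where
  "proj A R x = (SOME p. p \<in> A \<and> norm (x - p) = infdist x A \<and>
      (\<forall>y\<in>A. (x - p) \<bullet> (y - p) \<le> norm (x - p) * (norm (y - p))\<^sup>2 / (2 * R)))"

lemma proj:
  assumes "prox_regular R A" "infdist x A < R"
  shows proj_in: "proj A R x \<in> A"
    and norm_diff_proj: "norm (x - proj A R x) = infdist x A"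
    and proj_inner_le: "y \<in> A \<Longrightarrow>
      (x - proj A R x) \<bullet> (y - proj A R x) \<le> infdist x A * (norm (y - proj A R x))\<^sup>2 / (2 * R)"
proof -
  have "\<exists>p. p \<in> A \<and> norm (x - p) = infdist x A \<and>
      (\<forall>y\<in>A. (x - p) \<bullet> (y - p) \<le> norm (x - p) * (norm (y - p))\<^sup>2 / (2 * R))"
    using assms unfolding prox_regular_def by blast
  from someI_ex[OF this, folded proj_def]
  show "proj A R x \<in> A" "norm (x - proj A R x) = infdist x A"
    "y \<in> A \<Longrightarrow> (x - proj A R x) \<bullet> (y - proj A R x) \<le> infdist x A * (norm (y - proj A R x))\<^sup>2 / (2 * R)"
    by auto
qed

lemma proj_of_mem:
  assumes "prox_regular R A" "R > 0" "x \<in> A"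
  shows "proj A R x = x"
  using norm_diff_proj[OF assms(1), of x] assms by simp

text \<open>The projection inequality at each of the two projections is tested with the other one;
  the sum is absorbed by Cauchy-Schwarz. The resulting Lipschitz constant is 1 / (1 - m/R), where m
  is the mean of the two distances.\<close>

lemma proj_lipschitz:
  assumes A: "prox_regular R A" and R: "R > 0" and x: "infdist x A < R" and y: "infdist y A < R"
  shows "norm (proj A R x - proj A R y) * (1 - (infdist x A + infdist y A) / (2 * R)) \<le> norm (x - y)"
proof -
  define p q where "p = proj A R x" and "q = proj A R y"
  define w where "w = p - q"
  have 1: "(x - p) \<bullet> (q - p) \<le> infdist x A * (norm (q - p))\<^sup>2 / (2 * R)"
    unfolding p_def q_def using A x y by (intro proj_inner_le proj_in)
  have 2: "(y - q) \<bullet> (p - q) \<le> infdist y A * (norm (p - q))\<^sup>2 / (2 * R)"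
    unfolding p_def q_def using A x y by (intro proj_inner_le proj_in)
  have n: "norm (q - p) = norm w" "norm (p - q) = norm w" by (simp_all add: w_def norm_minus_commute)
  have "(norm w)\<^sup>2 = (x - y) \<bullet> w + ((x - p) \<bullet> (q - p) + (y - q) \<bullet> (p - q))"
    unfolding power2_norm_eq_inner w_def by (simp add: inner_diff inner_commute algebra_simps)
  also have "\<dots> \<le> norm (x - y) * norm w + (infdist x A + infdist y A) / (2 * R) * (norm w)\<^sup>2"
    using 1 2 norm_cauchy_schwarz[of "x - y" w] unfolding n by (simp add: add_divide_distrib distrib_right)
  finally have "norm w * (norm w * (1 - (infdist x A + infdist y A) / (2 * R))) \<le> norm w * norm (x - y)"
    by (simp add: power2_eq_square algebra_simps)
  then show ?thesis
    by (cases "w = 0") (auto simp: w_def p_def q_def)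
qed

text \<open>Stewart's theorem. Its negative term is the quantitative strict convexity of the
  norm.\<close>

lemma norm_convex_comb_sq:
  fixes a b :: "'a::real_inner"
  shows "(norm ((1 - s) *\<^sub>R a + s *\<^sub>R b))\<^sup>2 =
    (1 - s) * (norm a)\<^sup>2 + s * (norm b)\<^sup>2 - s * (1 - s) * (norm (a - b))\<^sup>2"
  unfolding power2_norm_eq_inner
  by (simp add: inner_add inner_diff inner_commute algebra_simps)

text \<open>Averaging the projection inequality over \<open>a\<close> and \<open>b\<close>, with the
  weights of the convex combination, gives a quadratic inequality for the distance. It is sharp: for
  a chord of a circle of radius \<open>R\<close> it expresses the power of a point.\<close>

lemma infdist_convex_comb:
  assumes A: "prox_regular R A" and R: "R > 0" and ab: "a \<in> A" "b \<in> A"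
    and s: "0 \<le> s" "s \<le> 1" and xR: "infdist ((1 - s) *\<^sub>R a + s *\<^sub>R b) A < R"
  shows "2 * R * infdist ((1 - s) *\<^sub>R a + s *\<^sub>R b) A \<le>
    (infdist ((1 - s) *\<^sub>R a + s *\<^sub>R b) A)\<^sup>2 + s * (1 - s) * (norm (a - b))\<^sup>2"
proof -
  define x where "x = (1 - s) *\<^sub>R a + s *\<^sub>R b"
  define p where "p = proj A R x"
  define d where "d = infdist x A"
  have xp: "x - p = (1 - s) *\<^sub>R (a - p) + s *\<^sub>R (b - p)" by (simp add: x_def algebra_simps)
  have nxp: "norm (x - p) = d" using norm_diff_proj[OF A] xR unfolding x_def d_def p_def by blast
  have d0: "d \<ge> 0" by (simp add: d_def infdist_nonneg)
  have i: "(x - p) \<bullet> (y - p) \<le> d * (norm (y - p))\<^sup>2 / (2 * R)" if "y \<in> A" for y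
    using proj_inner_le[OF A _ that] xR unfolding x_def d_def p_def by blast
  have "d\<^sup>2 = (x - p) \<bullet> (x - p)" by (simp add: nxp flip: power2_norm_eq_inner)
  also have "\<dots> = (1 - s) * ((x - p) \<bullet> (a - p)) + s * ((x - p) \<bullet> (b - p))"
    by (subst (2) xp) (simp add: inner_add_right)
  also have "\<dots> \<le> (1 - s) * (d * (norm (a - p))\<^sup>2 / (2 * R)) + s * (d * (norm (b - p))\<^sup>2 / (2 * R))"
    using i ab s by (intro add_mono mult_left_mono) auto
  also have "\<dots> = d / (2 * R) * ((1 - s) * (norm (a - p))\<^sup>2 + s * (norm (b - p))\<^sup>2)"
    by (simp add: add_divide_distrib distrib_left mult_ac)
  also have "(1 - s) * (norm (a - p))\<^sup>2 + s * (norm (b - p))\<^sup>2 = d\<^sup>2 + s * (1 - s) * (norm (a - b))\<^sup>2"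
    using norm_convex_comb_sq[of s "a - p" "b - p"] nxp xp by simp
  finally have "d * (2 * R * d) \<le> d * (d\<^sup>2 + s * (1 - s) * (norm (a - b))\<^sup>2)"
    using R by (simp add: field_simps power2_eq_square)
  moreover have "0 \<le> s * (1 - s) * (norm (a - b))\<^sup>2" using s by simp
  ultimately have "2 * R * d \<le> d\<^sup>2 + s * (1 - s) * (norm (a - b))\<^sup>2"
    using d0 by (cases "d = 0") auto
  then show ?thesis by (simp add: d_def x_def)
qed

section \<open>Short paths in a prox-regular set\<close>

text \<open>Speed at most 1, rather than exactly 1, permits waiting at the end point. Hence the
  property is monotone in \<open>L\<close>, and projected paths need no parametrization by arc
  length.\<close>

definition lip_joined :: "'a::real_normed_vector set \<Rightarrow> 'a \<Rightarrow> 'a \<Rightarrow> real \<Rightarrow> bool" where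
  "lip_joined A x y L \<longleftrightarrow> 0 \<le> L \<and> (\<exists>g. g 0 = x \<and> g L = y \<and> g ` {0..L} \<subseteq> A \<and>
     (\<forall>s\<in>{0..L}. \<forall>t\<in>{0..L}. norm (g s - g t) \<le> \<bar>s - t\<bar>))"

text \<open>A bound on the intrinsic distance without arithmetic in \<open>ennreal\<close>; see \<open>intrinsic_dist_le_iff\<close>.\<close>

definition path_dist_le :: "'a::real_normed_vector set \<Rightarrow> 'a \<Rightarrow> 'a \<Rightarrow> real \<Rightarrow> bool" where
  "path_dist_le A x y c \<longleftrightarrow> (\<forall>e>0. lip_joined A x y (c + e))"

lemma lip_joined_of_lipschitz:
  assumes uv: "u \<le> v" and K: "K \<ge> 0" and gA: "g ` {u..v} \<subseteq> A"
    and lip: "\<And>s t. s \<in> {u..v} \<Longrightarrow> t \<in> {u..v} \<Longrightarrow> norm (g s - g t) \<le> K * \<bar>s - t\<bar>"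
  shows "lip_joined A (g u) (g v) (K * (v - u))"
proof (cases "K = 0")
  case True
  then have "g u = g v" using lip[of u v] uv by simp
  then show ?thesis using True gA uv unfolding lip_joined_def by (auto intro!: exI[of _ "\<lambda>_. g v"])
next
  case False
  then have K: "K > 0" using K by simp
  have in_uv: "u + t / K \<in> {u..v}" if "t \<in> {0..K * (v - u)}" for t
    using that K by (auto simp: field_simps)
  show ?thesis unfolding lip_joined_def
  proof (intro conjI exI[of _ "\<lambda>t. g (u + t / K)"] ballI)
    fix s t assume st: "s \<in> {0..K * (v - u)}" "t \<in> {0..K * (v - u)}"
    have "norm (g (u + s / K) - g (u + t / K)) \<le> K * \<bar>(u + s / K) - (u + t / K)\<bar>"
      using st in_uv by (intro lip)
    also have "(u + s / K) - (u + t / K) = (s - t) / K" by (simp add: diff_divide_distrib)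
    also have "K * \<bar>(s - t) / K\<bar> = \<bar>s - t\<bar>" using K by simp
    finally show "norm (g (u + s / K) - g (u + t / K)) \<le> \<bar>s - t\<bar>" .
  qed (use K uv in_uv gA in auto)
qed

lemma lip_joined_refl: "x \<in> A \<Longrightarrow> lip_joined A x x 0"
  unfolding lip_joined_def by (auto intro!: exI[of _ "\<lambda>_. x"])

lemma lip_joined_trans:
  assumes "lip_joined A x y L" "lip_joined A y z M"
  shows "lip_joined A x z (L + M)"
proof -
  obtain g where g: "0 \<le> L" "g 0 = x" "g L = y" "\<And>t. 0 \<le> t \<Longrightarrow> t \<le> L \<Longrightarrow> g t \<in> A"
    "\<And>s t. 0 \<le> s \<Longrightarrow> s \<le> L \<Longrightarrow> 0 \<le> t \<Longrightarrow> t \<le> L \<Longrightarrow> norm (g s - g t) \<le> \<bar>s - t\<bar>"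
    using assms(1) unfolding lip_joined_def by (auto simp: image_subset_iff)
  obtain h where h: "0 \<le> M" "h 0 = y" "h M = z" "\<And>t. 0 \<le> t \<Longrightarrow> t \<le> M \<Longrightarrow> h t \<in> A"
    "\<And>s t. 0 \<le> s \<Longrightarrow> s \<le> M \<Longrightarrow> 0 \<le> t \<Longrightarrow> t \<le> M \<Longrightarrow> norm (h s - h t) \<le> \<bar>s - t\<bar>"
    using assms(2) unfolding lip_joined_def by (auto simp: image_subset_iff)
  define k where "k t = (if t \<le> L then g t else h (t - L))" for t
  have cross: "norm (k s - k t) \<le> \<bar>s - t\<bar>" if "0 \<le> s" "s \<le> L" "L < t" "t \<le> L + M" for s t
  proof -
    have "k s - k t = (g s - g L) + (h 0 - h (t - L))" using that g h by (simp add: k_def)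
    then have "norm (k s - k t) \<le> norm (g s - g L) + norm (h 0 - h (t - L))"
      by (metis norm_triangle_ineq)
    also have "\<dots> \<le> \<bar>s - L\<bar> + \<bar>0 - (t - L)\<bar>"
      using that g(1) h(1) by (intro add_mono g(5) h(5)) linarith+
    finally show ?thesis using that by simp
  qed
  have "norm (k s - k t) \<le> \<bar>s - t\<bar>" if "s \<in> {0..L + M}" "t \<in> {0..L + M}" for s t
  proof -
    consider "s \<le> L" "t \<le> L" | "s \<le> L" "t > L" | "s > L" "t \<le> L" | "s > L" "t > L" by linarith
    then show ?thesis
    proof cases
      case 1 then show ?thesis using g(5)[of s t] that by (simp add: k_def)
    next
      case 2 then show ?thesis using cross[of s t] that by simp
    next
      case 3 then show ?thesis using cross[of t s] that by (simp add: norm_minus_commute)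
    next
      case 4 then show ?thesis using h(5)[of "s - L" "t - L"] that by (simp add: k_def)
    qed
  qed
  moreover have "k (L + M) = z" using g h by (cases "M = 0") (auto simp: k_def)
  moreover have "k ` {0..L + M} \<subseteq> A" using g(4) h(4) by (auto simp: k_def)
  ultimately show ?thesis unfolding lip_joined_def using g h
    by (intro conjI exI[of _ k]) (auto simp: k_def)
qed

lemma lip_joined_mono:
  assumes "lip_joined A x y L" "L \<le> M"
  shows "lip_joined A x y M"
proof -
  have y: "y \<in> A" and L: "L \<ge> 0" using assms unfolding lip_joined_def by auto
  have "lip_joined A ((\<lambda>_. y) 0) ((\<lambda>_. y) (M - L)) (1 * (M - L - 0))"
    by (rule lip_joined_of_lipschitz) (use y assms in auto)
  then show ?thesis using lip_joined_trans[OF assms(1)] by fastforce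
qed

lemma lip_joined_norm_le: "lip_joined A x y L \<Longrightarrow> norm (x - y) \<le> L"
  unfolding lip_joined_def
  by (metis (no_types) abs_minus_commute abs_of_nonneg atLeastAtMost_iff diff_zero order_refl)

lemma path_dist_le_of_lip_joined: "lip_joined A x y L \<Longrightarrow> path_dist_le A x y L"
  unfolding path_dist_le_def using lip_joined_mono by fastforce

lemma path_dist_le_trans:
  assumes "path_dist_le A x y c" "path_dist_le A y z c'"
  shows "path_dist_le A x z (c + c')"
  unfolding path_dist_le_def
proof (intro allI impI)
  fix e :: real assume "e > 0"
  then have "lip_joined A x y (c + e/2)" "lip_joined A y z (c' + e/2)"
    using assms unfolding path_dist_le_def by simp_all
  from lip_joined_trans[OF this] show "lip_joined A x z (c + c' + e)" by (simp add: algebra_simps)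
qed

lemma path_dist_le_mono: "path_dist_le A x y c \<Longrightarrow> c \<le> c' \<Longrightarrow> path_dist_le A x y c'"
  unfolding path_dist_le_def using lip_joined_mono by (metis add_right_mono)

lemma path_dist_le_closed:
  assumes "\<And>e. e > 0 \<Longrightarrow> path_dist_le A x y (c + e)"
  shows "path_dist_le A x y c"
  unfolding path_dist_le_def
proof (intro allI impI)
  fix e :: real assume "e > 0"
  then have "lip_joined A x y ((c + e/2) + e/2)"
    using assms[of "e/2"] unfolding path_dist_le_def by (metis half_gt_zero)
  then show "lip_joined A x y (c + e)" by (simp add: algebra_simps)
qed

lemma path_dist_le_norm_le: "path_dist_le A x y c \<Longrightarrow> norm (x - y) \<le> c"
  unfolding path_dist_le_def using lip_joined_norm_le by (metis field_le_epsilon)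

text \<open>The nearer end point is at most half a chord away, so the distance \<open>d\<close> is
  below \<open>R\<close>. Then \<open>d\<^sup>2 \<le> R * d\<close> makes the quadratic inequality
  of \<open>infdist_convex_comb\<close> linear.\<close>

lemma infdist_segment:
  assumes A: "prox_regular R A" and R: "R > 0" and xy: "x \<in> A" "y \<in> A" "norm (x - y) < 2 * R"
    and t: "0 \<le> t" "t \<le> 1"
  shows "infdist ((1 - t) *\<^sub>R x + t *\<^sub>R y) A < R"
    and "infdist ((1 - t) *\<^sub>R x + t *\<^sub>R y) A \<le> (norm (x - y))\<^sup>2 / (4 * R)"
proof -
  define z where "z = (1 - t) *\<^sub>R x + t *\<^sub>R y"
  define d where "d = infdist z A"
  define l where "l = norm (x - y)"
  have zx: "z - x = t *\<^sub>R (y - x)" and zy: "z - y = (1 - t) *\<^sub>R (x - y)" by (simp_all add: z_def algebra_simps)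
  have "d \<le> t * l" using infdist_le_norm[OF xy(1), of z] t 
    by (simp add: d_def l_def zx norm_minus_commute)
  moreover have "d \<le> (1 - t) * l" using infdist_le_norm[OF xy(2), of z] t 
    by (simp add: d_def l_def zy)
  ultimately have "2 * d \<le> l" by (simp add: algebra_simps)
  then have dR: "d < R" using xy by (simp add: l_def)
  then show "infdist ((1 - t) *\<^sub>R x + t *\<^sub>R y) A < R" by (simp add: d_def z_def)
  have d0: "d \<ge> 0" by (simp add: d_def infdist_nonneg)
  have "2 * R * d \<le> d\<^sup>2 + t * (1 - t) * l\<^sup>2"
    using infdist_convex_comb[OF A R xy(1,2) t] dR unfolding d_def z_def l_def by blast
  also have "d\<^sup>2 \<le> R * d" using d0 dR by (simp add: power2_eq_square mult_right_mono)
  also have "t * (1 - t) * l\<^sup>2 \<le> 1/4 * l\<^sup>2"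
  proof (rule mult_right_mono)
    have "0 \<le> (t - 1/2)\<^sup>2" by simp
    then show "t * (1 - t) \<le> 1/4" by (simp add: power2_eq_square algebra_simps)
  qed simp
  finally have "d \<le> l\<^sup>2 / (4 * R)" using R by (simp add: field_simps)
  then show "infdist ((1 - t) *\<^sub>R x + t *\<^sub>R y) A \<le> (norm (x - y))\<^sup>2 / (4 * R)"
    by (simp add: d_def z_def l_def)
qed

lemma proj_segment_lipschitz:
  assumes A: "prox_regular R A" and R: "R > 0" and xy: "x \<in> A" "y \<in> A" "norm (x - y) < 2 * R"
    and st: "s \<in> {0..1}" "t \<in> {0..1}"
  shows "norm (proj A R ((1 - s) *\<^sub>R x + s *\<^sub>R y) - proj A R ((1 - t) *\<^sub>R x + t *\<^sub>R y))
    \<le> norm (x - y) / (1 - (norm (x - y))\<^sup>2 / (4 * R\<^sup>2)) * \<bar>s - t\<bar>"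
proof -
  define z where "z t = (1 - t) *\<^sub>R x + t *\<^sub>R y" for t
  define l where "l = norm (x - y)"
  have d: "infdist (z t) A < R" "infdist (z t) A \<le> l\<^sup>2 / (4 * R)" if "t \<in> {0..1}" for t
    using infdist_segment[OF A R xy, of t] that unfolding z_def l_def by auto
  have "l\<^sup>2 < (2 * R)\<^sup>2" using xy(3) by (intro power_strict_mono) (auto simp: l_def)
  then have l1: "l\<^sup>2 / (4 * R\<^sup>2) < 1" using R by (simp add: power2_eq_square)
  have "norm (proj A R (z s) - proj A R (z t)) * (1 - l\<^sup>2 / (4 * R\<^sup>2))
      \<le> norm (proj A R (z s) - proj A R (z t)) * (1 - (infdist (z s) A + infdist (z t) A) / (2 * R))"
  proof (rule mult_left_mono)
    have "(infdist (z s) A + infdist (z t) A) / (2 * R) \<le> (l\<^sup>2 / (4 * R) + l\<^sup>2 / (4 * R)) / (2 * R)"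
      using d st R by (intro divide_right_mono add_mono) auto
    then show "1 - l\<^sup>2 / (4 * R\<^sup>2) \<le> 1 - (infdist (z s) A + infdist (z t) A) / (2 * R)"
      by (simp add: power2_eq_square)
  qed simp
  also have "\<dots> \<le> norm (z s - z t)" using d st by (intro proj_lipschitz[OF A R])
  also have "z s - z t = (t - s) *\<^sub>R (x - y)" by (simp add: z_def algebra_simps)
  also have "norm \<dots> = l * \<bar>s - t\<bar>" by (simp add: l_def abs_minus_commute)
  finally have "norm (proj A R (z s) - proj A R (z t)) \<le> l / (1 - l\<^sup>2 / (4 * R\<^sup>2)) * \<bar>s - t\<bar>"
    using l1 by (simp add: pos_le_divide_eq)
  then show ?thesis by (simp add: z_def l_def)
qed

text \<open>The path is the projected segment. For a chord of length \<open>l\<close> it is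
  stretched by a factor \<open>1 + O(l\<^sup>2)\<close>, so the excess over the chord is of third
  order and becomes negligible after subdividing.\<close>

lemma lip_joined_near:
  assumes A: "prox_regular R A" and R: "R > 0" and xy: "x \<in> A" "y \<in> A" "norm (x - y) < 2 * R"
  shows "lip_joined A x y (norm (x - y) / (1 - (norm (x - y))\<^sup>2 / (4 * R\<^sup>2)))"
proof -
  let ?q = "\<lambda>t. proj A R ((1 - t) *\<^sub>R x + t *\<^sub>R y)"
  have "(norm (x - y))\<^sup>2 < (2 * R)\<^sup>2" using xy(3) by (intro power_strict_mono) auto
  then have l1: "(norm (x - y))\<^sup>2 / (4 * R\<^sup>2) < 1" using R by (simp add: power2_eq_square)
  have "lip_joined A (?q 0) (?q 1) (norm (x - y) / (1 - (norm (x - y))\<^sup>2 / (4 * R\<^sup>2)) * (1 - 0))"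
  proof (rule lip_joined_of_lipschitz)
    show "?q ` {0..1} \<subseteq> A" using infdist_segment(1)[OF A R xy] by (auto intro!: proj_in[OF A])
    show "0 \<le> norm (x - y) / (1 - (norm (x - y))\<^sup>2 / (4 * R\<^sup>2))" using l1 by simp
  qed (use proj_segment_lipschitz[OF A R xy] in auto)
  then show ?thesis using proj_of_mem[OF A R] xy by simp
qed

text \<open>Relative form of the preceding bound: for \<open>u = l\<^sup>2 / (4 * R\<^sup>2)\<close>
  the last assumption says \<open>u * (1 + e) \<le> e\<close>, which amounts to
  \<open>1 / (1 - u) \<le> 1 + e\<close>.\<close>

lemma lip_joined_near':
  assumes A: "prox_regular R A" and R: "R > 0" and xy: "x \<in> A" "y \<in> A" "norm (x - y) < 2 * R"
    and e: "e \<ge> 0" "(norm (x - y))\<^sup>2 * (1 + e) \<le> 4 * R\<^sup>2 * e"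
  shows "lip_joined A x y ((1 + e) * norm (x - y))"
proof (rule lip_joined_mono[OF lip_joined_near[OF A R xy]])
  define u where "u = (norm (x - y))\<^sup>2 / (4 * R\<^sup>2)"
  have "(norm (x - y))\<^sup>2 < (2 * R)\<^sup>2" using xy(3) by (intro power_strict_mono) auto
  then have u1: "u < 1" using R by (simp add: u_def power2_eq_square)
  have "u * (1 + e) \<le> e" using e R by (simp add: u_def field_simps)
  then have "1 \<le> (1 + e) * (1 - u)" by (simp add: algebra_simps)
  then have "norm (x - y) * 1 \<le> norm (x - y) * ((1 + e) * (1 - u))" by (intro mult_left_mono) auto
  then have "norm (x - y) / (1 - u) \<le> (1 + e) * norm (x - y)" using u1 
    by (simp add: pos_divide_le_eq mult_ac)
  then show "norm (x - y) / (1 - (norm (x - y))\<^sup>2 / (4 * R\<^sup>2)) \<le> (1 + e) * norm (x - y)"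
    by (simp add: u_def)
qed

text \<open>The point is chosen on the projected segment by the intermediate value theorem, since for the
  projection of the midpoint the two distances may differ.\<close>

lemma equidistant_point:
  assumes A: "prox_regular R A" and R: "R > 0" and ab: "a \<in> A" "b \<in> A" "norm (a - b) < 2 * R"
  shows "\<exists>p\<in>A. norm (p - a) = norm (p - b) \<and> (norm (p - a))\<^sup>2 \<le> (norm (a - b))\<^sup>2 / 2 \<and>
    2 * arcsin (norm (p - a) / (2 * R)) \<le> arcsin (norm (a - b) / (2 * R))"
proof -
  define z where "z t = (1 - t) *\<^sub>R a + t *\<^sub>R b" for t
  define q where "q t = proj A R (z t)" for t
  define l where "l = norm (a - b)"
  have "l\<^sup>2 < (2 * R)\<^sup>2" using ab(3) by (intro power_strict_mono) (auto simp: l_def)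
  then have l2: "l\<^sup>2 < 4 * R\<^sup>2" by (simp add: power2_eq_square)
  then have l1: "l\<^sup>2 / (4 * R\<^sup>2) < 1" using R by simp
  have "(l / (1 - l\<^sup>2 / (4 * R\<^sup>2)))-lipschitz_on {0..1} q"
    using proj_segment_lipschitz[OF A R ab] l1 unfolding q_def z_def l_def
    by (intro lipschitz_onI) (auto simp: dist_norm)
  then have qc: "continuous_on {0..1} q" by (rule lipschitz_on_continuous_on)
  have q01: "q 0 = a" "q 1 = b" using proj_of_mem[OF A R] ab by (auto simp: q_def z_def)
  have "\<exists>t\<ge>0. t \<le> 1 \<and> norm (q t - a) - norm (q t - b) = 0"
    by (rule IVT') (auto simp: q01 intro!: continuous_intros qc)
  then obtain t where t: "0 \<le> t" "t \<le> 1" "norm (q t - a) = norm (q t - b)" by auto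
  define p where "p = q t"
  define x where "x = norm (p - a)"
  define d where "d = infdist (z t) A"
  have dR: "d < R" "d \<le> l\<^sup>2 / (4 * R)" 
    using infdist_segment[OF A R ab t(1,2)] by (simp_all add: d_def z_def l_def)
  have pA: "p \<in> A" unfolding p_def q_def using proj_in[OF A] dR(1) d_def by blast
  have d0: "d \<ge> 0" by (simp add: d_def infdist_nonneg)
  have xb: "norm (p - b) = x" using t(3) by (simp add: x_def p_def)
  have zp: "z t - p = (1 - t) *\<^sub>R (a - p) + t *\<^sub>R (b - p)" by (simp add: z_def algebra_simps)
  have nzp: "norm (z t - p) = d" unfolding p_def q_def d_def using norm_diff_proj[OF A] dR(1) d_def by blast
  have d2: "d\<^sup>2 = x\<^sup>2 - t * (1 - t) * l\<^sup>2"
    using norm_convex_comb_sq[of t "a - p" "b - p"] xb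
    unfolding zp[symmetric] nzp by (simp add: l_def x_def norm_minus_commute algebra_simps)
  have quarter: "t * (1 - t) * l\<^sup>2 \<le> 1/4 * l\<^sup>2"
  proof (rule mult_right_mono)
    have "0 \<le> (t - 1/2)\<^sup>2" by simp
    then show "t * (1 - t) \<le> 1/4" by (simp add: power2_eq_square algebra_simps)
  qed simp
  have dx: "2 * R * d \<le> x\<^sup>2"
    using infdist_convex_comb[OF A R ab(1,2) t(1,2)] dR(1) d2 unfolding d_def z_def l_def by simp
  \<comment> \<open>The bound \<open>xl\<close> has two uses: halving the squared chord makes the
    later recursion stop, and it keeps the angle \<open>\<alpha>\<close> below pi/4, so that
    \<open>arcsin\<close> inverts \<open>sin (2 * \<alpha>)\<close>.\<close>
  have "d\<^sup>2 \<le> (l\<^sup>2 / (4 * R))\<^sup>2" using dR d0 by (intro power_mono) auto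
  also have "\<dots> = l\<^sup>2 / 4 * (l\<^sup>2 / (4 * R\<^sup>2))" by (simp add: power2_eq_square)
  also have "\<dots> \<le> l\<^sup>2 / 4 * 1" using l1 by (intro mult_left_mono) auto
  finally have xl: "x\<^sup>2 \<le> l\<^sup>2 / 2" using d2 quarter by simp
  define w where "w = x / (2 * R)"
  have w0: "w \<ge> 0" using R by (simp add: w_def x_def)
  have w2: "w\<^sup>2 = x\<^sup>2 / (4 * R\<^sup>2)" by (simp add: w_def power_divide power_mult_distrib)
  have "w\<^sup>2 \<le> (l\<^sup>2 / 2) / (4 * R\<^sup>2)" unfolding w2 using xl by (intro divide_right_mono) auto
  also have "\<dots> < 1/2" using l1 by simp
  finally have whalf: "w\<^sup>2 < 1/2" .
  \<comment> \<open>By equidistance \<open>d2\<close> is free of mixed terms. Bounding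
    \<open>d\<close> through \<open>dx\<close> and \<open>t * (1 - t)\<close> by 1/4 eliminates both
    unknowns; with \<open>w = sin \<alpha>\<close> the remaining inequality is the double-angle
    formula \<open>sin (2 * \<alpha>) \<le> l / (2 * R)\<close>.\<close>
  have "(2 * R * d)\<^sup>2 \<le> (x\<^sup>2)\<^sup>2" using dx R d0 by (intro power_mono) auto
  then have "d\<^sup>2 \<le> (x\<^sup>2)\<^sup>2 / (4 * R\<^sup>2)" using R by (simp add: field_simps power2_eq_square)
  also have "\<dots> = x\<^sup>2 * w\<^sup>2" unfolding w2 by (simp add: power2_eq_square)
  finally have "4 * (x\<^sup>2 * (1 - w\<^sup>2)) \<le> l\<^sup>2" using d2 quarter by (simp add: algebra_simps)
  then have "4 * (x\<^sup>2 * (1 - w\<^sup>2)) / (4 * R\<^sup>2) \<le> l\<^sup>2 / (4 * R\<^sup>2)" by (intro divide_right_mono) auto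
  then have key: "4 * (w\<^sup>2 * (1 - w\<^sup>2)) \<le> (l / (2 * R))\<^sup>2"
    by (simp add: w2 power_divide power_mult_distrib)
  define \<alpha> where "\<alpha> = arcsin w"
  have "w\<^sup>2 \<le> (sqrt 2 / 2)\<^sup>2" using whalf by (simp add: power_divide)
  then have ws: "w \<le> sqrt 2 / 2" by (rule power2_le_imp_le) simp
  have w1: "w \<le> 1" using whalf w0 power2_le_imp_le[of w 1] by simp
  have sin\<alpha>: "sin \<alpha> = w" using w0 w1 by (simp add: \<alpha>_def)
  have "\<alpha> \<le> arcsin (sin (pi/4))" unfolding \<alpha>_def
    by (rule arcsin_le_arcsin) (use ws w0 in \<open>simp_all add: sin_45[symmetric]\<close>)
  also have "\<dots> = pi / 4" by (rule arcsin_sin) auto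
  finally have \<alpha>4: "\<alpha> \<le> pi / 4" .
  have \<alpha>0: "\<alpha> \<ge> 0" using w0 w1 by (simp add: \<alpha>_def arcsin_nonneg)
  have "(sin (2 * \<alpha>))\<^sup>2 = 4 * (w\<^sup>2 * (1 - w\<^sup>2))"
    by (simp add: sin_double power_mult_distrib cos_squared_eq sin\<alpha>)
  with key have "(sin (2 * \<alpha>))\<^sup>2 \<le> (l / (2 * R))\<^sup>2" by simp
  then have "sin (2 * \<alpha>) \<le> l / (2 * R)" by (rule power2_le_imp_le) (use R in \<open>simp add: l_def\<close>)
  then have "arcsin (sin (2 * \<alpha>)) \<le> arcsin (l / (2 * R))"
    using R ab(3) by (intro arcsin_le_arcsin) (auto simp: l_def)
  also have "arcsin (sin (2 * \<alpha>)) = 2 * \<alpha>" using \<alpha>0 \<alpha>4 pi_gt_zero by (intro arcsin_sin) linarith+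
  finally show ?thesis using pA t(3) xl
    by (intro bexI[of _ p]) (auto simp: \<alpha>_def w_def x_def l_def p_def)
qed

lemma arcsin_ge_self:
  assumes "0 \<le> x" "x \<le> 1"
  shows "x \<le> arcsin x"
  using sin_x_le_x[of "arcsin x"] assms arcsin_nonneg by simp

text \<open>Replacing a chord by the two chords to an equidistant point does not increase the total
  length \<open>f\<close> of the arcs of radius \<open>R\<close> above the chords, and at least
  halves the squared chord. After \<open>k\<close> levels the chords are so short that
  \<open>lip_joined_near'\<close> applies with relative error \<open>e\<close>, and a chord is no
  longer than its arc.\<close>

lemma path_dist_le_arcsin:
  assumes A: "prox_regular R A" and R: "R > 0" and ab: "a \<in> A" "b \<in> A" "norm (a - b) < 2 * R"
  shows "path_dist_le A a b (2 * R * arcsin (norm (a - b) / (2 * R)))"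
proof -
  define f where "f l = 2 * R * arcsin (l / (2 * R))" for l
  have fge: "l \<le> f l" if "0 \<le> l" "l \<le> 2 * R" for l
    using arcsin_ge_self[of "l / (2 * R)"] that R by (simp add: f_def field_simps)
  have main: "lip_joined A a b ((1 + e) * f (norm (a - b)))"
    if "e > 0" "a \<in> A" "b \<in> A" "norm (a - b) < 2 * R" "(norm (a - b))\<^sup>2 * (1 + e) \<le> 2 ^ k * (4 * R\<^sup>2 * e)"
    for e k a b
    using that(2-)
  proof (induction k arbitrary: a b)
    case 0
    then have "lip_joined A a b ((1 + e) * norm (a - b))"
      using that(1) by (intro lip_joined_near'[OF A R]) auto
    then show ?case
      by (rule lip_joined_mono) (use fge[of "norm (a - b)"] 0 that(1) in auto)
  next
    case (Suc k)
    obtain p where p: "p \<in> A" "norm (p - a) = norm (p - b)" "(norm (p - a))\<^sup>2 \<le> (norm (a - b))\<^sup>2 / 2"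
      "2 * arcsin (norm (p - a) / (2 * R)) \<le> arcsin (norm (a - b) / (2 * R))"
      using equidistant_point[OF A R Suc.prems(1-3)] by blast
    have "(norm (p - a))\<^sup>2 \<le> (norm (a - b))\<^sup>2"
      using p(3) zero_le_power2[of "norm (a - b)"] by linarith
    then have "norm (p - a) \<le> norm (a - b)" by (rule power2_le_imp_le) simp
    then have lt: "norm (p - a) < 2 * R" using Suc.prems(3) by simp
    have "(norm (p - a))\<^sup>2 * (1 + e) \<le> (norm (a - b))\<^sup>2 / 2 * (1 + e)"
      using p(3) that(1) by (intro mult_right_mono) auto
    also have "\<dots> \<le> 2 ^ k * (4 * R\<^sup>2 * e)" using Suc.prems(4) by simp
    finally have small: "(norm (p - a))\<^sup>2 * (1 + e) \<le> 2 ^ k * (4 * R\<^sup>2 * e)" .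
    have "lip_joined A a p ((1 + e) * f (norm (p - a)))"
      using Suc.IH[OF Suc.prems(1) p(1)] lt small by (simp add: norm_minus_commute)
    moreover have "lip_joined A p b ((1 + e) * f (norm (p - a)))"
      using Suc.IH[OF p(1) Suc.prems(2)] lt small p(2) by simp
    ultimately have "lip_joined A a b ((1 + e) * f (norm (p - a)) + (1 + e) * f (norm (p - a)))"
      by (rule lip_joined_trans)
    then show ?case
    proof (rule lip_joined_mono)
      have "2 * f (norm (p - a)) \<le> f (norm (a - b))" using p(4) R by (simp add: f_def)
      then have "(1 + e) * (2 * f (norm (p - a))) \<le> (1 + e) * f (norm (a - b))"
        using that(1) by (intro mult_left_mono) auto
      then show "(1 + e) * f (norm (p - a)) + (1 + e) * f (norm (p - a)) \<le> (1 + e) * f (norm (a - b))"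
        by (simp add: algebra_simps)
    qed
  qed
  define F where "F = f (norm (a - b))"
  have F0: "F \<ge> 0" using fge[of "norm (a - b)"] ab norm_ge_zero[of "a - b"] unfolding F_def by linarith
  have "lip_joined A a b (F + e)" if e: "e > 0" for e
  proof -
    \<comment> \<open>Turns the absolute error \<open>e\<close> into a relative one; the summand 1
      guards against \<open>F = 0\<close>.\<close>
    define e' where "e' = e / (F + 1)"
    have e': "e' > 0" using e F0 by (simp add: e'_def)
    have c0: "4 * R\<^sup>2 * e' > 0" using R e' by simp
    obtain k :: nat where "(norm (a - b))\<^sup>2 * (1 + e') / (4 * R\<^sup>2 * e') < 2 ^ k"
      using real_arch_pow[of 2] by auto
    then have "(norm (a - b))\<^sup>2 * (1 + e') \<le> 2 ^ k * (4 * R\<^sup>2 * e')"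
      using c0 by (simp add: pos_divide_less_eq less_imp_le)
    from main[OF e' ab this] have "lip_joined A a b ((1 + e') * F)" by (simp add: F_def)
    then show ?thesis
    proof (rule lip_joined_mono)
      have "e' * F \<le> e" using e F0 by (simp add: e'_def field_simps)
      then show "(1 + e') * F \<le> F + e" by (simp add: algebra_simps)
    qed
  qed
  then show ?thesis unfolding path_dist_le_def F_def f_def by blast
qed

section \<open>Stability of nearly shortest curves\<close>

text \<open>Bisecting \<open>k\<close> times divides the total quadratic error by \<open>2\<^sup>k\<close>.\<close>

lemma path_dist_le_of_local:
  fixes q :: "real \<Rightarrow> 'a::real_normed_vector" and G :: "real \<Rightarrow> real \<Rightarrow> real"
  assumes super: "\<And>u w v. 0 \<le> u \<Longrightarrow> u < w \<Longrightarrow> w < v \<Longrightarrow> v \<le> 1 \<Longrightarrow> G u w + G w v \<le> G u v"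
    and local: "\<And>u v. 0 \<le> u \<Longrightarrow> u < v \<Longrightarrow> v \<le> 1 \<Longrightarrow> v - u \<le> h \<Longrightarrow>
      path_dist_le A (q u) (q v) (G u v + C * (v - u)\<^sup>2)"
    and h: "h > 0" and uv: "0 \<le> u" "u < v" "v \<le> 1"
  shows "path_dist_le A (q u) (q v) (G u v)"
proof -
  have halve: "path_dist_le A (q u) (q v) (G u v + C * (v - u)\<^sup>2 / 2 ^ k)"
    if "0 \<le> u" "u < v" "v \<le> 1" "v - u \<le> h" for u v k
    using that
  proof (induction k arbitrary: u v)
    case 0 then show ?case using local by simp
  next
    case (Suc k)
    define w where "w = (u + v) / 2"
    have w: "u < w" "w < v" "w - u \<le> h" "v - w \<le> h" "w - u = (v - u) / 2" "v - w = (v - u) / 2"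
      using Suc.prems by (auto simp: w_def field_simps)
    have "path_dist_le A (q u) (q v)
      ((G u w + C * (w - u)\<^sup>2 / 2 ^ k) + (G w v + C * (v - w)\<^sup>2 / 2 ^ k))"
      using Suc.prems w(1-4) by (intro path_dist_le_trans[of A "q u" "q w"] Suc.IH) auto
    then show ?case
    proof (rule path_dist_le_mono)
      have "G u w + G w v \<le> G u v" using Suc.prems w(1-4) by (intro super)
      moreover have "C * (w - u)\<^sup>2 / 2 ^ k + C * (v - w)\<^sup>2 / 2 ^ k = C * (v - u)\<^sup>2 / 2 ^ Suc k"
        unfolding w(5,6) by (simp add: power_divide)
      ultimately show "G u w + C * (w - u)\<^sup>2 / 2 ^ k + (G w v + C * (v - w)\<^sup>2 / 2 ^ k)
        \<le> G u v + C * (v - u)\<^sup>2 / 2 ^ Suc k" by linarith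
    qed
  qed
  have base: "path_dist_le A (q u) (q v) (G u v)" if "0 \<le> u" "u < v" "v \<le> 1" "v - u \<le> h" for u v
  proof (rule path_dist_le_closed)
    fix e :: real assume e: "e > 0"
    obtain k :: nat where "C * (v - u)\<^sup>2 / e < 2 ^ k" using real_arch_pow[of 2] by auto
    then have "C * (v - u)\<^sup>2 / 2 ^ k \<le> e" using e by (simp add: field_simps)
    then show "path_dist_le A (q u) (q v) (G u v + e)"
      using path_dist_le_mono[OF halve[OF that]] by simp
  qed
  obtain k :: nat where k: "(v - u) / h < 2 ^ k" using real_arch_pow[of 2] by auto
  \<comment> \<open>A second bisection, now free of errors, passes from intervals of length at most
    \<open>h\<close> to arbitrary ones.\<close>
  have "path_dist_le A (q u) (q v) (G u v)" if "0 \<le> u" "u < v" "v \<le> 1" "v - u \<le> 2 ^ k * h" for u v k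
    using that
  proof (induction k arbitrary: u v)
    case 0 then show ?case using base by simp
  next
    case (Suc k)
    define w where "w = (u + v) / 2"
    have w: "u < w" "w < v" "w - u \<le> 2 ^ k * h" "v - w \<le> 2 ^ k * h"
      using Suc.prems by (auto simp: w_def field_simps)
    have "path_dist_le A (q u) (q v) (G u w + G w v)"
      using Suc.prems w by (intro path_dist_le_trans[of A "q u" "q w"] Suc.IH) auto
    then show ?case using super[of u w v] Suc.prems w path_dist_le_mono by simp
  qed
  from this[of u v k] show ?thesis using uv k h by (simp add: field_simps)
qed

lemma subdivision_mem:
  assumes "subdivision c d n t" "k \<le> n"
  shows "t k \<in> {c..d}"
  using assms unfolding subdivision_def strict_mono_on_def
  by (metis atLeastAtMost_iff atMost_iff le0 nle_le order.order_iff_strict)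

lemma subdivision_less:
  assumes "subdivision c d n t" "k < n"
  shows "t k < t (Suc k)"
  using assms unfolding subdivision_def strict_mono_on_def by auto

lemma path_dist_le_sum:
  assumes t: "subdivision c d n t" and n: "n > 0"
    and le: "\<And>u v. c \<le> u \<Longrightarrow> u < v \<Longrightarrow> v \<le> d \<Longrightarrow> path_dist_le A (q u) (q v) (G u v)"
  shows "path_dist_le A (q c) (q d) (\<Sum>k<n. G (t k) (t (Suc k)))"
proof -
  have step: "path_dist_le A (q (t k)) (q (t (Suc k))) (G (t k) (t (Suc k)))" if "k < n" for k
    using that le subdivision_less[OF t that] subdivision_mem[OF t, of k] subdivision_mem[OF t, of "Suc k"] by auto
  have "path_dist_le A (q (t 0)) (q (t (Suc m))) (\<Sum>k<Suc m. G (t k) (t (Suc k)))" if "Suc m \<le> n" for m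
    using that
  proof (induction m)
    case 0 then show ?case using step[of 0] by simp
  next
    case (Suc m)
    then show ?case using path_dist_le_trans[OF Suc.IH step[of "Suc m"]] by simp
  qed
  from this[of "n - 1"] show ?thesis using n t by (simp add: subdivision_def)
qed

text \<open>Convexity of |x|^2 / h in the pair (x, h). Refining a subdivision therefore never
  decreases the sums in \<open>V2\<close>, and a negative multiple of their terms is superadditive
  as \<open>path_dist_le_of_local\<close> requires.\<close>

lemma norm_sq_div_add_le:
  fixes x y :: "'a::real_normed_vector"
  assumes "h > 0" "k > 0"
  shows "(norm (x + y))\<^sup>2 / (h + k) \<le> (norm x)\<^sup>2 / h + (norm y)\<^sup>2 / k"
proof -
  define a b where "a = norm x" and "b = norm y"
  have "(norm (x + y))\<^sup>2 \<le> (a + b)\<^sup>2"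
    unfolding a_def b_def by (intro power_mono norm_triangle_ineq) auto
  moreover have "0 \<le> (a * k - b * h)\<^sup>2" by simp
  moreover have "(a\<^sup>2 / h + b\<^sup>2 / k) * (h + k) = (a + b)\<^sup>2 + (a * k - b * h)\<^sup>2 / (h * k)"
    using assms by (simp add: field_simps power2_eq_square)
  ultimately have "(norm (x + y))\<^sup>2 \<le> (a\<^sup>2 / h + b\<^sup>2 / k) * (h + k)"
    using assms by (smt (verit) divide_nonneg_pos mult_pos_pos)
  then show ?thesis using assms by (simp add: pos_divide_le_eq a_def b_def)
qed

text \<open>An infinitesimal form of Wirtinger's inequality: \<open>\<psi> = \<omega> cot(\<omega> t + \<delta>)\<close> solves the Riccati equation
  \<open>\<psi>' = -(\<omega>\<^sup>2 + \<psi>\<^sup>2)\<close>, so \<open>(\<psi> |g|\<^sup>2)' \<le> |g'|\<^sup>2 - \<omega>\<^sup>2 |g|\<^sup>2\<close>.\<close>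

lemma wirtinger_local:
  fixes g :: "real \<Rightarrow> 'a::real_inner"
  assumes \<omega>: "0 < \<omega>" "\<omega> < pi" and K: "K \<ge> 0"
    and lip: "\<And>s t. s \<in> {0..1} \<Longrightarrow> t \<in> {0..1} \<Longrightarrow> norm (g s - g t) \<le> K * \<bar>s - t\<bar>"
    and g0: "g 0 = 0"
  obtains \<psi> C where "\<And>u v. 0 \<le> u \<Longrightarrow> u < v \<Longrightarrow> v \<le> 1 \<Longrightarrow>
    \<omega>\<^sup>2 * (v - u) * ((norm (g u))\<^sup>2 + (norm (g v))\<^sup>2) / 2 \<le>
    (norm (g v - g u))\<^sup>2 / (v - u) - (\<psi> v * (norm (g v))\<^sup>2 - \<psi> u * (norm (g u))\<^sup>2) + C * (v - u)\<^sup>2"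
proof -
  \<comment> \<open>Centres the range of \<open>\<omega> * t + \<delta>\<close> at pi/2. As its
    length \<open>\<omega>\<close> is below pi, the range avoids the poles of
    \<open>cot\<close>.\<close>
  define \<delta> where "\<delta> = pi / 2 - \<omega> / 2"
  define \<psi> where "\<psi> t = \<omega> * cot (\<omega> * t + \<delta>)" for t
  have arg: "0 < \<omega> * t + \<delta>" "\<omega> * t + \<delta> < pi" if "t \<in> {0..1}" for t
  proof -
    have "\<omega> * t \<le> \<omega> * 1" "0 \<le> \<omega> * t" using that \<omega> by (auto intro!: mult_left_mono)
    then show "0 < \<omega> * t + \<delta>" using \<omega> unfolding \<delta>_def by linarith
    have "\<omega> * t \<le> \<omega>" using \<open>\<omega> * t \<le> \<omega> * 1\<close> by simp
    then show "\<omega> * t + \<delta> < pi" using \<omega> unfolding \<delta>_def by linarith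
  qed
  have sin0: "sin (\<omega> * t + \<delta>) \<noteq> 0" if "t \<in> {0..1}" for t
    using arg[OF that] sin_gt_zero by fastforce
  have der: "(\<psi> has_real_derivative - (\<omega>\<^sup>2 + (\<psi> t)\<^sup>2)) (at t)" if "t \<in> {0..1}" for t
  proof -
    have "(\<psi> has_real_derivative \<omega> * (- inverse ((sin (\<omega> * t + \<delta>))\<^sup>2) * \<omega>)) (at t)"
      unfolding \<psi>_def
      by (rule derivative_eq_intros DERIV_chain2[OF DERIV_cot] refl sin0[OF that])+ simp
    also have "inverse ((sin (\<omega> * t + \<delta>))\<^sup>2) = 1 + (cot (\<omega> * t + \<delta>))\<^sup>2"
      using sin0[OF that]
      by (simp add: cot_def power_divide cos_squared_eq diff_divide_distrib inverse_eq_divide)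
    also have "\<omega> * (- (1 + (cot (\<omega> * t + \<delta>))\<^sup>2) * \<omega>) = - (\<omega>\<^sup>2 + (\<psi> t)\<^sup>2)"
      by (simp add: \<psi>_def power_mult_distrib power2_eq_square[of \<omega>] algebra_simps)
    finally show ?thesis .
  qed
  have "continuous_on {0..1} \<psi>"
    using der by (meson DERIV_isCont continuous_at_imp_continuous_on)
  then have "bounded (\<psi> ` {0..1})" by (intro compact_imp_bounded compact_continuous_image) auto
  then obtain B where B: "B > 0" "\<And>t. t \<in> {0..1} \<Longrightarrow> \<bar>\<psi> t\<bar> \<le> B"
    unfolding bounded_pos by auto
  define L where "L = \<omega>\<^sup>2 + B\<^sup>2"
  have L0: "L \<ge> 0" by (simp add: L_def)
  have \<psi>sq: "(\<psi> t)\<^sup>2 \<le> B\<^sup>2" if "t \<in> {0..1}" for t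
    using B(2)[OF that] abs_le_square_iff[of "\<psi> t" B] B(1) by simp
  have mvt: "\<exists>\<xi>. \<xi> \<in> {0..1} \<and> u < \<xi> \<and> \<xi> < v \<and> \<psi> v - \<psi> u = - ((v - u) * (\<omega>\<^sup>2 + (\<psi> \<xi>)\<^sup>2))"
    if "0 \<le> u" "u < v" "v \<le> 1" for u v
  proof -
    have "\<exists>\<xi>>u. \<xi> < v \<and> \<psi> v - \<psi> u = (v - u) * - (\<omega>\<^sup>2 + (\<psi> \<xi>)\<^sup>2)"
      by (rule MVT2[OF that(2)]) (use der that in auto)
    then obtain \<xi> where \<xi>: "u < \<xi>" "\<xi> < v" "\<psi> v - \<psi> u = (v - u) * - (\<omega>\<^sup>2 + (\<psi> \<xi>)\<^sup>2)" by blast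
    then show ?thesis using that by (intro exI[of _ \<xi>]) (simp add: algebra_simps)
  qed
  have \<psi>lip: "\<bar>\<psi> v - \<psi> u\<bar> \<le> (v - u) * L" if "0 \<le> u" "u < v" "v \<le> 1" for u v
  proof -
    from mvt[OF that] obtain \<xi> where \<xi>: "\<xi> \<in> {0..1}" "\<psi> v - \<psi> u = - ((v - u) * (\<omega>\<^sup>2 + (\<psi> \<xi>)\<^sup>2))" by blast
    have "(v - u) * (\<omega>\<^sup>2 + (\<psi> \<xi>)\<^sup>2) \<le> (v - u) * L"
      using that \<psi>sq[OF \<xi>(1)] by (intro mult_left_mono) (auto simp: L_def)
    moreover have "0 \<le> (v - u) * (\<omega>\<^sup>2 + (\<psi> \<xi>)\<^sup>2)" using that by simp
    ultimately show ?thesis unfolding \<xi>(2) by simp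
  qed
  \<comment> \<open>The mean value theorem gives the Riccati equation at an intermediate point;
    moving it to \<open>v\<close> costs an error of second order in \<open>v - u\<close>.\<close>
  have \<psi>step: "\<psi> v - \<psi> u \<le> - (v - u) * (\<omega>\<^sup>2 + (\<psi> v)\<^sup>2) + 2 * B * L * (v - u)\<^sup>2"
    if uv: "0 \<le> u" "u < v" "v \<le> 1" for u v
  proof -
    from mvt[OF uv] obtain \<xi> where \<xi>: "\<xi> \<in> {0..1}" "u < \<xi>" "\<xi> < v"
      "\<psi> v - \<psi> u = - ((v - u) * (\<omega>\<^sup>2 + (\<psi> \<xi>)\<^sup>2))" by blast
    have "(\<psi> v)\<^sup>2 - (\<psi> \<xi>)\<^sup>2 = (\<psi> v - \<psi> \<xi>) * (\<psi> v + \<psi> \<xi>)" by (simp add: power2_eq_square algebra_simps)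
    also have "\<dots> \<le> \<bar>\<psi> v - \<psi> \<xi>\<bar> * \<bar>\<psi> v + \<psi> \<xi>\<bar>" by (metis abs_ge_self abs_mult)
    also have "\<dots> \<le> ((v - u) * L) * (2 * B)"
    proof (intro mult_mono)
      have "\<bar>\<psi> v - \<psi> \<xi>\<bar> \<le> (v - \<xi>) * L" using \<xi> uv by (intro \<psi>lip) auto
      also have "\<dots> \<le> (v - u) * L" using \<xi> L0 by (intro mult_right_mono) auto
      finally show "\<bar>\<psi> v - \<psi> \<xi>\<bar> \<le> (v - u) * L" .
      show "\<bar>\<psi> v + \<psi> \<xi>\<bar> \<le> 2 * B" using B(2)[of v] B(2)[of \<xi>] \<xi> uv by auto
    qed (use uv L0 in auto)
    finally have "(v - u) * ((\<psi> v)\<^sup>2 - (\<psi> \<xi>)\<^sup>2) \<le> (v - u) * (((v - u) * L) * (2 * B))"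
      using uv by (intro mult_left_mono) auto
    then show ?thesis unfolding \<xi>(4) by (simp add: algebra_simps power2_eq_square)
  qed
  have gK: "norm (g t) \<le> K" if "t \<in> {0..1}" for t
  proof -
    have "norm (g t) \<le> K * \<bar>t\<bar>" using lip[of t 0] that g0 by simp
    also have "\<dots> \<le> K * 1" using that K by (intro mult_left_mono) auto
    finally show ?thesis by simp
  qed
  define C where "C = 2 * B * L * K\<^sup>2 + B * K\<^sup>2 + \<omega>\<^sup>2 * K\<^sup>2"
  have "\<omega>\<^sup>2 * (v - u) * ((norm (g u))\<^sup>2 + (norm (g v))\<^sup>2) / 2 \<le>
    (norm (g v - g u))\<^sup>2 / (v - u) - (\<psi> v * (norm (g v))\<^sup>2 - \<psi> u * (norm (g u))\<^sup>2) + C * (v - u)\<^sup>2"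
    if uv: "0 \<le> u" "u < v" "v \<le> 1" for u v
  proof -
    define h where "h = v - u"
    have h: "h > 0" using uv by (simp add: h_def)
    define \<Delta> where "\<Delta> = g v - g u"
    define N where "N = (norm (g u))\<^sup>2"
    have n\<Delta>: "norm \<Delta> \<le> K * h" using lip[of v u] uv by (simp add: \<Delta>_def h_def)
    have \<Delta>sq: "(norm \<Delta>)\<^sup>2 \<le> K\<^sup>2 * h\<^sup>2"
      using power_mono[OF n\<Delta>, of 2] by (simp add: power_mult_distrib)
    have NK: "N \<le> K\<^sup>2" unfolding N_def using gK[of u] uv by (intro power_mono) auto
    have N0: "N \<ge> 0" by (simp add: N_def)
    have Nv: "(norm (g v))\<^sup>2 = N + 2 * (g u \<bullet> \<Delta>) + (norm \<Delta>)\<^sup>2"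
      unfolding N_def \<Delta>_def power2_norm_eq_inner by (simp add: inner_diff inner_commute algebra_simps)
    \<comment> \<open>Completing the square: the discrete form of 2 \<psi> <g, g'> \<le> |g'|^2 +
      \<psi>^2 |g|^2.\<close>
    have "0 \<le> (norm (\<Delta> - (h * \<psi> v) *\<^sub>R g u))\<^sup>2" by simp
    also have "\<dots> = (norm \<Delta>)\<^sup>2 - h * (\<psi> v * (2 * (g u \<bullet> \<Delta>))) + h\<^sup>2 * ((\<psi> v)\<^sup>2 * N)"
      unfolding N_def power2_norm_eq_inner 
      by (simp add: inner_diff inner_commute algebra_simps power2_eq_square)
    finally have "h * (\<psi> v * (2 * (g u \<bullet> \<Delta>))) \<le> h * ((norm \<Delta>)\<^sup>2 / h + h * ((\<psi> v)\<^sup>2 * N))"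
      using h by (simp add: distrib_left power2_eq_square)
    then have c1: "\<psi> v * (2 * (g u \<bullet> \<Delta>)) \<le> (norm \<Delta>)\<^sup>2 / h + h * ((\<psi> v)\<^sup>2 * N)" using h by simp
    have "\<psi> v * (norm \<Delta>)\<^sup>2 \<le> B * (K\<^sup>2 * h\<^sup>2)"
      using B(2)[of v] B(1) \<Delta>sq uv by (intro mult_mono) auto
    note c2 = this
    have "(\<psi> v - \<psi> u) * N \<le> (- h * (\<omega>\<^sup>2 + (\<psi> v)\<^sup>2) + 2 * B * L * h\<^sup>2) * N"
      using \<psi>step[OF uv] N0 unfolding h_def by (intro mult_right_mono)
    also have "\<dots> = - h * (\<omega>\<^sup>2 + (\<psi> v)\<^sup>2) * N + 2 * B * L * h\<^sup>2 * N" by (simp add: algebra_simps)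
    also have "2 * B * L * h\<^sup>2 * N \<le> 2 * B * L * h\<^sup>2 * K\<^sup>2" using NK B L0 by (intro mult_left_mono) auto
    finally have c3: "(\<psi> v - \<psi> u) * N \<le> - h * (\<omega>\<^sup>2 + (\<psi> v)\<^sup>2) * N + 2 * B * L * h\<^sup>2 * K\<^sup>2" by simp
    have "(norm (g v))\<^sup>2 - N = (norm (g v) - norm (g u)) * (norm (g v) + norm (g u))"
      by (simp add: N_def power2_eq_square algebra_simps)
    also have "\<dots> \<le> (K * h) * (K + K)"
    proof (intro mult_mono add_mono gK)
      show "norm (g v) - norm (g u) \<le> K * h" using n\<Delta> norm_triangle_ineq2[of "g v" "g u"] by (simp add: \<Delta>_def)
    qed (use uv K h in auto)
    finally have "\<omega>\<^sup>2 * h * ((norm (g v))\<^sup>2 - N) / 2 \<le> \<omega>\<^sup>2 * h * ((K * h) * (K + K)) / 2"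
      using h by (intro divide_right_mono mult_left_mono) auto
    then have c4: "\<omega>\<^sup>2 * h * (N + (norm (g v))\<^sup>2) / 2 \<le> \<omega>\<^sup>2 * h * N + \<omega>\<^sup>2 * K\<^sup>2 * h\<^sup>2"
      by (simp add: algebra_simps power2_eq_square)
    have "\<psi> v * (norm (g v))\<^sup>2 - \<psi> u * N = (\<psi> v - \<psi> u) * N + \<psi> v * (2 * (g u \<bullet> \<Delta>)) + \<psi> v * (norm \<Delta>)\<^sup>2"
      unfolding Nv by (simp add: algebra_simps)
    moreover have "- h * (\<omega>\<^sup>2 + (\<psi> v)\<^sup>2) * N = - (\<omega>\<^sup>2 * h * N) - h * ((\<psi> v)\<^sup>2 * N)"
      by (simp add: algebra_simps)
    moreover have "C * h\<^sup>2 = 2 * B * L * h\<^sup>2 * K\<^sup>2 + B * (K\<^sup>2 * h\<^sup>2) + \<omega>\<^sup>2 * K\<^sup>2 * h\<^sup>2"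
      by (simp add: C_def algebra_simps)
    ultimately show ?thesis
      using c1 c2 c3 c4 unfolding h_def[symmetric] \<Delta>_def[symmetric] N_def[symmetric] by linarith
  qed
  then show thesis by (rule that)
qed

text \<open>First variation: \<open>\<sigma>\<close> is pushed towards \<open>\<tau>\<close> by the small amount \<open>s\<close> and projected back to \<open>A\<close>.
  Since \<open>A\<close> has reach \<open>R\<close>, projecting stretches by a factor \<open>1 + s |\<sigma> - \<tau>|\<^sup>2 / (2 R\<^sup>2)\<close> up to \<open>O(s\<^sup>2)\<close>,
  whereas the convex combination shortens because of the strict convexity of the norm.\<close>

lemma convex_comb_proj_step:
  fixes A :: "'a::real_inner set"
  assumes A: "prox_regular R A" and R: "R > 0" and M: "0 < M" "M \<le> 4 * R"
    and \<sigma>A: "\<sigma> ` {0..1} \<subseteq> A" and \<tau>A: "\<tau> ` {0..1} \<subseteq> A" and eq0: "\<sigma> 0 = \<tau> 0"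
    and \<sigma>lip: "\<And>s t. s \<in> {0..1} \<Longrightarrow> t \<in> {0..1} \<Longrightarrow> norm (\<sigma> s - \<sigma> t) \<le> M * \<bar>s - t\<bar>"
    and \<tau>lip: "\<And>s t. s \<in> {0..1} \<Longrightarrow> t \<in> {0..1} \<Longrightarrow> norm (\<tau> s - \<tau> t) \<le> M * \<bar>s - t\<bar>"
    and s: "0 < s" "s \<le> 1/128"
    and q_def: "\<And>t. q t = proj A R ((1 - s) *\<^sub>R \<sigma> t + s *\<^sub>R \<tau> t)"
    and g_def: "\<And>t. g t = \<sigma> t - \<tau> t"
    and uv: "0 \<le> u" "u < v" "v \<le> 1" and small: "v - u \<le> R / (2 * M)"
  shows "path_dist_le A (q u) (q v) (M * (v - u) * (1 + 2500 * s\<^sup>2)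
    + M * (v - u) * (s * (((norm (g u))\<^sup>2 + (norm (g v))\<^sup>2) / (4 * R\<^sup>2)))
    - s * (1 - s) * (norm (g v - g u))\<^sup>2 / (2 * M * (v - u)) + 4 * M ^ 3 / R\<^sup>2 * (v - u)\<^sup>2)"
proof -
  define h where "h = v - u"
  have h: "0 < h" "h \<le> 1" using uv by (auto simp: h_def)
  define x where "x t = (1 - s) *\<^sub>R \<sigma> t + s *\<^sub>R \<tau> t" for t
  define N where "N t = (norm (g t))\<^sup>2" for t
  define d where "d t = infdist (x t) A" for t
  have M2: "M\<^sup>2 \<le> 16 * R\<^sup>2" using power_mono[OF M(2), of 2] M(1) by (simp add: power_mult_distrib)
  have g2M: "norm (g t) \<le> 2 * M" if "t \<in> {0..1}" for t
  proof -
    have "g t = (\<sigma> t - \<sigma> 0) - (\<tau> t - \<tau> 0)" by (simp add: g_def eq0)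
    then have "norm (g t) \<le> norm (\<sigma> t - \<sigma> 0) + norm (\<tau> t - \<tau> 0)" by (metis norm_triangle_ineq4)
    also have "\<dots> \<le> M * \<bar>t - 0\<bar> + M * \<bar>t - 0\<bar>" using that by (intro add_mono \<sigma>lip \<tau>lip) auto
    also have "\<dots> \<le> 2 * M" using that M by (simp add: mult_left_le)
    finally show ?thesis .
  qed
  have N64: "N t \<le> 64 * R\<^sup>2" if "t \<in> {0..1}" for t
  proof -
    have "N t \<le> (2 * M)\<^sup>2" unfolding N_def using g2M[OF that] by (intro power_mono) auto
    then show ?thesis using M2 by (simp add: power_mult_distrib)
  qed
  have N0: "N t \<ge> 0" for t by (simp add: N_def)
  have d0: "d t \<ge> 0" for t by (simp add: d_def infdist_nonneg)
  \<comment> \<open>The crude bound \<open>s * norm (g t)\<close>, from the point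
    \<open>\<sigma> t\<close> of \<open>A\<close>, is fed back into the quadratic inequality of
    \<open>infdist_convex_comb\<close>; this yields the sharp leading term.\<close>
  have dt: "d t < R" "d t \<le> s * (1 + s) * N t / (2 * R)" if t: "t \<in> {0..1}" for t
  proof -
    have xs: "x t - \<sigma> t = - (s *\<^sub>R g t)" by (simp add: x_def g_def algebra_simps)
    have "d t \<le> norm (x t - \<sigma> t)" unfolding d_def using t \<sigma>A by (intro infdist_le_norm) auto
    then have ds: "d t \<le> s * norm (g t)" unfolding xs using s by simp
    also have "\<dots> \<le> (1/128) * (8 * R)" using s g2M[OF t] M by (intro mult_mono) auto
    finally show dR: "d t < R" using R by simp
    have "2 * R * d t \<le> (d t)\<^sup>2 + s * (1 - s) * N t"
      unfolding d_def x_def N_def g_def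
      by (rule infdist_convex_comb[OF A R]) (use t \<sigma>A \<tau>A s dR in \<open>auto simp: d_def x_def\<close>)
    also have "(d t)\<^sup>2 \<le> (s * norm (g t))\<^sup>2" using ds d0 by (intro power_mono) auto
    also have "(s * norm (g t))\<^sup>2 = s\<^sup>2 * N t" by (simp add: N_def power_mult_distrib)
    also have "s\<^sup>2 * N t + s * (1 - s) * N t \<le> s * (1 + s) * N t"
      using s N0[of t] by (simp add: algebra_simps power2_eq_square)
    finally show "d t \<le> s * (1 + s) * N t / (2 * R)" using R by (simp add: field_simps)
  qed
  have u01: "u \<in> {0..1}" and v01: "v \<in> {0..1}" using uv by auto
  define P where "P = (N u + N v) / (4 * R\<^sup>2)"
  define y where "y = (d u + d v) / (2 * R)"
  \<comment> \<open>An upper bound for \<open>1 / (1 - y)\<close>, which is at most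
    \<open>1 + y + 2 * y\<^sup>2\<close> for \<open>y \<le> 1/2\<close>. The first-order term is
    kept exactly; the quadratic ones sum to 32 + 2 * 33^2 = 2210, rounded up to 2500.\<close>
  define F where "F = 1 + s * P + 2500 * s\<^sup>2"
  have P: "0 \<le> P" "P \<le> 32" using N0 N64[OF u01] N64[OF v01] R by (auto simp: P_def field_simps)
  have y0: "y \<ge> 0" using d0[of u] d0[of v] R by (simp add: y_def)
  have "y \<le> (s * (1 + s) * N u / (2 * R) + s * (1 + s) * N v / (2 * R)) / (2 * R)"
    unfolding y_def using dt[OF u01] dt[OF v01] R by (intro divide_right_mono add_mono) auto
  also have "\<dots> = s * (1 + s) * P" using R by (simp add: P_def field_simps power2_eq_square)
  finally have yP: "y \<le> s * P + s\<^sup>2 * P" by (simp add: algebra_simps power2_eq_square)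
  have s2: "s\<^sup>2 \<le> s / 128" using s by (simp add: power2_eq_square mult_left_mono)
  have sP: "s * P \<le> s * 32" "s\<^sup>2 * P \<le> s\<^sup>2 * 32" using P s by (auto intro!: mult_left_mono)
  have y33: "y \<le> 33 * s" using yP sP s2 s by linarith
  then have yh: "y \<le> 1/2" using s by simp
  have "y\<^sup>2 \<le> (33 * s)\<^sup>2" using y33 y0 by (intro power_mono) auto
  then have y2: "2 * y\<^sup>2 \<le> 2178 * s\<^sup>2" by (simp add: power_mult_distrib)
  have F1: "1 + y + 2 * y\<^sup>2 \<le> F" using y2 yP sP zero_le_power2[of s] unfolding F_def by linarith
  have "1 \<le> (1 + y + 2 * y\<^sup>2) * (1 - y)"
  proof -
    have "(1 + y + 2 * y\<^sup>2) * (1 - y) = 1 + y\<^sup>2 * (1 - 2 * y)" by (simp add: power2_eq_square algebra_simps)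
    then show ?thesis using yh by simp
  qed
  also have "\<dots> \<le> F * (1 - y)" using F1 yh by (intro mult_right_mono) auto
  finally have F: "1 \<le> F * (1 - y)" .
  have F2: "F \<le> 2" using sP s s2 unfolding F_def by linarith
  have Fge1: "F \<ge> 1" using P s by (simp add: F_def)
  \<comment> \<open>The first-order saving: a squared length of at most (M h)^2 - 2 M h z gives a
    length of at most M h - z. The condition \<open>z \<le> M * h\<close> keeps the latter
    nonnegative.\<close>
  define z where "z = s * (1 - s) * (norm (g v - g u))\<^sup>2 / (2 * M * h)"
  have z0: "z \<ge> 0" using s M h by (simp add: z_def)
  have \<sigma>h: "norm (\<sigma> v - \<sigma> u) \<le> M * h" and \<tau>h: "norm (\<tau> v - \<tau> u) \<le> M * h"
    using \<sigma>lip[OF v01 u01] \<tau>lip[OF v01 u01] uv by (simp_all add: h_def)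
  have gvu: "g v - g u = (\<sigma> v - \<sigma> u) - (\<tau> v - \<tau> u)" by (simp add: g_def)
  have "norm (g v - g u) \<le> 2 * (M * h)" unfolding gvu
    using norm_triangle_ineq4[of "\<sigma> v - \<sigma> u" "\<tau> v - \<tau> u"] \<sigma>h \<tau>h by linarith
  then have "(norm (g v - g u))\<^sup>2 \<le> (2 * (M * h))\<^sup>2" by (intro power_mono) auto
  then have "s * (1 - s) * (norm (g v - g u))\<^sup>2 \<le> (1/128) * 1 * (2 * (M * h))\<^sup>2"
    using s by (intro mult_mono) auto
  then have "z \<le> (1/128) * 1 * (2 * (M * h))\<^sup>2 / (2 * M * h)"
    unfolding z_def using M h by (intro divide_right_mono) auto
  also have "\<dots> = M * h / 64" using M h by (simp add: power2_eq_square)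
  also have "\<dots> \<le> M * h" using M h by simp
  finally have zM: "z \<le> M * h" .
  have xvu: "x v - x u = (1 - s) *\<^sub>R (\<sigma> v - \<sigma> u) + s *\<^sub>R (\<tau> v - \<tau> u)" by (simp add: x_def algebra_simps)
  have "(norm (x v - x u))\<^sup>2 = (1 - s) * (norm (\<sigma> v - \<sigma> u))\<^sup>2 + s * (norm (\<tau> v - \<tau> u))\<^sup>2
      - s * (1 - s) * (norm (g v - g u))\<^sup>2"
    unfolding xvu gvu by (rule norm_convex_comb_sq)
  also have "\<dots> \<le> (1 - s) * (M * h)\<^sup>2 + s * (M * h)\<^sup>2 - s * (1 - s) * (norm (g v - g u))\<^sup>2"
    using \<sigma>h \<tau>h s by (intro diff_right_mono add_mono mult_left_mono power_mono) auto
  also have "s * (1 - s) * (norm (g v - g u))\<^sup>2 = 2 * (M * h) * z" using M h by (simp add: z_def)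
  also have "(1 - s) * (M * h)\<^sup>2 + s * (M * h)\<^sup>2 - 2 * (M * h) * z \<le> (M * h - z)\<^sup>2"
    by (simp add: power2_eq_square algebra_simps)
  finally have nx: "norm (x v - x u) \<le> M * h - z" using zM by (intro power2_le_imp_le[of "norm (x v - x u)"]) auto
  have qx: "q t = proj A R (x t)" for t by (simp add: q_def x_def)
  have "norm (q v - q u) * (1 - y) \<le> norm (x v - x u)"
    using proj_lipschitz[OF A R, of "x v" "x u"] dt[OF u01] dt[OF v01]
    unfolding qx y_def d_def by (simp add: add.commute)
  then have "norm (q v - q u) * (1 - y) * F \<le> (M * h - z) * F"
    using nx Fge1 by (intro mult_right_mono) auto
  moreover have "norm (q v - q u) * 1 \<le> norm (q v - q u) * (F * (1 - y))"
    using F by (intro mult_left_mono) auto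
  ultimately have l1: "norm (q v - q u) \<le> (M * h - z) * F" by (simp add: mult_ac)
  also have "\<dots> \<le> M * h * F - z" using Fge1 z0 mult_left_mono[of 1 F z] by (simp add: algebra_simps)
  finally have l2: "norm (q v - q u) \<le> M * h * F - z" .
  have "(M * h - z) * F \<le> (M * h) * 2" using F2 z0 zM Fge1 by (intro mult_mono) auto
  with l1 have l3: "norm (q v - q u) \<le> 2 * M * h" by simp
  define l where "l = norm (q v - q u)"
  have qA: "q u \<in> A" "q v \<in> A" unfolding qx using dt u01 v01 by (auto intro!: proj_in[OF A] simp: d_def)
  have "2 * M * h \<le> R" using small M by (simp add: h_def field_simps)
  then have lR: "l \<le> R" using l3 by (simp add: l_def)
  have l0: "l \<ge> 0" by (simp add: l_def)
  \<comment> \<open>The relative price of passing from the chord between \<open>q u\<close> and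
    \<open>q v\<close> to a path in \<open>A\<close>. Since \<open>l\<close> is of order
    \<open>h\<close>, the absolute price is cubic in \<open>h\<close>, and \<open>small\<close>
    ensures \<open>l \<le> R\<close>.\<close>
  define e where "e = l\<^sup>2 / (2 * R\<^sup>2)"
  have e0: "e \<ge> 0" by (simp add: e_def)
  have "l\<^sup>2 \<le> R\<^sup>2" using lR l0 by (intro power_mono)
  then have e1: "e \<le> 1/2" using R by (simp add: e_def field_simps)
  have l2e: "l\<^sup>2 = 2 * R\<^sup>2 * e" using R by (simp add: e_def)
  have "lip_joined A (q u) (q v) ((1 + e) * norm (q u - q v))"
  proof (rule lip_joined_near'[OF A R qA _ e0])
    show "norm (q u - q v) < 2 * R" using lR R by (simp add: l_def norm_minus_commute)
    have "2 * R\<^sup>2 * e * (1 + e) \<le> 2 * R\<^sup>2 * e * 2" using e0 e1 by (intro mult_left_mono) auto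
    then show "(norm (q u - q v))\<^sup>2 * (1 + e) \<le> 4 * R\<^sup>2 * e"
      using l2e by (simp add: l_def norm_minus_commute)
  qed
  then have "path_dist_le A (q u) (q v) ((1 + e) * l)"
    by (intro path_dist_le_of_lip_joined) (simp add: l_def norm_minus_commute)
  then show ?thesis
  proof (rule path_dist_le_mono)
    have "e * l = l ^ 3 / (2 * R\<^sup>2)" by (simp add: e_def power3_eq_cube power2_eq_square)
    also have "\<dots> \<le> (2 * M * h) ^ 3 / (2 * R\<^sup>2)" using l3 l0 unfolding l_def by (intro divide_right_mono power_mono) auto
    also have "\<dots> = 4 * M ^ 3 / R\<^sup>2 * h ^ 3" using R by (simp add: power_mult_distrib field_simps)
    also have "\<dots> \<le> 4 * M ^ 3 / R\<^sup>2 * h\<^sup>2"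
      using M h by (intro mult_left_mono power_decreasing) auto
    finally have "(1 + e) * l \<le> M * h * F - z + 4 * M ^ 3 / R\<^sup>2 * h\<^sup>2"
      using l2 by (simp add: l_def algebra_simps)
    also have "M * h * F = M * h * (1 + 2500 * s\<^sup>2) + M * h * (s * P)" by (simp add: F_def algebra_simps)
    finally show "(1 + e) * l \<le> M * (v - u) * (1 + 2500 * s\<^sup>2)
      + M * (v - u) * (s * (((norm (g u))\<^sup>2 + (norm (g v))\<^sup>2) / (4 * R\<^sup>2)))
      - s * (1 - s) * (norm (g v - g u))\<^sup>2 / (2 * M * (v - u)) + 4 * M ^ 3 / R\<^sup>2 * (v - u)\<^sup>2"
      unfolding h_def[symmetric] by (simp add: P_def N_def z_def)
  qed
qed

text \<open>The coefficient \<open>s * (1 - s) / (2 * M)\<close> of the saving is split as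
  \<open>B + K\<close>. The part \<open>K\<close> pays, through Wirtinger's inequality, for the
  stretching by the projection; the part \<open>B\<close> remains. Nonnegativity of \<open>B\<close>
  makes the bound superadditive, so local estimates add up along the subdivision.\<close>

lemma first_variation:
  fixes A :: "'a::real_inner set"
  assumes A: "prox_regular R A" and R: "R > 0" and M: "0 < M" "M \<le> 4 * R"
    and \<sigma>A: "\<sigma> ` {0..1} \<subseteq> A" and \<tau>A: "\<tau> ` {0..1} \<subseteq> A"
    and ends: "\<sigma> 0 = a" "\<tau> 0 = a" "\<sigma> 1 = b" "\<tau> 1 = b"
    and \<sigma>lip: "\<And>s t. s \<in> {0..1} \<Longrightarrow> t \<in> {0..1} \<Longrightarrow> norm (\<sigma> s - \<sigma> t) \<le> M * \<bar>s - t\<bar>"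
    and \<tau>lip: "\<And>s t. s \<in> {0..1} \<Longrightarrow> t \<in> {0..1} \<Longrightarrow> norm (\<tau> s - \<tau> t) \<le> M * \<bar>s - t\<bar>"
    and s: "0 < s" "s \<le> 1/128" and \<omega>: "0 < \<omega>" "\<omega> < pi"
    and B_def: "B = s * (1 - s) / (2 * M) - M * s / (2 * R\<^sup>2 * \<omega>\<^sup>2)" and B: "B \<ge> 0"
    and g_def: "\<And>t. g t = \<sigma> t - \<tau> t"
    and sub: "subdivision 0 1 n t"
  shows "path_dist_le A a b (M * (1 + 2500 * s\<^sup>2) -
    B * (\<Sum>k<n. (norm (g (t (Suc k)) - g (t k)))\<^sup>2 / (t (Suc k) - t k)))"
proof -
  define q where "q t = proj A R ((1 - s) *\<^sub>R \<sigma> t + s *\<^sub>R \<tau> t)" for t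
  define N where "N t = (norm (g t))\<^sup>2" for t
  define K where "K = M * s / (2 * R\<^sup>2 * \<omega>\<^sup>2)"
  have K0: "K \<ge> 0" using M s by (simp add: K_def)
  have glip: "norm (g s - g t) \<le> 2 * M * \<bar>s - t\<bar>" if "s \<in> {0..1}" "t \<in> {0..1}" for s t
  proof -
    have "g s - g t = (\<sigma> s - \<sigma> t) - (\<tau> s - \<tau> t)" by (simp add: g_def)
    then have "norm (g s - g t) \<le> norm (\<sigma> s - \<sigma> t) + norm (\<tau> s - \<tau> t)" by (metis norm_triangle_ineq4)
    also have "\<dots> \<le> M * \<bar>s - t\<bar> + M * \<bar>s - t\<bar>" using that by (intro add_mono \<sigma>lip \<tau>lip) auto
    finally show ?thesis by simp
  qed
  have g01: "g 0 = 0" "g 1 = 0" using ends by (simp_all add: g_def)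
  obtain \<psi> C where W: "\<And>u v. 0 \<le> u \<Longrightarrow> u < v \<Longrightarrow> v \<le> 1 \<Longrightarrow>
    \<omega>\<^sup>2 * (v - u) * (N u + N v) / 2 \<le>
    (norm (g v - g u))\<^sup>2 / (v - u) - (\<psi> v * N v - \<psi> u * N u) + C * (v - u)\<^sup>2"
    unfolding N_def
    using wirtinger_local[OF \<omega>, of "2 * M" g] glip g01(1) M by (metis less_eq_real_def mult_nonneg_nonneg zero_le_numeral)
  \<comment> \<open>The terms that telescope. The contribution of \<open>\<psi>\<close> vanishes at
    both ends because \<open>g\<close> does.\<close>
  define \<Gamma> where "\<Gamma> t = M * (1 + 2500 * s\<^sup>2) * t - K * (\<psi> t * N t)" for t
  define G where "G u v = (\<Gamma> v - \<Gamma> u) - B * ((norm (g v - g u))\<^sup>2 / (v - u))" for u v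
  have le: "path_dist_le A (q u) (q v) (G u v)" if uv: "0 \<le> u" "u < v" "v \<le> 1" for u v
  proof (rule path_dist_le_of_local[OF _ _ _ uv, where h = "R / (2 * M)" and C = "4 * M ^ 3 / R\<^sup>2 + K * C"])
    fix u w v :: real assume uwv: "0 \<le> u" "u < w" "w < v" "v \<le> 1"
    have "(norm (g v - g u))\<^sup>2 / (v - u) \<le> (norm (g w - g u))\<^sup>2 / (w - u) + (norm (g v - g w))\<^sup>2 / (v - w)"
      using norm_sq_div_add_le[of "w - u" "v - w" "g w - g u" "g v - g w"] uwv by simp
    then have "B * ((norm (g v - g u))\<^sup>2 / (v - u)) \<le> B * ((norm (g w - g u))\<^sup>2 / (w - u) + (norm (g v - g w))\<^sup>2 / (v - w))"
      using B by (rule mult_left_mono)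
    then show "G u w + G w v \<le> G u v" by (simp add: G_def distrib_left)
  next
    fix u v :: real assume uv: "0 \<le> u" "u < v" "v \<le> 1" "v - u \<le> R / (2 * M)"
    have "path_dist_le A (q u) (q v) (M * (v - u) * (1 + 2500 * s\<^sup>2)
      + M * (v - u) * (s * ((N u + N v) / (4 * R\<^sup>2)))
      - s * (1 - s) * (norm (g v - g u))\<^sup>2 / (2 * M * (v - u)) + 4 * M ^ 3 / R\<^sup>2 * (v - u)\<^sup>2)"
      unfolding N_def
      by (rule convex_comb_proj_step[OF A R M \<sigma>A \<tau>A _ \<sigma>lip \<tau>lip s q_def g_def uv]) (use ends in auto)
    then show "path_dist_le A (q u) (q v) (G u v + (4 * M ^ 3 / R\<^sup>2 + K * C) * (v - u)\<^sup>2)"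
    proof (rule path_dist_le_mono)
      have "M * (v - u) * (s * ((N u + N v) / (4 * R\<^sup>2))) = K * (\<omega>\<^sup>2 * (v - u) * (N u + N v) / 2)"
        using \<omega> by (simp add: K_def)
      also have "\<dots> \<le> K * ((norm (g v - g u))\<^sup>2 / (v - u) - (\<psi> v * N v - \<psi> u * N u) + C * (v - u)\<^sup>2)"
        using W[OF uv(1-3)] K0 by (rule mult_left_mono)
      finally have 1: "M * (v - u) * (s * ((N u + N v) / (4 * R\<^sup>2))) \<le>
        K * ((norm (g v - g u))\<^sup>2 / (v - u)) - (K * (\<psi> v * N v) - K * (\<psi> u * N u)) + K * C * (v - u)\<^sup>2"
        by (simp add: algebra_simps)
      have 2: "s * (1 - s) * (norm (g v - g u))\<^sup>2 / (2 * M * (v - u)) = (B + K) * ((norm (g v - g u))\<^sup>2 / (v - u))"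
        by (simp add: B_def K_def)
      have 3: "G u v = M * (v - u) * (1 + 2500 * s\<^sup>2) - (K * (\<psi> v * N v) - K * (\<psi> u * N u))
         - B * ((norm (g v - g u))\<^sup>2 / (v - u))"
        by (simp add: G_def \<Gamma>_def algebra_simps)
      show "M * (v - u) * (1 + 2500 * s\<^sup>2) + M * (v - u) * (s * ((N u + N v) / (4 * R\<^sup>2)))
        - s * (1 - s) * (norm (g v - g u))\<^sup>2 / (2 * M * (v - u)) + 4 * M ^ 3 / R\<^sup>2 * (v - u)\<^sup>2
        \<le> G u v + (4 * M ^ 3 / R\<^sup>2 + K * C) * (v - u)\<^sup>2"
        using 1 unfolding 2 3 distrib_right by linarith
    qed
  qed (use R M in auto)
  have n: "n > 0" using sub by (cases n) (auto simp: subdivision_def)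
  have q01: "q 0 = a" "q 1 = b"
  proof -
    have "a \<in> A" "b \<in> A" using ends \<sigma>A by (auto simp: image_subset_iff)
    then have "proj A R a = a" "proj A R b = b" using proj_of_mem[OF A R] by auto
    moreover have "(1 - s) *\<^sub>R c + s *\<^sub>R c = c" for c :: 'a by (simp add: algebra_simps)
    ultimately show "q 0 = a" "q 1 = b" using ends by (simp_all add: q_def)
  qed
  have "path_dist_le A (q 0) (q 1) (\<Sum>k<n. G (t k) (t (Suc k)))"
    by (rule path_dist_le_sum[OF sub n le])
  also have "(\<Sum>k<n. G (t k) (t (Suc k))) = (\<Sum>k<n. \<Gamma> (t (Suc k)) - \<Gamma> (t k))
    - B * (\<Sum>k<n. (norm (g (t (Suc k)) - g (t k)))\<^sup>2 / (t (Suc k) - t k))"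
    by (simp add: G_def sum_subtractf sum_distrib_left)
  also have "(\<Sum>k<n. \<Gamma> (t (Suc k)) - \<Gamma> (t k)) = \<Gamma> 1 - \<Gamma> 0"
    using sub by (simp add: sum_lessThan_telescope[of "\<lambda>k. \<Gamma> (t k)"] subdivision_def)
  also have "\<Gamma> 1 - \<Gamma> 0 = M * (1 + 2500 * s\<^sup>2)" by (simp add: \<Gamma>_def N_def g01)
  finally show ?thesis by (simp add: q01)
qed

section \<open>Near minimizers sharing one Lipschitz constant\<close>

definition lip_curve ::
  "'a::real_normed_vector set \<Rightarrow> real \<Rightarrow> 'a \<Rightarrow> 'a \<Rightarrow> (real \<Rightarrow> 'a) \<Rightarrow> bool" where
  "lip_curve A M a b \<sigma> \<longleftrightarrow> \<sigma> 0 = a \<and> \<sigma> 1 = b \<and> \<sigma> ` {0..1} \<subseteq> A \<and>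
    (\<forall>s\<in>{0..1}. \<forall>t\<in>{0..1}. norm (\<sigma> s - \<sigma> t) \<le> M * \<bar>s - t\<bar>)"

text \<open>No path in \<open>A\<close> is shorter than \<open>M - \<eta>\<close>, so the competitor
  of \<open>first_variation\<close> saves at most \<open>\<eta>\<close> plus its error of order s^2.
  Dividing by \<open>B\<close>, which is of order s, bounds the sum.\<close>

lemma near_minimizers_close:
  fixes A :: "'a::real_inner set"
  assumes A: "prox_regular R A" and R: "R > 0" and \<kappa>: "0 < \<kappa>" "\<kappa> < pi" and \<epsilon>: "\<epsilon> > 0"
  obtains \<eta> where "\<eta> > 0" "\<And>M a b \<sigma> \<tau> n t. 0 < M \<Longrightarrow> M \<le> \<kappa> * R \<Longrightarrow>
    lip_curve A M a b \<sigma> \<Longrightarrow> lip_curve A M a b \<tau> \<Longrightarrow>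
    (\<And>c. path_dist_le A a b c \<Longrightarrow> M - \<eta> \<le> c) \<Longrightarrow> subdivision 0 1 n t \<Longrightarrow>
    (\<Sum>k<n. (norm ((\<sigma> (t (Suc k)) - \<tau> (t (Suc k))) - (\<sigma> (t k) - \<tau> (t k))))\<^sup>2 / (t (Suc k) - t k)) \<le> \<epsilon>"
proof -
  define \<omega> where "\<omega> = (pi + \<kappa>) / 2"
  have \<omega>: "0 < \<omega>" "\<omega> < pi" "\<kappa> < \<omega>" using \<kappa> by (auto simp: \<omega>_def)
  \<comment> \<open>The gap left by Wirtinger's inequality with a frequency \<open>\<omega>\<close>
    strictly between \<open>\<kappa>\<close> and pi.\<close>
  define \<theta> where "\<theta> = 1 - \<kappa>\<^sup>2 / \<omega>\<^sup>2"
  have "\<kappa>\<^sup>2 < \<omega>\<^sup>2" using \<omega>(3) \<kappa> by (intro power_strict_mono) auto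
  then have \<theta>: "\<theta> > 0" using \<omega>(1) by (simp add: \<theta>_def)
  \<comment> \<open>In this order, the bounds meet the requirement of
    \<open>first_variation\<close>, give \<open>B \<ge> s * \<theta> / (4 * M)\<close>, and confine
    the s^2 error to \<open>\<epsilon> / 2\<close> after division by \<open>B\<close>. The choice of
    \<open>\<eta>\<close> below accounts for the other half.\<close>
  define s where "s = min (1/128) (min (\<theta> / 2) (\<theta> * \<epsilon> / (20000 * (\<kappa> * R)\<^sup>2)))"
  have s: "0 < s" "s \<le> 1/128" "s \<le> \<theta> / 2" "s \<le> \<theta> * \<epsilon> / (20000 * (\<kappa> * R)\<^sup>2)"
    using \<theta> \<epsilon> \<kappa> R by (auto simp: s_def)
  define \<eta> where "\<eta> = s * \<theta> * \<epsilon> / (8 * (\<kappa> * R))"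
  have \<eta>: "\<eta> > 0" using s \<theta> \<epsilon> \<kappa> R by (simp add: \<eta>_def)
  show thesis
  proof (rule that[OF \<eta>])
    fix M a b \<sigma> \<tau> n and t :: "nat \<Rightarrow> real"
    assume M: "0 < M" "M \<le> \<kappa> * R" and \<sigma>: "lip_curve A M a b \<sigma>" and \<tau>: "lip_curve A M a b \<tau>"
      and min: "\<And>c. path_dist_le A a b c \<Longrightarrow> M - \<eta> \<le> c" and sub: "subdivision 0 1 n t"
    define g where "g t = \<sigma> t - \<tau> t" for t
    define S where "S = (\<Sum>k<n. (norm (g (t (Suc k)) - g (t k)))\<^sup>2 / (t (Suc k) - t k))"
    define B where "B = s * (1 - s) / (2 * M) - M * s / (2 * R\<^sup>2 * \<omega>\<^sup>2)"
    have "\<kappa> * R \<le> 4 * R" using \<kappa> R pi_less_4 by (intro mult_right_mono) auto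
    then have M4: "M \<le> 4 * R" using M by simp
    have "M\<^sup>2 \<le> (\<kappa> * R)\<^sup>2" using M by (intro power_mono) auto
    then have "M\<^sup>2 / (R\<^sup>2 * \<omega>\<^sup>2) \<le> (\<kappa> * R)\<^sup>2 / (R\<^sup>2 * \<omega>\<^sup>2)" by (intro divide_right_mono) auto
    also have "\<dots> = 1 - \<theta>" using R by (simp add: power_mult_distrib \<theta>_def)
    finally have "\<theta> / 2 \<le> 1 - s - M\<^sup>2 / (R\<^sup>2 * \<omega>\<^sup>2)" using s(3) by linarith
    then have "s / (2 * M) * (\<theta> / 2) \<le> s / (2 * M) * (1 - s - M\<^sup>2 / (R\<^sup>2 * \<omega>\<^sup>2))"
      using s M by (intro mult_left_mono) auto
    also have "\<dots> = B" using M R \<omega> by (simp add: B_def field_simps power2_eq_square)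
    finally have B: "s * \<theta> / (4 * M) \<le> B" by simp
    have B0: "B \<ge> 0" using B s \<theta> M by (smt (verit) divide_nonneg_pos mult_pos_pos)
    have S0: "S \<ge> 0" unfolding S_def using subdivision_less[OF sub]
      by (intro sum_nonneg divide_nonneg_nonneg) (auto simp: less_imp_le)
    have "path_dist_le A a b (M * (1 + 2500 * s\<^sup>2) - B * S)"
      unfolding S_def
      by (rule first_variation[OF A R M(1) M4 _ _ _ _ _ _ _ _ s(1,2) \<omega>(1,2) B_def B0 g_def sub])
        (use \<sigma> \<tau> in \<open>auto simp: lip_curve_def\<close>)
    from min[OF this] have "M - \<eta> \<le> M * (1 + 2500 * s\<^sup>2) - B * S" .
    then have "B * S \<le> \<eta> + 2500 * M * s\<^sup>2" by (simp add: algebra_simps)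
    moreover have "s * \<theta> / (4 * M) * S \<le> B * S" using B S0 by (rule mult_right_mono)
    ultimately have "s * \<theta> / (4 * M) * S \<le> \<eta> + 2500 * M * s\<^sup>2" by linarith
    then have "S \<le> (4 * M) / (s * \<theta>) * (\<eta> + 2500 * M * s\<^sup>2)" using s \<theta> M by (simp add: field_simps)
    also have "\<dots> \<le> (4 * (\<kappa> * R)) / (s * \<theta>) * (\<eta> + 2500 * (\<kappa> * R) * s\<^sup>2)"
      using M s \<theta> \<eta> by (intro mult_mono divide_right_mono add_mono) auto
    also have "\<dots> = \<epsilon> / 2 + s * (10000 * (\<kappa> * R)\<^sup>2 / \<theta>)"
      using s \<theta> \<kappa> R by (simp add: \<eta>_def field_simps power2_eq_square)
    also have "s * (10000 * (\<kappa> * R)\<^sup>2 / \<theta>) \<le> \<theta> * \<epsilon> / (20000 * (\<kappa> * R)\<^sup>2) * (10000 * (\<kappa> * R)\<^sup>2 / \<theta>)"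
      using s \<theta> by (intro mult_right_mono) auto
    also have "\<dots> = \<epsilon> / 2" using \<theta> \<kappa> R by simp
    finally show "(\<Sum>k<n. (norm ((\<sigma> (t (Suc k)) - \<tau> (t (Suc k))) - (\<sigma> (t k) - \<tau> (t k))))\<^sup>2 / (t (Suc k) - t k)) \<le> \<epsilon>"
      by (simp add: S_def g_def)
  qed
qed

section \<open>Proximal smoothness of shortest curves\<close>

lemma arcsin_mvt:
  assumes "-1 < x" "x < y" "y \<le> 1"
  obtains \<xi> where "x < \<xi>" "\<xi> < y" "arcsin y - arcsin x = (y - x) / sqrt (1 - \<xi>\<^sup>2)"
proof -
  have "\<exists>l \<xi>. x < \<xi> \<and> \<xi> < y \<and> DERIV arcsin \<xi> :> l \<and> arcsin y - arcsin x = (y - x) * l"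
  proof (rule MVT[OF assms(2)])
    \<comment> \<open>Continuity up to the end admits \<open>y = 1\<close>, the case where the chord
      is a diameter and \<open>arcsin\<close> has no finite slope.\<close>
    show "continuous_on {x..y} arcsin"
      using assms by (intro continuous_on_subset[OF continuous_on_arcsin']) auto
    show "arcsin differentiable (at \<xi>)" if "x < \<xi>" "\<xi> < y" for \<xi>
      using DERIV_arcsin[of \<xi>] that assms by (metis less_le_trans less_trans real_differentiable_def)
  qed
  then obtain l \<xi> where *: "x < \<xi>" "\<xi> < y" "DERIV arcsin \<xi> :> l" "arcsin y - arcsin x = (y - x) * l" by blast
  moreover have "l = inverse (sqrt (1 - \<xi>\<^sup>2))"
    using DERIV_unique[OF *(3) DERIV_arcsin] * assms by auto
  ultimately show thesis using that by (simp add: divide_inverse)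
qed

text \<open>This amounts to the monotonicity of \<open>arcsin x / x\<close>.\<close>

lemma arc_strict_antimono_radius:
  assumes "0 < r" "r < R" "0 < l" "l \<le> 2 * r"
  shows "2 * R * arcsin (l / (2 * R)) < 2 * r * arcsin (l / (2 * r))"
proof -
  define x X where "x = l / (2 * R)" and "X = l / (2 * r)"
  have x: "0 < x" "x < X" "X \<le> 1" using assms by (auto simp: x_def X_def field_simps)
  obtain \<xi>0 where \<xi>0: "0 < \<xi>0" "\<xi>0 < x" "arcsin x - arcsin 0 = (x - 0) / sqrt (1 - \<xi>0\<^sup>2)"
    using arcsin_mvt[of 0 x] x by auto
  obtain \<xi> where \<xi>: "x < \<xi>" "\<xi> < X" "arcsin X - arcsin x = (X - x) / sqrt (1 - \<xi>\<^sup>2)"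
    using arcsin_mvt[of x X] x by auto
  \<comment> \<open>The derivative of \<open>arcsin\<close> increases, so its mean slope on
    \<open>{x..X}\<close> exceeds that on \<open>{0..x}\<close>.\<close>
  have "\<xi>0\<^sup>2 < \<xi>\<^sup>2" using \<xi>0 \<xi> by (intro power_strict_mono) auto
  moreover have "\<xi>\<^sup>2 < 1\<^sup>2" using \<xi> x by (intro power_strict_mono) auto
  ultimately have "1 / sqrt (1 - \<xi>0\<^sup>2) < 1 / sqrt (1 - \<xi>\<^sup>2)"
    by (intro divide_strict_left_mono mult_pos_pos) auto
  then have "(X - x) * (1 / sqrt (1 - \<xi>0\<^sup>2)) < (X - x) * (1 / sqrt (1 - \<xi>\<^sup>2))"
    using x by (intro mult_strict_left_mono) auto
  then have "X * (1 / sqrt (1 - \<xi>0\<^sup>2)) < arcsin X"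
    using \<xi>(3) \<xi>0(3) by (simp add: algebra_simps diff_divide_distrib)
  moreover have "1 / sqrt (1 - \<xi>0\<^sup>2) = arcsin x / x" using \<xi>0(3) x by simp
  ultimately have "2 * r * (X * (arcsin x / x)) < 2 * r * arcsin X"
    using assms by (intro mult_strict_left_mono) auto
  moreover have "2 * r * (X * (arcsin x / x)) = 2 * R * arcsin x"
    using assms by (simp add: x_def X_def)
  ultimately show ?thesis by (simp add: x_def X_def)
qed

text \<open>Triangle inequality for the angle on the unit sphere. Splitting \<open>u\<close> and
  \<open>w\<close> along and orthogonally to \<open>v\<close>, and applying Cauchy-Schwarz to the
  orthogonal parts, gives \<open>cos (\<alpha> + \<beta>) \<le> u \<bullet> w\<close>. If
  \<open>\<alpha> + \<beta>\<close> exceeds pi there is nothing to prove.\<close>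

lemma arccos_triangle:
  fixes u v w :: "'a::real_inner"
  assumes "norm u = 1" "norm v = 1" "norm w = 1"
  shows "arccos (u \<bullet> w) \<le> arccos (u \<bullet> v) + arccos (v \<bullet> w)"
proof -
  have bd: "\<bar>p \<bullet> q\<bar> \<le> 1" if "norm p = 1" "norm q = 1" for p q :: 'a
    using Cauchy_Schwarz_ineq2[of p q] that by simp
  note b = bd[OF assms(1,3)] bd[OF assms(1,2)] bd[OF assms(2,3)]
  define \<alpha> \<beta> where "\<alpha> = arccos (u \<bullet> v)" and "\<beta> = arccos (v \<bullet> w)"
  have \<alpha>\<beta>: "0 \<le> \<alpha>" "\<alpha> \<le> pi" "0 \<le> \<beta>" "\<beta> \<le> pi"
    using b by (auto simp: \<alpha>_def \<beta>_def abs_le_iff arccos_lbound arccos_ubound)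
  have c: "cos \<alpha> = u \<bullet> v" "cos \<beta> = v \<bullet> w" using b by (simp_all add: \<alpha>_def \<beta>_def)
  have s0: "sin \<alpha> \<ge> 0" "sin \<beta> \<ge> 0" using \<alpha>\<beta> by (simp_all add: sin_ge_zero)
  show ?thesis
  proof (cases "\<alpha> + \<beta> \<le> pi")
    case False
    then show ?thesis using arccos_ubound[of "u \<bullet> w"] b(1) by (simp add: \<alpha>_def \<beta>_def abs_le_iff)
  next
    case True
    define u' w' where "u' = u - (u \<bullet> v) *\<^sub>R v" and "w' = w - (v \<bullet> w) *\<^sub>R v"
    have vv: "v \<bullet> v = 1" "u \<bullet> u = 1" "w \<bullet> w = 1" using assms by (simp_all add: norm_eq_1)
    have "(norm u')\<^sup>2 = 1 - (u \<bullet> v)\<^sup>2" unfolding power2_norm_eq_inner u'_def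
      by (simp add: inner_diff vv inner_commute power2_eq_square)
    also have "\<dots> = (sin \<alpha>)\<^sup>2" by (simp add: sin_squared_eq c)
    finally have nu: "norm u' = sin \<alpha>" using s0 by (simp add: power2_eq_iff_nonneg)
    have "(norm w')\<^sup>2 = 1 - (v \<bullet> w)\<^sup>2" unfolding power2_norm_eq_inner w'_def
      by (simp add: inner_diff vv inner_commute power2_eq_square)
    also have "\<dots> = (sin \<beta>)\<^sup>2" by (simp add: sin_squared_eq c)
    finally have nw: "norm w' = sin \<beta>" using s0 by (simp add: power2_eq_iff_nonneg)
    have "u \<bullet> w = (u \<bullet> v) * (v \<bullet> w) + u' \<bullet> w'"
      unfolding u'_def w'_def by (simp add: inner_diff vv inner_commute)
    moreover have "u' \<bullet> w' \<ge> - (sin \<alpha> * sin \<beta>)"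
      using Cauchy_Schwarz_ineq2[of u' w'] nu nw by (simp add: abs_le_iff)
    ultimately have "cos (\<alpha> + \<beta>) \<le> u \<bullet> w" by (simp add: cos_add c)
    then have "arccos (u \<bullet> w) \<le> arccos (cos (\<alpha> + \<beta>))" using b by (intro arccos_le_arccos) auto
    also have "\<dots> = \<alpha> + \<beta>" using True \<alpha>\<beta> by (intro arccos_cos) auto
    finally show ?thesis by (simp add: \<alpha>_def \<beta>_def)
  qed
qed

lemma arccos_inner_unit:
  fixes u v :: "'a::real_inner"
  assumes "norm u = 1" "norm v = 1"
  shows "arccos (u \<bullet> v) = 2 * arcsin (norm (u - v) / 2)"
proof -
  define d where "d = norm (u - v) / 2"
  have d: "0 \<le> d" "d \<le> 1" using norm_triangle_ineq4[of u v] assms by (auto simp: d_def)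
  have "u \<bullet> v = 1 - 2 * d\<^sup>2" using assms
    by (simp add: d_def power_divide power2_norm_eq_inner inner_diff inner_commute norm_eq_1 field_simps)
  also have "\<dots> = cos (2 * arcsin d)" using d by (simp add: cos_double_sin)
  finally have "arccos (u \<bullet> v) = arccos (cos (2 * arcsin d))" by simp
  also have "\<dots> = 2 * arcsin d"
    using d arcsin_nonneg[of d] arcsin_ubound[of d] by (intro arccos_cos) auto
  finally show ?thesis by (simp add: d_def)
qed

lemma arcsin_le_near_0:
  assumes "e > 0"
  shows "\<exists>\<delta>>0. \<forall>x. 0 \<le> x \<longrightarrow> x < \<delta> \<longrightarrow> arcsin x \<le> (1 + e) * x"
proof -
  have "(arcsin has_derivative (\<lambda>x. x)) (at 0)"
    using DERIV_arcsin[of 0] by (simp add: has_field_derivative_def mult_1[abs_def])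
  with assms obtain \<delta> where "\<delta> > 0" "\<And>y. norm (y - 0) < \<delta> \<Longrightarrow> norm (arcsin y - arcsin 0 - (y - 0)) \<le> e * norm (y - 0)"
    unfolding has_derivative_within_alt by blast
  moreover have "arcsin x \<le> (1 + e) * x" if "0 \<le> x" "x < \<delta>" for x
    using calculation(2)[of x] that by (simp add: algebra_simps)
  ultimately show ?thesis by blast
qed

text \<open>A spherical curve is at least as long as the angle between its ends. Bisection and the
  triangle inequality reduce this to short pieces, where the angle exceeds the chord by a factor of
  at most \<open>1 + e\<close>.\<close>

lemma arccos_le_lipschitz:
  fixes u :: "real \<Rightarrow> 'a::real_inner"
  assumes unit: "\<And>t. t \<in> {a..b} \<Longrightarrow> norm (u t) = 1" and K: "K \<ge> 0" and ab: "a < b"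
    and lip: "\<And>s t. s \<in> {a..b} \<Longrightarrow> t \<in> {a..b} \<Longrightarrow> norm (u s - u t) \<le> K * \<bar>s - t\<bar>"
  shows "arccos (u a \<bullet> u b) \<le> K * (b - a)"
proof -
  have main: "arccos (u a \<bullet> u b) \<le> (1 + e) * (K * (b - a))" if e: "e > 0" for e
  proof -
    from arcsin_le_near_0[OF e] obtain \<delta> where \<delta>: "\<delta> > 0" "\<And>x. 0 \<le> x \<Longrightarrow> x < \<delta> \<Longrightarrow> arcsin x \<le> (1 + e) * x" by blast
    have *: "arccos (u s \<bullet> u t) \<le> (1 + e) * (K * (t - s))"
      if "a \<le> s" "s < t" "t \<le> b" "K * (t - s) < 2 ^ k * \<delta>" for s t k
      using that
    proof (induction k arbitrary: s t)
      case 0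
      have n: "norm (u s - u t) \<le> K * (t - s)" using lip[of s t] 0 by simp
      have "arccos (u s \<bullet> u t) = 2 * arcsin (norm (u s - u t) / 2)"
        using 0 by (intro arccos_inner_unit unit) auto
      also have "\<dots> \<le> 2 * ((1 + e) * (norm (u s - u t) / 2))"
        using n 0 \<delta>(1) by (intro mult_left_mono \<delta>(2)) auto
      also have "\<dots> \<le> (1 + e) * (K * (t - s))" using n e by simp
      finally show ?case .
    next
      case (Suc k)
      define m where "m = (s + t) / 2"
      have m: "s < m" "m < t" "m - s = (t - s) / 2" "t - m = (t - s) / 2"
        using Suc.prems by (auto simp: m_def field_simps)
      then have Km: "K * (m - s) < 2 ^ k * \<delta>" "K * (t - m) < 2 ^ k * \<delta>"
        using Suc.prems(4) by (simp_all only: m) (simp_all)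
      have "arccos (u s \<bullet> u t) \<le> arccos (u s \<bullet> u m) + arccos (u m \<bullet> u t)"
        using Suc.prems m by (intro arccos_triangle unit) auto
      also have "\<dots> \<le> (1 + e) * (K * (m - s)) + (1 + e) * (K * (t - m))"
        using Suc.prems m(1,2) Km by (intro add_mono Suc.IH) auto
      also have "\<dots> = (1 + e) * (K * (t - s))" by (simp add: algebra_simps)
      finally show ?case .
    qed
    obtain k :: nat where "K * (b - a) / \<delta> < 2 ^ k" using real_arch_pow[of 2] by auto
    then show ?thesis using *[of a b k] ab \<delta>(1) by (simp add: pos_divide_less_eq)
  qed
  define X where "X = K * (b - a)"
  have X: "X \<ge> 0" using K ab by (simp add: X_def)
  have "arccos (u a \<bullet> u b) \<le> X"
  proof (rule field_le_epsilon)
    fix e :: real assume e: "e > 0"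
    have "arccos (u a \<bullet> u b) \<le> (1 + e / (X + 1)) * X" unfolding X_def[symmetric]
      using main[of "e / (X + 1)"] e X by (simp add: X_def[symmetric])
    also have "\<dots> = X + e * (X / (X + 1))" by (simp add: algebra_simps)
    also have "\<dots> \<le> X + e * 1" using e X by (intro add_left_mono mult_left_mono) auto
    finally show "arccos (u a \<bullet> u b) \<le> X + e" by simp
  qed
  then show ?thesis by (simp add: X_def)
qed

text \<open>Outside a ball the radial projection onto its sphere does not increase distances: |x -
  y|^2 splits into a radial term, which is dropped, and an angular term with the factor |x| |y|
  \<ge> r^2.\<close>

lemma norm_sgn_diff_le:
  fixes x y :: "'a::real_inner"
  assumes "0 < r" "r \<le> norm x" "r \<le> norm y"
  shows "r * norm (sgn x - sgn y) \<le> norm (x - y)"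
proof (rule power2_le_imp_le)
  define p q where "p = norm x" and "q = norm y"
  have pq: "r \<le> p" "r \<le> q" "p > 0" "q > 0" using assms by (auto simp: p_def q_def)
  have "x \<noteq> 0" "y \<noteq> 0" using assms by auto
  then have xy: "x = p *\<^sub>R sgn x" "y = q *\<^sub>R sgn y" "norm (sgn x) = 1" "norm (sgn y) = 1"
    by (simp_all add: p_def q_def sgn_div_norm)
  then have ss: "sgn x \<bullet> sgn x = 1" "sgn y \<bullet> sgn y = 1" by (simp_all add: norm_eq_1)
  have "(norm (x - y))\<^sup>2 = (norm (p *\<^sub>R sgn x - q *\<^sub>R sgn y))\<^sup>2" using xy by metis
  also have "\<dots> = (p - q)\<^sup>2 + (p * q) * (norm (sgn x - sgn y))\<^sup>2"
    unfolding power2_norm_eq_inner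
    by (simp add: inner_diff inner_commute ss power2_eq_square algebra_simps)
  also have "(p * q) * (norm (sgn x - sgn y))\<^sup>2 \<ge> (r * r) * (norm (sgn x - sgn y))\<^sup>2"
    using pq assms by (intro mult_right_mono mult_mono) auto
  ultimately have "(r * r) * (norm (sgn x - sgn y))\<^sup>2 \<le> (norm (x - y))\<^sup>2"
    using zero_le_power2[of "p - q"] by linarith
  then show "(r * norm (sgn x - sgn y))\<^sup>2 \<le> (norm (x - y))\<^sup>2" by (simp add: power2_eq_square mult_ac)
qed simp

text \<open>Radial projection to the unit sphere divides the Lipschitz constant by \<open>r\<close>;
  the projected curve then spans the angle between the end points.\<close>

lemma length_outside_ball:
  fixes f :: "real \<Rightarrow> 'a::real_inner"
  assumes ab: "a < b" and r: "r > 0" and K: "K \<ge> 0"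
    and lip: "\<And>s t. s \<in> {a..b} \<Longrightarrow> t \<in> {a..b} \<Longrightarrow> norm (f s - f t) \<le> K * \<bar>s - t\<bar>"
    and out: "\<And>t. t \<in> {a..b} \<Longrightarrow> r \<le> norm (f t - z)"
    and ends: "norm (f a - z) = r" "norm (f b - z) = r"
  shows "2 * r * arcsin (norm (f a - f b) / (2 * r)) \<le> K * (b - a)"
proof -
  define u where "u t = sgn (f t - z)" for t
  have unit: "norm (u t) = 1" if "t \<in> {a..b}" for t
    using out[OF that] r by (auto simp: u_def norm_sgn)
  have ulip: "norm (u s - u t) \<le> K / r * \<bar>s - t\<bar>" if "s \<in> {a..b}" "t \<in> {a..b}" for s t
  proof -
    have "r * norm (u s - u t) \<le> norm ((f s - z) - (f t - z))"
      unfolding u_def by (rule norm_sgn_diff_le[OF r out[OF that(1)] out[OF that(2)]])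
    also have "\<dots> \<le> K * \<bar>s - t\<bar>" using lip[OF that] by simp
    finally show ?thesis using r by (simp add: field_simps)
  qed
  have "2 * arcsin (norm (u a - u b) / 2) = arccos (u a \<bullet> u b)"
    using unit ab by (intro arccos_inner_unit[symmetric]) auto
  also have "\<dots> \<le> K / r * (b - a)"
    by (rule arccos_le_lipschitz[OF unit _ ab ulip]) (use K r in auto)
  finally have 1: "2 * arcsin (norm (u a - u b) / 2) \<le> K / r * (b - a)" .
  have "u a - u b = (f a - f b) /\<^sub>R r" using ends by (simp add: u_def sgn_div_norm algebra_simps)
  then have "norm (u a - u b) = norm (f a - f b) / r" using r by (simp add: divide_inverse mult.commute)
  with 1 show ?thesis using r by (simp add: field_simps)
qed

lemma last_crossing:
  fixes f :: "real \<Rightarrow> real"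
  assumes ab: "a \<le> b" and f: "continuous_on {a..b} f" and le: "f a \<le> r" and gt: "r < f b"
  obtains u where "a \<le> u" "u < b" "f u = r" "\<And>x. u \<le> x \<Longrightarrow> x \<le> b \<Longrightarrow> r \<le> f x"
proof -
  define S where "S = {a..b} \<inter> f -` {..r}"
  have "closed S" unfolding S_def by (intro continuous_closed_preimage f) auto
  moreover have "bounded S" by (rule bounded_subset[of "{a..b}"]) (auto simp: S_def)
  ultimately have "compact S" by (simp add: compact_eq_bounded_closed)
  moreover have "S \<noteq> {}" using ab le by (auto simp: S_def)
  ultimately obtain u where u: "u \<in> S" "\<And>x. x \<in> S \<Longrightarrow> x \<le> u" using compact_attains_sup by metis
  have uab: "a \<le> u" "u \<le> b" "f u \<le> r" using u(1) by (auto simp: S_def)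
  have ub: "u \<noteq> b" using uab gt by auto
  have "\<exists>x\<ge>u. x \<le> b \<and> f x = r"
    by (rule IVT') (use uab gt in \<open>auto intro: continuous_on_subset[OF f]\<close>)
  then obtain x where x: "u \<le> x" "x \<le> b" "f x = r" by blast
  then have "x \<in> S" using uab by (auto simp: S_def)
  then have "x = u" using u(2) x(1) by force
  then have fu: "f u = r" using x by simp
  have "r \<le> f x" if "u \<le> x" "x \<le> b" for x
  proof (rule ccontr)
    assume "\<not> r \<le> f x"
    then have "x \<in> S" using that uab by (auto simp: S_def)
    then have "x = u" using u(2) that by force
    then show False using fu \<open>\<not> r \<le> f x\<close> by simp
  qed
  then show thesis using that uab ub fu by auto
qed

section \<open>Curves realizing the intrinsic distance, and balls\<close>

lemma lip_curve_continuous: "lip_curve A M a b \<gamma> \<Longrightarrow> continuous_on {0..1} \<gamma>"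
proof -
  assume "lip_curve A M a b \<gamma>"
  then have *: "\<forall>s\<in>{0..1}. \<forall>t\<in>{0..1}. norm (\<gamma> s - \<gamma> t) \<le> M * \<bar>s - t\<bar>" by (simp add: lip_curve_def)
  then have "norm (\<gamma> 0 - \<gamma> 1) \<le> M * \<bar>0 - 1\<bar>" by (metis atLeastAtMost_iff order_refl zero_le_one)
  then have "norm (\<gamma> 0 - \<gamma> 1) \<le> M" by simp
  then have "M \<ge> 0" by (rule order_trans[OF norm_ge_zero])
  then have "M-lipschitz_on {0..1} \<gamma>"
    using * by (intro lipschitz_onI) (auto simp: dist_norm)
  then show ?thesis by (rule lipschitz_on_continuous_on)
qed

lemma lip_curve_mono: "lip_curve A M a b \<gamma> \<Longrightarrow> M \<le> M' \<Longrightarrow> lip_curve A M' a b \<gamma>"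
  unfolding lip_curve_def by (meson abs_ge_zero mult_right_mono order_trans)

lemma lip_curve_path_dist_le:
  assumes "lip_curve A M a b \<gamma>" "M \<ge> 0" "0 \<le> s" "s \<le> t" "t \<le> 1"
  shows "path_dist_le A (\<gamma> s) (\<gamma> t) (M * (t - s))"
  using assms by (intro path_dist_le_of_lip_joined lip_joined_of_lipschitz) (auto simp: lip_curve_def)

text \<open>A shorter path between \<open>\<gamma> s\<close> and \<open>\<gamma> t\<close> could be
  spliced into \<open>\<gamma>\<close>, undercutting \<open>\<rho>\<close>.\<close>

lemma geodesic_le_path_dist:
  assumes \<gamma>: "lip_curve A \<rho> a b \<gamma>" and \<rho>: "\<rho> \<ge> 0" and min: "\<And>c. path_dist_le A a b c \<Longrightarrow> \<rho> \<le> c"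
    and st: "0 \<le> s" "s \<le> t" "t \<le> 1" and c: "path_dist_le A (\<gamma> s) (\<gamma> t) c"
  shows "\<rho> * (t - s) \<le> c"
proof -
  have "path_dist_le A (\<gamma> 0) (\<gamma> 1) (\<rho> * (s - 0) + c + \<rho> * (1 - t))"
    using st by (intro path_dist_le_trans[OF path_dist_le_trans[OF _ c]] lip_curve_path_dist_le[OF \<gamma> \<rho>]) auto
  then have "\<rho> \<le> \<rho> * (s - 0) + c + \<rho> * (1 - t)" using \<gamma> min by (simp add: lip_curve_def)
  then show ?thesis by (simp add: algebra_simps)
qed

lemma geodesic_inj:
  assumes \<gamma>: "lip_curve A \<rho> a b \<gamma>" and \<rho>: "\<rho> > 0" and min: "\<And>c. path_dist_le A a b c \<Longrightarrow> \<rho> \<le> c"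
    and st: "s \<in> {0..1}" "t \<in> {0..1}" "\<gamma> s = \<gamma> t"
  shows "s = t"
proof -
  have *: "t \<le> s" if "s \<in> {0..1}" "t \<in> {0..1}" "\<gamma> s = \<gamma> t" "s \<le> t" for s t
  proof -
    have "\<gamma> s \<in> A" using \<gamma> that by (auto simp: lip_curve_def)
    then have "path_dist_le A (\<gamma> s) (\<gamma> t) 0"
      using that by (simp add: path_dist_le_of_lip_joined lip_joined_refl)
    then have "\<rho> * (t - s) \<le> 0" using geodesic_le_path_dist[OF \<gamma> _ min] \<rho> that by auto
    then show ?thesis using \<rho> by (simp add: mult_le_0_iff)
  qed
  show ?thesis using *[of s t] *[of t s] st by fastforce
qed

text \<open>An excursion outside the ball would be at least as long as an arc of radius \<open>r\<close> over its chord, but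
  its end points are joined within \<open>A\<close> by a path no longer than an arc of radius \<open>R > r\<close>.\<close>

lemma geodesic_in_ball:
  assumes A: "prox_regular R A" and R: "R > 0"
    and \<gamma>: "lip_curve A \<rho> a b \<gamma>" and \<rho>: "\<rho> > 0" and min: "\<And>c. path_dist_le A a b c \<Longrightarrow> \<rho> \<le> c"
    and r: "0 < r" "r < R" and s: "0 \<le> s1" "s1 \<le> t" "t \<le> s2" "s2 \<le> 1"
    and ends: "norm (\<gamma> s1 - z) \<le> r" "norm (\<gamma> s2 - z) \<le> r"
  shows "norm (\<gamma> t - z) \<le> r"
proof (rule ccontr)
  assume "\<not> ?thesis"
  then have t: "r < norm (\<gamma> t - z)" by simp
  note cont = lip_curve_continuous[OF \<gamma>]
  obtain u where u: "s1 \<le> u" "u < t" "norm (\<gamma> u - z) = r" "\<And>x. u \<le> x \<Longrightarrow> x \<le> t \<Longrightarrow> r \<le> norm (\<gamma> x - z)"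
  proof (rule last_crossing[of s1 t "\<lambda>x. norm (\<gamma> x - z)" r])
    show "continuous_on {s1..t} (\<lambda>x. norm (\<gamma> x - z))"
      using s by (intro continuous_intros continuous_on_subset[OF cont]) auto
  qed (use s t ends in auto)
  \<comment> \<open>In reversed time the last crossing becomes the first return to the sphere after
    \<open>t\<close>.\<close>
  obtain w' where w': "- s2 \<le> w'" "w' < - t" "norm (\<gamma> (- w') - z) = r"
    "\<And>x. w' \<le> x \<Longrightarrow> x \<le> - t \<Longrightarrow> r \<le> norm (\<gamma> (- x) - z)"
  proof (rule last_crossing[of "- s2" "- t" "\<lambda>x. norm (\<gamma> (- x) - z)" r])
    show "continuous_on {- s2..- t} (\<lambda>x. norm (\<gamma> (- x) - z))"
      using s by (intro continuous_intros continuous_on_compose2[OF cont]) auto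
  qed (use s t ends in auto)
  define w where "w = - w'"
  have w: "t < w" "w \<le> s2" "norm (\<gamma> w - z) = r" "\<And>x. t \<le> x \<Longrightarrow> x \<le> w \<Longrightarrow> r \<le> norm (\<gamma> x - z)"
    using w' w'(4)[of "- x" for x] by (auto simp: w_def)
  define l where "l = norm (\<gamma> u - \<gamma> w)"
  have uw: "u < w" "0 \<le> u" "w \<le> 1" using u w s by auto
  have in_A: "\<gamma> u \<in> A" "\<gamma> w \<in> A" using \<gamma> uw by (auto simp: lip_curve_def)
  have "\<gamma> u \<noteq> \<gamma> w" using geodesic_inj[OF \<gamma> \<rho> min, of u w] uw by auto
  then have l0: "l > 0" by (simp add: l_def)
  have "l \<le> norm (\<gamma> u - z) + norm (\<gamma> w - z)"
    unfolding l_def using norm_triangle_ineq4[of "\<gamma> u - z" "\<gamma> w - z"] by simp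
  then have l2: "l \<le> 2 * r" using u w by simp
  have "path_dist_le A (\<gamma> u) (\<gamma> w) (2 * R * arcsin (l / (2 * R)))"
    unfolding l_def using l2 r by (intro path_dist_le_arcsin[OF A R in_A]) (auto simp: l_def)
  then have "\<rho> * (w - u) \<le> 2 * R * arcsin (l / (2 * R))"
    using geodesic_le_path_dist[OF \<gamma> _ min] \<rho> uw by auto
  also have "\<dots> < 2 * r * arcsin (l / (2 * r))" by (rule arc_strict_antimono_radius[OF r l0 l2])
  also have "\<dots> \<le> \<rho> * (w - u)" unfolding l_def
  proof (rule length_outside_ball[OF uw(1) r(1)])
    show "norm (\<gamma> s - \<gamma> t) \<le> \<rho> * \<bar>s - t\<bar>" if "s \<in> {u..w}" "t \<in> {u..w}" for s t
      using \<gamma> that uw by (auto simp: lip_curve_def)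
    show "r \<le> norm (\<gamma> x - z)" if "x \<in> {u..w}" for x
      using u(4)[of x] w(4)[of x] that by (cases "x \<le> t") auto
  qed (use \<rho> u w in auto)
  finally show False by simp
qed

text \<open>If the proximal inequality failed at \<open>p\<close> for some \<open>y\<close> on the curve, then \<open>y\<close> would lie strictly inside a
  ball of radius \<open>r < R\<close> with \<open>p\<close> on its boundary, and so inside all slightly tilted balls. The arc from
  \<open>p\<close> to \<open>y\<close> lies in all of them, so it leaves \<open>p\<close> at an angle bounded away from the tangent
  plane, towards \<open>x\<close>. This contradicts the minimality of \<open>p\<close>.\<close>

lemma prox_regular_geodesic:
  fixes A :: "'a::real_inner set"
  assumes A: "prox_regular R A" and R: "R > 0"
    and \<gamma>: "lip_curve A \<rho> a b \<gamma>" and \<rho>: "\<rho> > 0" and min: "\<And>c. path_dist_le A a b c \<Longrightarrow> \<rho> \<le> c"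
  shows "prox_regular R (\<gamma> ` {0..1})"
  unfolding prox_regular_def
proof (intro conjI allI impI)
  let ?G = "\<gamma> ` {0..1}"
  note cont = lip_curve_continuous[OF \<gamma>]
  have "compact ?G" by (intro compact_continuous_image cont) auto
  then show "closed ?G" by (rule compact_imp_closed)
  show "?G \<noteq> {}" by simp
  fix x assume "infdist x ?G < R"
  have "\<exists>t\<in>{0..1}. \<forall>s\<in>{0..1}. norm (x - \<gamma> t) \<le> norm (x - \<gamma> s)"
    by (rule continuous_attains_inf) (auto intro!: continuous_intros cont)
  then obtain t0 where t0: "t0 \<in> {0..1}" "\<And>s. s \<in> {0..1} \<Longrightarrow> norm (x - \<gamma> t0) \<le> norm (x - \<gamma> s)" by blast
  define p where "p = \<gamma> t0"
  define d where "d = norm (x - p)"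
  have dmin: "d \<le> norm (x - \<gamma> s)" if "s \<in> {0..1}" for s using t0(2)[OF that] by (simp add: d_def p_def)
  have "infdist x ?G \<le> d" unfolding d_def using t0 by (intro infdist_le_norm) (auto simp: p_def)
  moreover have "d \<le> infdist x ?G"
  proof (rule field_le_epsilon)
    fix e :: real assume "e > 0"
    then obtain y where "y \<in> ?G" "norm (x - y) < infdist x ?G + e"
      using infdist_approx[of ?G e x] by auto
    then show "d \<le> infdist x ?G + e" using dmin by fastforce
  qed
  ultimately have inf: "d = infdist x ?G" by simp
  have "(x - p) \<bullet> (y - p) \<le> norm (x - p) * (norm (y - p))\<^sup>2 / (2 * R)" if y: "y \<in> ?G" for y
  proof (rule ccontr)
    assume neg: "\<not> ?thesis"
    obtain s where s: "s \<in> {0..1}" "y = \<gamma> s" using y by auto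
    define n where "n = y - p"
    have "x \<noteq> p" using neg by auto
    then have d0: "d > 0" by (simp add: d_def)
    define v where "v = (x - p) /\<^sub>R d"
    have xp: "x - p = d *\<^sub>R v" using d0 by (simp add: v_def)
    have v1: "norm v = 1" using d0 by (simp add: v_def d_def)
    have "norm (x - p) * (norm n)\<^sup>2 / (2 * R) < (x - p) \<bullet> n" using neg by (simp add: n_def)
    moreover have "norm (x - p) = d" by (simp add: d_def)
    ultimately have "d * ((norm n)\<^sup>2 / (2 * R)) < d * (v \<bullet> n)" unfolding xp by simp
    then have vn: "(norm n)\<^sup>2 / (2 * R) < v \<bullet> n" using mult_less_cancel_left_pos[OF d0] by blast
    have vn0: "0 < v \<bullet> n" using vn R by (smt (verit) divide_nonneg_pos zero_le_power2)
    have st0: "s \<noteq> t0" using vn0 s by (auto simp: n_def p_def)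
    \<comment> \<open>The radius of the sphere that touches the tangent plane at \<open>p\<close>
      and passes through \<open>y\<close>. It is below \<open>R\<close> exactly because the
      inequality fails, which leaves room for \<open>r\<close> in between.\<close>
    define k where "k = (norm n)\<^sup>2 / (2 * (v \<bullet> n))"
    have k: "0 \<le> k" "k < R" using vn vn0 R by (auto simp: k_def field_simps)
    define r where "r = (R + k) / 2"
    have r: "0 < r" "r < R" "k < r" using k R by (auto simp: r_def)
    define c where "c = p + r *\<^sub>R v"
    have "(norm n)\<^sup>2 < 2 * r * (v \<bullet> n)" using r(3) vn0 by (simp add: k_def field_simps)
    moreover have "(norm (y - c))\<^sup>2 = (norm n)\<^sup>2 - 2 * r * (v \<bullet> n) + r\<^sup>2"
    proof -
      have "y - c = n + (- r) *\<^sub>R v" by (simp add: n_def c_def algebra_simps)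
      then show ?thesis using norm_add_scale_unit_sq[OF v1, of n "- r"] by (simp add: inner_commute)
    qed
    ultimately have "(norm (y - c))\<^sup>2 < r\<^sup>2" by simp
    then have yc: "norm (y - c) < r" by (rule power_less_imp_less_base) (use r in simp)
    \<comment> \<open>The amount by which the centre \<open>c\<close> may move. The ball about the
      new centre with \<open>p\<close> on its boundary has a radius in
      \<open>{r - \<mu>..r + \<mu>}\<close>, hence below \<open>R\<close>, and still contains
      \<open>y\<close>.\<close>
    define \<mu> where "\<mu> = min (R - r) (r - norm (y - c)) / 2"
    have "2 * \<mu> \<le> R - r" "2 * \<mu> \<le> r - norm (y - c)" "\<mu> > 0"
      using r yc unfolding \<mu>_def by auto
    then have \<mu>: "\<mu> > 0" "r + \<mu> < R" "norm (y - c) \<le> r - 2 * \<mu>" using r by linarith+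
    have pc: "p - c = - (r *\<^sub>R v)" by (simp add: c_def)
    have tilt: "\<mu> * norm (\<gamma> t - p) \<le> r * (v \<bullet> (\<gamma> t - p))" if t: "min t0 s \<le> t" "t \<le> max t0 s" for t
    proof (cases "\<gamma> t = p")
      case False
      define m where "m = \<gamma> t - p"
      have m0: "norm m > 0" using False by (simp add: m_def)
      \<comment> \<open>The centre is moved straight away from the point \<open>\<gamma> t\<close>
        under test; among all tilts this one constrains that point most.\<close>
      define e where "e = - (m /\<^sub>R norm m)"
      have e1: "norm e = 1" and me: "m \<bullet> e = - norm m"
        using m0 by (simp_all add: e_def dot_square_norm power2_eq_square)
      define c' where "c' = c + \<mu> *\<^sub>R e"
      define r' where "r' = norm (p - c')"
      have pc': "p - c' = - (r *\<^sub>R v) - \<mu> *\<^sub>R e" using pc by (simp add: c'_def)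
      have r'le: "r' \<le> r + \<mu>" unfolding r'_def pc'
        using norm_triangle_ineq4[of "- (r *\<^sub>R v)" "\<mu> *\<^sub>R e"] v1 e1 r \<mu> by simp
      have r'ge: "r - \<mu> \<le> r'" unfolding r'_def pc'
        using norm_triangle_ineq2[of "- (r *\<^sub>R v)" "\<mu> *\<^sub>R e"] v1 e1 r \<mu> by simp
      have "y - c' = (y - c) - \<mu> *\<^sub>R e" by (simp add: c'_def)
      then have "norm (y - c') = norm ((y - c) - \<mu> *\<^sub>R e)" by (rule arg_cong)
      also have "\<dots> \<le> norm (y - c) + \<mu>"
        using norm_triangle_ineq4[of "y - c" "\<mu> *\<^sub>R e"] e1 \<mu> by simp
      finally have "norm (y - c') \<le> norm (y - c) + \<mu>" .
      then have yc': "norm (y - c') \<le> r'" using \<mu> r'ge by simp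
      have rmu: "r - \<mu> > 0" using \<mu> norm_ge_zero[of "y - c"] by linarith
      have e12: "norm (\<gamma> t0 - c') \<le> r'" "norm (\<gamma> s - c') \<le> r'"
        using yc' s by (simp_all add: r'_def p_def)
      have "norm (\<gamma> t - c') \<le> r'"
        by (rule geodesic_in_ball[OF A R \<gamma> \<rho> min, of r' "min t0 s" t "max t0 s"])
          (use r'le r'ge rmu \<mu> t t0 s e12 in \<open>auto simp: min_def max_def\<close>)
      also have "\<gamma> t - c' = m + (p - c')" by (simp add: m_def)
      finally have "(norm (m + (p - c')))\<^sup>2 \<le> (norm (p - c'))\<^sup>2"
        unfolding r'_def by (intro power_mono) auto
      then have "(norm m)\<^sup>2 + 2 * (m \<bullet> (p - c')) \<le> 0"
        unfolding power2_norm_eq_inner by (simp add: inner_add inner_commute)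
      moreover have "m \<bullet> (p - c') = - (r * (v \<bullet> m)) + \<mu> * norm m"
        unfolding pc' using me by (simp add: inner_diff_right inner_commute)
      ultimately show ?thesis using zero_le_power2[of "norm m"] unfolding m_def by linarith
    qed simp
    define \<theta> where "\<theta> = d * \<mu> / r"
    have \<theta>: "\<theta> > 0" using d0 \<mu> r by (simp add: \<theta>_def)
    \<comment> \<open>Since no point of the curve is closer to \<open>x\<close> than
      \<open>p\<close>, \<open>2 * d * (v \<bullet> m) \<le> (norm m)\<^sup>2\<close>. Together with
      \<open>tilt\<close> this keeps every other point of the arc at a fixed distance from
      \<open>p\<close>.\<close>
    have far: "2 * \<theta> \<le> norm (\<gamma> t - p)" if t: "min t0 s \<le> t" "t \<le> max t0 s" "\<gamma> t \<noteq> p" for t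
    proof -
      define m where "m = \<gamma> t - p"
      have "t \<in> {0..1}" using t t0 s by auto
      then have "d\<^sup>2 \<le> (norm (x - \<gamma> t))\<^sup>2" using dmin d0 by (intro power_mono) auto
      also have "x - \<gamma> t = - (m + (- d) *\<^sub>R v)" using xp by (simp add: m_def algebra_simps)
      also have "(norm \<dots>)\<^sup>2 = (norm m)\<^sup>2 - 2 * d * (v \<bullet> m) + d\<^sup>2"
        unfolding norm_minus_cancel using norm_add_scale_unit_sq[OF v1, of m "- d"] by (simp add: inner_commute)
      finally have 1: "2 * d * (v \<bullet> m) \<le> (norm m)\<^sup>2" by simp
      have "\<mu> * norm m / r \<le> v \<bullet> m" using tilt[OF t(1,2)] r by (simp add: m_def field_simps)
      then have "2 * d * (\<mu> * norm m / r) \<le> 2 * d * (v \<bullet> m)" using d0 by (intro mult_left_mono) auto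
      with 1 have "norm m * (2 * \<theta>) \<le> norm m * norm m" by (simp add: \<theta>_def power2_eq_square mult_ac)
      then show ?thesis using t(3) by (simp add: m_def)
    qed
    \<comment> \<open>A parameter so close to \<open>t0\<close>, on the way to \<open>s\<close>,
      that the curve has moved by at most \<open>\<theta>\<close>, which contradicts
      \<open>far\<close>.\<close>
    define \<xi> where "\<xi> = min 1 (\<theta> / \<rho>)"
    have \<xi>: "0 < \<xi>" "\<xi> \<le> 1" "\<rho> * \<xi> \<le> \<theta>" using \<theta> \<rho> by (auto simp: \<xi>_def min_def field_simps)
    define t where "t = t0 + \<xi> * (s - t0)"
    have tconv: "t = (1 - \<xi>) * t0 + \<xi> * s" by (simp add: t_def algebra_simps)
    have t_le: "t \<le> max t0 s"
      unfolding tconv using \<xi> by (intro convex_bound_le) auto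
    have t_ge: "min t0 s \<le> t"
    proof -
      have "min t0 s = (1 - \<xi>) * min t0 s + \<xi> * min t0 s" by (simp add: algebra_simps)
      also have "\<dots> \<le> t" unfolding tconv using \<xi> by (intro add_mono mult_left_mono) auto
      finally show ?thesis .
    qed
    have t01: "t \<in> {0..1}" using t_le t_ge t0 s by auto
    have tt0: "t \<noteq> t0" using \<xi> st0 by (simp add: t_def)
    then have "\<gamma> t \<noteq> p" using geodesic_inj[OF \<gamma> \<rho> min t01 t0(1)] by (auto simp: p_def)
    then have "2 * \<theta> \<le> norm (\<gamma> t - p)" using far t_le t_ge by blast
    also have "\<dots> \<le> \<rho> * \<bar>t - t0\<bar>" using \<gamma> t01 t0 by (simp add: lip_curve_def p_def)
    also have "\<dots> = \<rho> * \<xi> * \<bar>s - t0\<bar>" using \<xi> by (simp add: t_def abs_mult)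
    also have "\<dots> \<le> \<theta> * 1" using \<xi> t0 s \<theta> \<rho> by (intro mult_mono) auto
    finally show False using \<theta> by simp
  qed
  then show "\<exists>p\<in>?G. norm (x - p) = infdist x ?G \<and>
      (\<forall>y\<in>?G. (x - p) \<bullet> (y - p) \<le> norm (x - p) * (norm (y - p))\<^sup>2 / (2 * R))"
    using t0(1) inf by (intro bexI[of _ p]) (auto simp: p_def d_def)
qed

section \<open>A smooth distance function recovered from the projection\<close>

lemma proj_tendsto:
  assumes A: "prox_regular R A" and R: "R > 0" and x: "infdist x A < R"
  shows "(proj A R \<longlongrightarrow> proj A R x) (at x)"
proof -
  have inf: "((\<lambda>y. infdist y A) \<longlongrightarrow> infdist x A) (at x)" by (intro tendsto_intros)
  have "((\<lambda>y. proj A R y - proj A R x) \<longlongrightarrow> 0) (at x)"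
  proof (rule Lim_null_comparison)
    have "\<forall>\<^sub>F y in at x. infdist y A < R" using order_tendstoD(2)[OF inf x] .
    then show "\<forall>\<^sub>F y in at x. norm (proj A R y - proj A R x)
      \<le> norm (y - x) / (1 - (infdist y A + infdist x A) / (2 * R))"
    proof eventually_elim
      case (elim y)
      have "1 - (infdist y A + infdist x A) / (2 * R) > 0" using elim x R by (simp add: field_simps)
      then show ?case using proj_lipschitz[OF A R elim x] by (simp add: pos_le_divide_eq)
    qed
    have "((\<lambda>y. norm (y - x) / (1 - (infdist y A + infdist x A) / (2 * R))) \<longlongrightarrow>
      norm (x - x) / (1 - (infdist x A + infdist x A) / (2 * R))) (at x)"
      using x R by (intro tendsto_intros inf) (auto simp: field_simps)
    then show "((\<lambda>y. norm (y - x) / (1 - (infdist y A + infdist x A) / (2 * R))) \<longlongrightarrow> 0) (at x)" by simp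
  qed
  then show ?thesis using LIM_zero_cancel by blast
qed

text \<open>Convexity of the norm: \<open>sgn a\<close> is a subgradient at
  \<open>a\<close>.\<close>

lemma norm_diff_le_sgn:
  fixes a b :: "'a::real_inner"
  shows "norm a - norm b \<le> sgn a \<bullet> (a - b)"
proof (cases "a = 0")
  case False
  have "sgn a \<bullet> b \<le> norm (sgn a) * norm b" by (rule norm_cauchy_schwarz)
  moreover have "sgn a \<bullet> a = norm a" using False by (simp add: sgn_div_norm dot_square_norm power2_eq_square)
  ultimately show ?thesis using False by (simp add: inner_diff_right norm_sgn)
qed simp

text \<open>The gradient is the unit vector pointing from the projection to \<open>x\<close>.
  Comparing \<open>infdist y A\<close> with the distance from \<open>y\<close> to the projection of
  \<open>x\<close>, and vice versa, encloses the increment between two subgradient inequalities;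
  their unit vectors converge because the projection is continuous.\<close>

lemma prox_regular_imp_proximally_smooth:
  fixes A :: "'a::real_inner set"
  assumes A: "prox_regular R A" and R: "R > 0"
  shows "proximally_smooth R A"
  unfolding proximally_smooth_def
proof (intro conjI exI[of _ "\<lambda>x. blinfun_inner_right (sgn (x - proj A R x))"] ballI)
  let ?U = "{x. 0 < infdist x A \<and> infdist x A < R}"
  let ?n = "\<lambda>x. sgn (x - proj A R x)"
  show "closed A" using A by (simp add: prox_regular_def)
  have ne: "x \<noteq> proj A R x" if "x \<in> ?U" for x using norm_diff_proj[OF A, of x] that by auto
  have n_lim: "(?n \<longlongrightarrow> ?n x) (at x)" if "x \<in> ?U" for x
    using that ne[OF that] by (intro tendsto_intros proj_tendsto[OF A R]) auto
  show "continuous_on ?U (\<lambda>x. blinfun_inner_right (?n x))"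
    unfolding continuous_on_def
    by (intro ballI bounded_linear.tendsto[OF bounded_linear_blinfun_inner_right] tendsto_within_subset[OF n_lim]) auto
  fix x assume x: "x \<in> ?U"
  then have xR: "infdist x A < R" by simp
  let ?e = "\<lambda>y. norm (sgn (y - proj A R x) - ?n x) + norm (sgn (x - proj A R y) - ?n x)"
  show "((\<lambda>y. infdist y A) has_derivative blinfun_apply (blinfun_inner_right (?n x))) (at x)"
  proof (rule has_derivativeI)
    show "bounded_linear (blinfun_apply (blinfun_inner_right (?n x)))" by (rule blinfun.bounded_linear_right)
    show "((\<lambda>y. ((infdist y A - infdist x A) - blinfun_apply (blinfun_inner_right (?n x)) (y - x)) /\<^sub>R norm (y - x)) \<longlongrightarrow> 0) (at x)"
    proof (rule Lim_null_comparison[where g = ?e])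
      have inf: "((\<lambda>y. infdist y A) \<longlongrightarrow> infdist x A) (at x)" by (intro tendsto_intros)
      have "\<forall>\<^sub>F y in at x. infdist y A < R" using order_tendstoD(2)[OF inf xR] .
      then show "\<forall>\<^sub>F y in at x. norm (((infdist y A - infdist x A) - blinfun_apply (blinfun_inner_right (?n x)) (y - x)) /\<^sub>R norm (y - x)) \<le> ?e y"
      proof eventually_elim
        case (elim y)
        define E where "E = infdist y A - infdist x A - ?n x \<bullet> (y - x)"
        have "infdist y A \<le> norm (y - proj A R x)" by (intro infdist_le_norm proj_in[OF A xR])
        then have "infdist y A - infdist x A \<le> norm (y - proj A R x) - norm (x - proj A R x)"
          using norm_diff_proj[OF A xR] by simp
        also have "\<dots> \<le> sgn (y - proj A R x) \<bullet> (y - x)"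
          using norm_diff_le_sgn[of "y - proj A R x" "x - proj A R x"] by simp
        finally have "E \<le> (sgn (y - proj A R x) - ?n x) \<bullet> (y - x)" by (simp add: E_def inner_diff_left)
        also have "\<dots> \<le> norm (sgn (y - proj A R x) - ?n x) * norm (y - x)" by (rule norm_cauchy_schwarz)
        also have "\<dots> \<le> ?e y * norm (y - x)" by (intro mult_right_mono) auto
        finally have 1: "E \<le> ?e y * norm (y - x)" .
        have "infdist x A \<le> norm (x - proj A R y)" by (intro infdist_le_norm proj_in[OF A elim])
        then have "infdist x A - infdist y A \<le> norm (x - proj A R y) - norm (y - proj A R y)"
          using norm_diff_proj[OF A elim] by simp
        also have "\<dots> \<le> sgn (x - proj A R y) \<bullet> (x - y)"
          using norm_diff_le_sgn[of "x - proj A R y" "y - proj A R y"] by simp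
        finally have "- E \<le> (sgn (x - proj A R y) - ?n x) \<bullet> (x - y)"
          by (simp add: E_def inner_diff_left inner_diff_right)
        also have "\<dots> \<le> norm (sgn (x - proj A R y) - ?n x) * norm (x - y)" by (rule norm_cauchy_schwarz)
        also have "norm (x - y) = norm (y - x)" by (rule norm_minus_commute)
        also have "norm (sgn (x - proj A R y) - ?n x) * norm (y - x) \<le> ?e y * norm (y - x)"
          by (intro mult_right_mono) auto
        finally have "\<bar>E\<bar> \<le> ?e y * norm (y - x)" using 1 by simp
        then show ?case
          by (cases "y = x") (auto simp: E_def inverse_eq_divide pos_divide_le_eq abs_mult mult.commute)
      qed
      have "(?e \<longlongrightarrow> norm (sgn (x - proj A R x) - ?n x) + norm (sgn (x - proj A R x) - ?n x)) (at x)"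
        using ne[OF x] by (intro tendsto_intros proj_tendsto[OF A R xR]) auto
      then show "(?e \<longlongrightarrow> 0) (at x)" by simp
    qed
  qed
qed

section \<open>Length, existence and uniqueness\<close>

lemma curve_length_ge_sum:
  assumes "subdivision c d n t"
  shows "ennreal (\<Sum>k<n. norm (f (t (Suc k)) - f (t k))) \<le> curve_length c d f"
  unfolding curve_length_def by (rule SUP_upper2[of "(n, t)"]) (use assms in auto)

lemma curve_length_leI:
  assumes "\<And>n t. subdivision c d n t \<Longrightarrow> (\<Sum>k<n. norm (f (t (Suc k)) - f (t k))) \<le> K"
  shows "curve_length c d f \<le> ennreal K"
  unfolding curve_length_def by (rule SUP_least) (use assms in \<open>auto intro: ennreal_leI\<close>)

lemma curve_length_lipschitz_le:
  assumes lip: "\<And>s t. s \<in> {c..d} \<Longrightarrow> t \<in> {c..d} \<Longrightarrow> norm (f s - f t) \<le> K * \<bar>s - t\<bar>"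
  shows "curve_length c d f \<le> ennreal (K * (d - c))"
proof (rule curve_length_leI)
  fix n t assume t: "subdivision c d n t"
  have "(\<Sum>k<n. norm (f (t (Suc k)) - f (t k))) \<le> (\<Sum>k<n. K * (t (Suc k) - t k))"
  proof (rule sum_mono)
    fix k assume "k \<in> {..<n}"
    then show "norm (f (t (Suc k)) - f (t k)) \<le> K * (t (Suc k) - t k)"
      using lip[of "t (Suc k)" "t k"] subdivision_mem[OF t, of k] subdivision_mem[OF t, of "Suc k"]
        subdivision_less[OF t, of k] by auto
  qed
  also have "\<dots> = K * (t n - t 0)" by (simp add: sum_lessThan_telescope flip: sum_distrib_left)
  also have "\<dots> = K * (d - c)" using t by (simp add: subdivision_def)
  finally show "(\<Sum>k<n. norm (f (t (Suc k)) - f (t k))) \<le> K * (d - c)" .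
qed

lemma sum_lessThan_append: "(\<Sum>k<n + m. f k) = (\<Sum>k<n. f k) + (\<Sum>k<m. f (n + k))"
  for f :: "nat \<Rightarrow> 'a::comm_monoid_add"
  by (induction m) (simp_all add: add.assoc)

lemma strict_mono_on_atMostI:
  fixes t :: "nat \<Rightarrow> real"
  assumes "\<And>k. k < n \<Longrightarrow> t k < t (Suc k)"
  shows "strict_mono_on {..n} t"
proof (rule strict_mono_onI)
  fix i j assume "i \<in> {..n}" "j \<in> {..n}" "i < j"
  then show "t i < t j"
  proof (induction j)
    case (Suc j)
    then show ?case using assms[of j] by (cases "i = j") force+
  qed simp
qed

lemma subdivision_append:
  assumes t: "subdivision c d n t" and t': "subdivision d e m t'"
  shows "subdivision c e (n + m) (\<lambda>k. if k \<le> n then t k else t' (k - n))"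
proof -
  define s where "s k = (if k \<le> n then t k else t' (k - n))" for k
  have tt': "t n = t' 0" using t t' by (simp add: subdivision_def)
  have "s k < s (Suc k)" if k: "k < n + m" for k
  proof -
    consider "k < n" | "k = n" | "k > n" by linarith
    then show ?thesis
    proof cases
      case 1 then show ?thesis using subdivision_less[OF t, of k] by (simp add: s_def)
    next
      case 2 then show ?thesis using subdivision_less[OF t', of 0] k tt' by (simp add: s_def)
    next
      case 3 then show ?thesis using subdivision_less[OF t', of "k - n"] k by (simp add: s_def Suc_diff_le)
    qed
  qed
  then have "strict_mono_on {..n + m} s" by (rule strict_mono_on_atMostI)
  moreover have "s 0 = c" "s (n + m) = e" using t t' tt' by (auto simp: s_def subdivision_def)
  ultimately show ?thesis by (simp add: subdivision_def s_def[abs_def])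
qed

lemma curve_length_add_le:
  assumes cd: "c \<le> d" and de: "d \<le> e"
  shows "curve_length c d f + curve_length d e f \<le> curve_length c e f"
proof -
  have sum: "ennreal (\<Sum>k<n. norm (f (t (Suc k)) - f (t k))) + ennreal (\<Sum>k<m. norm (f (t' (Suc k)) - f (t' k)))
      \<le> curve_length c e f" if t: "subdivision c d n t" and t': "subdivision d e m t'" for n t m t'
  proof -
    define s where "s k = (if k \<le> n then t k else t' (k - n))" for k
    have s: "subdivision c e (n + m) s" unfolding s_def by (rule subdivision_append[OF t t'])
    have "t n = t' 0" using t t' by (simp add: subdivision_def)
    then have s': "s (n + k) = t' k" for k by (auto simp: s_def)
    have 1: "(\<Sum>k<n. norm (f (t (Suc k)) - f (t k))) = (\<Sum>k<n. norm (f (s (Suc k)) - f (s k)))"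
      by (intro sum.cong) (auto simp: s_def)
    have 2: "(\<Sum>k<m. norm (f (t' (Suc k)) - f (t' k))) = (\<Sum>k<m. norm (f (s (Suc (n + k))) - f (s (n + k))))"
      using s'[of "Suc k" for k] by (simp add: s')
    have "ennreal (\<Sum>k<n. norm (f (t (Suc k)) - f (t k))) + ennreal (\<Sum>k<m. norm (f (t' (Suc k)) - f (t' k)))
      = ennreal (\<Sum>k<n + m. norm (f (s (Suc k)) - f (s k)))"
      unfolding 1 2 sum_lessThan_append[of _ n m] by (simp add: sum_nonneg)
    also have "\<dots> \<le> curve_length c e f" by (rule curve_length_ge_sum[OF s])
    finally show ?thesis .
  qed
  \<comment> \<open>A summand can be moved inside a supremum only over a nonempty index set; a
    degenerate interval has the subdivision with \<open>n = 0\<close>.\<close>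
  have ex: "\<exists>n t. subdivision u v n t" if "u \<le> v" for u v
  proof (cases "u = v")
    case True
    then show ?thesis by (intro exI[of _ 0] exI[of _ "\<lambda>_. u"]) (auto simp: subdivision_def strict_mono_on_def)
  next
    case False
    then show ?thesis using that
      by (intro exI[of _ 1] exI[of _ "\<lambda>k. if k = 0 then u else v"])
        (auto simp: subdivision_def strict_mono_on_def)
  qed
  have "curve_length c d f + ennreal (\<Sum>k<m. norm (f (t' (Suc k)) - f (t' k))) \<le> curve_length c e f"
    if t': "subdivision d e m t'" for m t'
    unfolding curve_length_def[of c d]
    by (subst ennreal_SUP_add_left[symmetric]) (use ex[OF cd] sum t' in \<open>auto intro!: SUP_least\<close>)
  then show ?thesis
    unfolding curve_length_def[of d e]
    by (subst ennreal_SUP_add_right) (use ex[OF de] in \<open>auto intro!: SUP_least\<close>)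
qed

lemma curve_length_mono:
  assumes "c \<le> d" "d \<le> e"
  shows "curve_length c d f \<le> curve_length c e f"
  using curve_length_add_le[OF assms, of f] by (metis add.right_neutral add_left_mono order_trans zero_le)

lemma norm_le_curve_length:
  assumes "c \<le> d"
  shows "ennreal (norm (f d - f c)) \<le> curve_length c d f"
proof (cases "c = d")
  case False
  then have "subdivision c d 1 (\<lambda>k. if k = 0 then c else d)"
    using assms by (auto simp: subdivision_def strict_mono_on_def)
  from curve_length_ge_sum[OF this, of f] show ?thesis by simp
qed simp

text \<open>A rectifiable curve need not be Lipschitz, as \<open>lip_joined\<close> demands. It is
  replaced by short paths between finely spaced points of it; these cost at most
  \<open>1 + e\<close> times the chords, and the chords sum to at most \<open>V\<close>.\<close>

lemma path_dist_le_of_curve: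
  fixes A :: "'a::real_inner set"
  assumes A: "prox_regular R A" and R: "R > 0" and cd: "c \<le> d"
    and f: "continuous_on {c..d} f" "f ` {c..d} \<subseteq> A" and V: "V \<ge> 0" "curve_length c d f \<le> ennreal V"
  shows "path_dist_le A (f c) (f d) V"
proof (cases "c = d")
  case True
  then have "path_dist_le A (f c) (f d) 0"
    using f by (auto intro!: path_dist_le_of_lip_joined lip_joined_refl)
  then show ?thesis using V path_dist_le_mono by blast
next
  case False
  then have cd: "c < d" using cd by simp
  have main: "path_dist_le A (f c) (f d) ((1 + e) * V)" if e: "e > 0" for e
  proof -
    \<comment> \<open>Chosen such that chords below \<open>\<delta>\<close> satisfy
      \<open>l\<^sup>2 * (1 + e) \<le> R\<^sup>2 * e\<close>, more than
      \<open>lip_joined_near'\<close> asks.\<close>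
    define \<delta> where "\<delta> = min R (R * sqrt (e / (1 + e)))"
    have \<delta>: "\<delta> > 0" using R e by (simp add: \<delta>_def)
    have near: "lip_joined A x y ((1 + e) * norm (x - y))" if "x \<in> A" "y \<in> A" "norm (x - y) < \<delta>" for x y
    proof (rule lip_joined_near'[OF A R that(1,2)])
      show "norm (x - y) < 2 * R" using that R by (simp add: \<delta>_def)
      have "norm (x - y) \<le> R * sqrt (e / (1 + e))" using that by (simp add: \<delta>_def)
      then have "(norm (x - y))\<^sup>2 \<le> (R * sqrt (e / (1 + e)))\<^sup>2" by (intro power_mono) auto
      also have "\<dots> = R\<^sup>2 * e / (1 + e)" using e by (simp add: power_mult_distrib)
      finally have "(norm (x - y))\<^sup>2 * (1 + e) \<le> R\<^sup>2 * e" using e by (simp add: pos_le_divide_eq)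
      also have "\<dots> \<le> 4 * R\<^sup>2 * e" using e by simp
      finally show "(norm (x - y))\<^sup>2 * (1 + e) \<le> 4 * R\<^sup>2 * e" .
    qed (use e in auto)
    have "uniformly_continuous_on {c..d} f" using f by (intro compact_uniformly_continuous) auto
    then obtain h where h: "h > 0" "\<And>x y. x \<in> {c..d} \<Longrightarrow> y \<in> {c..d} \<Longrightarrow> dist y x < h \<Longrightarrow> dist (f y) (f x) < \<delta>"
      using \<delta> unfolding uniformly_continuous_on_def by metis
    obtain n :: nat where n: "(d - c) / h < real n" using reals_Archimedean2 by blast
    have "(d - c) / h > 0" using cd h by simp
    then have n0: "n > 0" using n by (cases n) auto
    define x where "x = (d - c) / real n"
    define t where "t k = c + real k * x" for k
    have tS: "t (Suc k) = t k + (d - c) / real n" for k by (simp add: t_def distrib_right flip: x_def)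
    have step: "0 < (d - c) / real n" "(d - c) / real n < h" using cd n n0 h by (simp_all add: field_simps)
    have sub: "subdivision c d n t" unfolding subdivision_def
      using n0 step by (auto intro!: strict_mono_on_atMostI simp: tS) (simp_all add: t_def x_def)
    have "path_dist_le A (f (t 0)) (f (t m)) ((1 + e) * (\<Sum>k<m. norm (f (t (Suc k)) - f (t k))))" if "m \<le> n" for m
      using that
    proof (induction m)
      case 0
      then show ?case using f cd by (auto intro!: path_dist_le_of_lip_joined lip_joined_refl simp: t_def)
    next
      case (Suc m)
      have mem: "t m \<in> {c..d}" "t (Suc m) \<in> {c..d}" using subdivision_mem[OF sub] Suc.prems by auto
      have "dist (f (t (Suc m))) (f (t m)) < \<delta>" using step by (intro h(2) mem) (simp add: tS dist_real_def)
      then have "lip_joined A (f (t m)) (f (t (Suc m))) ((1 + e) * norm (f (t m) - f (t (Suc m))))"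
        using mem f by (intro near) (auto simp: dist_norm norm_minus_commute)
      from path_dist_le_trans[OF Suc.IH path_dist_le_of_lip_joined[OF this]] Suc.prems
      show ?case by (simp add: distrib_left norm_minus_commute)
    qed
    from this[of n] have "path_dist_le A (f c) (f d) ((1 + e) * (\<Sum>k<n. norm (f (t (Suc k)) - f (t k))))"
      using sub by (simp add: subdivision_def)
    then show ?thesis
    proof (rule path_dist_le_mono)
      have "ennreal (\<Sum>k<n. norm (f (t (Suc k)) - f (t k))) \<le> ennreal V"
        using curve_length_ge_sum[OF sub] V(2) by (rule order_trans)
      then show "(1 + e) * (\<Sum>k<n. norm (f (t (Suc k)) - f (t k))) \<le> (1 + e) * V"
        using V(1) e by (intro mult_left_mono) auto
    qed
  qed
  show ?thesis
  proof (rule path_dist_le_closed)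
    fix e :: real assume e: "e > 0"
    have "(1 + e / (V + 1)) * V = V + e * (V / (V + 1))" by (simp add: algebra_simps)
    also have "\<dots> \<le> V + e * 1" using e V by (intro add_left_mono mult_left_mono) auto
    finally have "(1 + e / (V + 1)) * V \<le> V + e" by simp
    moreover have "path_dist_le A (f c) (f d) ((1 + e / (V + 1)) * V)" using e V by (intro main) auto
    ultimately show "path_dist_le A (f c) (f d) (V + e)" by (rule path_dist_le_mono[rotated])
  qed
qed

text \<open>The assumption \<open>x \<noteq> y\<close> forces \<open>L > 0\<close>; parameter
  intervals of curves are non-degenerate.\<close>

lemma intrinsic_dist_le_of_lip_joined:
  assumes "lip_joined A x y L" "x \<noteq> y"
  shows "intrinsic_dist A x y \<le> ennreal L"
proof -
  obtain g where g: "g 0 = x" "g L = y" "g ` {0..L} \<subseteq> A"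
    "\<And>s t. s \<in> {0..L} \<Longrightarrow> t \<in> {0..L} \<Longrightarrow> norm (g s - g t) \<le> \<bar>s - t\<bar>"
    using assms(1) unfolding lip_joined_def by blast
  have L: "L > 0" using lip_joined_norm_le[OF assms(1)] assms(2) by (smt (verit) zero_less_norm_iff right_minus_eq)
  have "1-lipschitz_on {0..L} g" using g(4) by (intro lipschitz_onI) (auto simp: dist_norm)
  then have "curve_connecting A x y 0 L g"
    using g L by (auto simp: curve_connecting_def lipschitz_on_continuous_on)
  then have "intrinsic_dist A x y \<le> curve_length 0 L g"
    unfolding intrinsic_dist_def by (intro INF_lower2[of "(0, L, g)"]) auto
  also have "\<dots> \<le> ennreal (1 * (L - 0))" using g(4) by (intro curve_length_lipschitz_le) auto
  finally show ?thesis by simp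
qed

lemma intrinsic_dist_le_iff:
  fixes A :: "'a::real_inner set"
  assumes A: "prox_regular R A" and R: "R > 0" and xy: "x \<noteq> y" and c: "c \<ge> 0"
  shows "intrinsic_dist A x y \<le> ennreal c \<longleftrightarrow> path_dist_le A x y c"
proof
  assume le: "intrinsic_dist A x y \<le> ennreal c"
  show "path_dist_le A x y c"
  proof (rule path_dist_le_closed)
    fix e :: real assume e: "e > 0"
    then have "intrinsic_dist A x y < ennreal (c + e)"
      using le c by (simp add: ennreal_lessI order_le_less_trans)
    then obtain u v f where "curve_connecting A x y u v f" "curve_length u v f < ennreal (c + e)"
      unfolding intrinsic_dist_def INF_less_iff by auto
    then show "path_dist_le A x y (c + e)"
      using path_dist_le_of_curve[OF A R, of u v f "c + e"] c e by (auto simp: curve_connecting_def)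
  qed
next
  assume "path_dist_le A x y c"
  then have le: "intrinsic_dist A x y \<le> ennreal c + ennreal e" if "e > 0" for e
    using intrinsic_dist_le_of_lip_joined[OF _ xy, of A "c + e"] that c by (simp add: path_dist_le_def)
  show "intrinsic_dist A x y \<le> ennreal c" by (rule ennreal_le_epsilon) (rule le)
qed

text \<open>A subdivision with the single interior point \<open>x\<close> suffices: its first term
  already bounds |\<sigma> x - \<tau> x|^2 / x.\<close>

lemma near_minimizers_uniformly_close:
  fixes A :: "'a::real_inner set"
  assumes A: "prox_regular R A" and R: "R > 0" and \<kappa>: "0 < \<kappa>" "\<kappa> < pi" and \<epsilon>: "\<epsilon> > 0"
  obtains \<eta> where "\<eta> > 0" "\<And>M a b \<sigma> \<tau> t. 0 < M \<Longrightarrow> M \<le> \<kappa> * R \<Longrightarrow>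
    lip_curve A M a b \<sigma> \<Longrightarrow> lip_curve A M a b \<tau> \<Longrightarrow>
    (\<And>c. path_dist_le A a b c \<Longrightarrow> M - \<eta> \<le> c) \<Longrightarrow> t \<in> {0..1} \<Longrightarrow> norm (\<sigma> t - \<tau> t) \<le> \<epsilon>"
proof -
  from \<epsilon> have "\<epsilon>\<^sup>2 > 0" by simp
  show thesis
  proof (rule near_minimizers_close[OF A R \<kappa> \<open>\<epsilon>\<^sup>2 > 0\<close>])
    fix \<eta> :: real
    assume \<eta>: "\<eta> > 0" and close: "\<And>M a b \<sigma> \<tau> n t. 0 < M \<Longrightarrow> M \<le> \<kappa> * R \<Longrightarrow> lip_curve A M a b \<sigma> \<Longrightarrow> lip_curve A M a b \<tau> \<Longrightarrow>
    (\<And>c. path_dist_le A a b c \<Longrightarrow> M - \<eta> \<le> c) \<Longrightarrow> subdivision 0 1 n t \<Longrightarrow>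
    (\<Sum>k<n. (norm ((\<sigma> (t (Suc k)) - \<tau> (t (Suc k))) - (\<sigma> (t k) - \<tau> (t k))))\<^sup>2 / (t (Suc k) - t k)) \<le> \<epsilon>\<^sup>2"
    show thesis
    proof (rule that[OF \<eta>])
      fix M a b \<sigma> \<tau> and x :: real
      assume *: "0 < M" "M \<le> \<kappa> * R" "lip_curve A M a b \<sigma>" "lip_curve A M a b \<tau>"
        "\<And>c. path_dist_le A a b c \<Longrightarrow> M - \<eta> \<le> c" and x: "x \<in> {0..1}"
      have ends: "\<sigma> 0 = \<tau> 0" "\<sigma> 1 = \<tau> 1" using * by (auto simp: lip_curve_def)
      show "norm (\<sigma> x - \<tau> x) \<le> \<epsilon>"
      proof (cases "x = 0 \<or> x = 1")
        case True
        then show ?thesis using ends \<epsilon> by auto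
      next
        case False
        then have x01: "0 < x" "x < 1" using x by auto
        define t :: "nat \<Rightarrow> real" where "t k = (if k = 0 then 0 else if k = 1 then x else 1)" for k
        have "subdivision 0 1 2 t" unfolding subdivision_def
          using x01 by (auto intro!: strict_mono_on_atMostI simp: t_def)
        from close[OF * this]
        have "(norm (\<sigma> x - \<tau> x))\<^sup>2 / x + (norm (- (\<sigma> x - \<tau> x)))\<^sup>2 / (1 - x) \<le> \<epsilon>\<^sup>2"
          by (simp add: t_def ends numeral_2_eq_2 norm_minus_commute)
        moreover have "0 \<le> (norm (- (\<sigma> x - \<tau> x)))\<^sup>2 / (1 - x)" using x01 by simp
        ultimately have "(norm (\<sigma> x - \<tau> x))\<^sup>2 / x \<le> \<epsilon>\<^sup>2" by linarith
        then have "(norm (\<sigma> x - \<tau> x))\<^sup>2 \<le> \<epsilon>\<^sup>2 * x" using x01 by (simp add: pos_divide_le_eq)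
        also have "\<dots> \<le> \<epsilon>\<^sup>2" using x01 by (simp add: mult_left_le)
        finally show ?thesis by (rule power2_le_imp_le) (use \<epsilon> in simp)
      qed
    qed
  qed
qed

text \<open>Curves whose Lipschitz constants decrease to the infimum \<open>\<rho>\<close> are
  pointwise Cauchy, since near minimizers are uniformly close. Completeness replaces compactness,
  and the limit inherits the constant \<open>\<rho>\<close>.\<close>

lemma shortest_lip_curve_exists:
  fixes A :: "'a::{real_inner, complete_space} set"
  assumes A: "prox_regular R A" and R: "R > 0"
    and ab: "a \<in> A" "b \<in> A" "a \<noteq> b" "norm (a - b) < 2 * R"
  obtains \<rho> \<gamma> where "0 < \<rho>" "\<rho> \<le> 2 * R * arcsin (norm (a - b) / (2 * R))" "lip_curve A \<rho> a b \<gamma>"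
    "path_dist_le A a b \<rho>" "\<And>c. path_dist_le A a b c \<Longrightarrow> \<rho> \<le> c"
proof -
  define f where "f = 2 * R * arcsin (norm (a - b) / (2 * R))"
  define \<rho> where "\<rho> = Inf {c. path_dist_le A a b c}"
  have f: "path_dist_le A a b f" unfolding f_def by (rule path_dist_le_arcsin[OF A R ab(1,2,4)])
  have bdd: "bdd_below {c. path_dist_le A a b c}"
    using path_dist_le_norm_le by (intro bdd_belowI[of _ "norm (a - b)"]) auto
  have min: "\<rho> \<le> c" if "path_dist_le A a b c" for c
    unfolding \<rho>_def using that by (intro cInf_lower bdd) auto
  have "norm (a - b) \<le> \<rho>" unfolding \<rho>_def using f path_dist_le_norm_le
    by (intro cInf_greatest) auto
  then have \<rho>0: "\<rho> > 0" using ab(3) by (smt (verit) zero_less_norm_iff right_minus_eq)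
  have \<rho>: "path_dist_le A a b \<rho>"
  proof (rule path_dist_le_closed)
    fix e :: real assume "e > 0"
    then have "Inf {c. path_dist_le A a b c} < \<rho> + e" by (simp add: \<rho>_def)
    then obtain c where "path_dist_le A a b c" "c < \<rho> + e" using cInf_lessD[of "{c. path_dist_le A a b c}"] f by auto
    then show "path_dist_le A a b (\<rho> + e)" by (meson less_imp_le path_dist_le_mono)
  qed
  have \<rho>f: "\<rho> \<le> f" by (rule min[OF f])
  have "arcsin (norm (a - b) / (2 * R)) < arcsin 1"
  proof (rule arcsin_less_arcsin)
    have "0 \<le> norm (a - b) / (2 * R)" using R by simp
    then show "- 1 \<le> norm (a - b) / (2 * R)" by linarith
  qed (use R ab in auto)
  then have fpi: "f < pi * R" using R by (simp add: f_def mult.commute)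
  \<comment> \<open>Half of the room between the arc length and pi R, so that constants slightly
    above \<open>\<rho>\<close> still stay below \<open>\<kappa> * R\<close>.\<close>
  define \<delta> where "\<delta> = (pi * R - f) / 2"
  define \<kappa> where "\<kappa> = (f + \<delta>) / R"
  have \<delta>: "\<delta> > 0" using fpi by (simp add: \<delta>_def)
  have \<kappa>R: "\<kappa> * R = f + \<delta>" using R by (simp add: \<kappa>_def)
  have "f + \<delta> < pi * R" using fpi by (simp add: \<delta>_def field_simps)
  then have \<kappa>: "0 < \<kappa>" "\<kappa> < pi" using \<rho>0 \<rho>f \<delta> R by (auto simp: \<kappa>_def pos_divide_less_eq)
  define L where "L n = \<rho> + \<delta> / (real n + 1)" for n :: nat
  have L: "\<rho> < L n" "L n \<le> \<kappa> * R" for n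
  proof -
    have "0 < \<delta> / (real n + 1)" "\<delta> / (real n + 1) \<le> \<delta>" using \<delta> by (auto simp: field_simps)
    then show "\<rho> < L n" "L n \<le> \<kappa> * R" unfolding \<kappa>R L_def using \<rho>f by linarith+
  qed
  have Llim: "L \<longlonglongrightarrow> \<rho>"
  proof -
    have "(\<lambda>n. \<rho> + \<delta> * inverse (real (Suc n))) \<longlonglongrightarrow> \<rho> + \<delta> * 0"
      by (intro tendsto_intros LIMSEQ_inverse_real_of_nat)
    then show ?thesis by (simp add: L_def[abs_def] divide_inverse add.commute)
  qed
  have "\<exists>\<sigma>. lip_curve A (L n) a b \<sigma>" for n
  proof -
    have "lip_joined A a b (\<rho> + (L n - \<rho>))" using \<rho> L(1)[of n] unfolding path_dist_le_def by (metis diff_gt_0_iff_gt)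
    then have "lip_joined A a b (L n)" by simp
    then obtain g where g: "g 0 = a" "g (L n) = b" "g ` {0..L n} \<subseteq> A"
      "\<And>s t. s \<in> {0..L n} \<Longrightarrow> t \<in> {0..L n} \<Longrightarrow> norm (g s - g t) \<le> \<bar>s - t\<bar>"
      unfolding lip_joined_def by blast
    have Lpos: "L n > 0" using L(1)[of n] \<rho>0 by simp
    have mem: "L n * t \<in> {0..L n}" if "t \<in> {0..1}" for t using that Lpos by (auto simp: mult_left_le)
    have "lip_curve A (L n) a b (\<lambda>t. g (L n * t))"
      unfolding lip_curve_def
    proof (intro conjI ballI)
      fix s t :: real assume st: "s \<in> {0..1}" "t \<in> {0..1}"
      have "norm (g (L n * s) - g (L n * t)) \<le> \<bar>L n * s - L n * t\<bar>" using st mem by (intro g)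
      also have "\<dots> = L n * \<bar>s - t\<bar>" using Lpos by (simp add: abs_mult flip: right_diff_distrib)
      finally show "norm (g (L n * s) - g (L n * t)) \<le> L n * \<bar>s - t\<bar>" .
    qed (use g mem in auto)
    then show ?thesis by blast
  qed
  then obtain \<sigma> where \<sigma>: "\<And>n. lip_curve A (L n) a b (\<sigma> n)" by metis
  have cauchy: "Cauchy (\<lambda>n. \<sigma> n t)" if t: "t \<in> {0..1}" for t
  proof (rule metric_CauchyI)
    fix e :: real assume e: "e > 0"
    then have "e / 2 > 0" by simp
    show "\<exists>N. \<forall>m\<ge>N. \<forall>n\<ge>N. dist (\<sigma> m t) (\<sigma> n t) < e"
    proof (rule near_minimizers_uniformly_close[OF A R \<kappa> \<open>e / 2 > 0\<close>])
      fix \<eta> :: real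
      assume \<eta>: "\<eta> > 0"
      and close: "\<And>M a b \<sigma> \<tau> t. 0 < M \<Longrightarrow> M \<le> \<kappa> * R \<Longrightarrow> lip_curve A M a b \<sigma> \<Longrightarrow> lip_curve A M a b \<tau> \<Longrightarrow>
        (\<And>c. path_dist_le A a b c \<Longrightarrow> M - \<eta> \<le> c) \<Longrightarrow> t \<in> {0..1} \<Longrightarrow> norm (\<sigma> t - \<tau> t) \<le> e / 2"
      have "\<forall>\<^sub>F n in sequentially. L n < \<rho> + \<eta>" using \<eta> by (intro order_tendstoD(2)[OF Llim]) simp
      then obtain N where N: "\<And>n. n \<ge> N \<Longrightarrow> L n < \<rho> + \<eta>" by (auto simp: eventually_sequentially)
      show "\<exists>N. \<forall>m\<ge>N. \<forall>n\<ge>N. dist (\<sigma> m t) (\<sigma> n t) < e"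
      proof (intro exI[of _ N] allI impI)
        fix m n assume mn: "m \<ge> N" "n \<ge> N"
        \<comment> \<open>The closeness estimate compares curves with the same constant; the larger
          one serves both.\<close>
        define M where "M = max (L m) (L n)"
        have "norm (\<sigma> m t - \<sigma> n t) \<le> e / 2"
        proof (rule close[of M a b])
          show "0 < M" using L(1)[of m] \<rho>0 by (simp add: M_def)
          show "M \<le> \<kappa> * R" using L(2) by (simp add: M_def)
          show "lip_curve A M a b (\<sigma> m)" "lip_curve A M a b (\<sigma> n)"
            using lip_curve_mono[OF \<sigma>] by (auto simp: M_def)
          show "M - \<eta> \<le> c" if "path_dist_le A a b c" for c
            using min[OF that] N[OF mn(1)] N[OF mn(2)] unfolding M_def by linarith
        qed (rule t)
        then show "dist (\<sigma> m t) (\<sigma> n t) < e" using e by (simp add: dist_norm)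
      qed
    qed
  qed
  define \<gamma> where "\<gamma> t = lim (\<lambda>n. \<sigma> n t)" for t
  have lim: "(\<lambda>n. \<sigma> n t) \<longlonglongrightarrow> \<gamma> t" if "t \<in> {0..1}" for t
    unfolding \<gamma>_def using cauchy[OF that] Cauchy_convergent convergent_LIMSEQ_iff by blast
  have "closed A" using A by (simp add: prox_regular_def)
  have "lip_curve A \<rho> a b \<gamma>"
    unfolding lip_curve_def
  proof (intro conjI ballI image_subsetI)
    show "\<gamma> 0 = a" "\<gamma> 1 = b" using \<sigma> by (simp_all add: \<gamma>_def lip_curve_def)
    show "\<gamma> t \<in> A" if "t \<in> {0..1}" for t
    proof (rule closed_sequentially[OF \<open>closed A\<close> _ lim[OF that]])
      show "\<sigma> n t \<in> A" for n using \<sigma>[of n] that by (auto simp: lip_curve_def)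
    qed
    fix s t :: real assume st: "s \<in> {0..1}" "t \<in> {0..1}"
    show "norm (\<gamma> s - \<gamma> t) \<le> \<rho> * \<bar>s - t\<bar>"
    proof (rule LIMSEQ_le)
      show "(\<lambda>n. norm (\<sigma> n s - \<sigma> n t)) \<longlonglongrightarrow> norm (\<gamma> s - \<gamma> t)" by (intro tendsto_intros lim st)
      show "(\<lambda>n. L n * \<bar>s - t\<bar>) \<longlonglongrightarrow> \<rho> * \<bar>s - t\<bar>" by (intro tendsto_intros Llim)
      show "\<exists>N. \<forall>n\<ge>N. norm (\<sigma> n s - \<sigma> n t) \<le> L n * \<bar>s - t\<bar>" using \<sigma> st by (auto simp: lip_curve_def)
    qed
  qed
  then show thesis using that \<rho>0 \<rho>f \<rho> min by (simp add: f_def)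
qed

text \<open>The chord from \<open>\<sigma> s\<close> to \<open>\<sigma> t\<close> is at most the
  length of that part, which superadditivity of length bounds by \<open>L * (t - s)\<close>. The
  values of \<open>\<sigma>\<close> lie in \<open>A\<close> because the parameter change maps onto
  the unit interval.\<close>

lemma standard_parametrization_lip_curve:
  assumes \<eta>: "curve_connecting A a b c d \<eta>" and \<sigma>: "standard_parametrization \<sigma> c d \<eta>"
    and L: "curve_length c d \<eta> = ennreal L" "L \<ge> 0"
  shows "lip_curve A L a b \<sigma>"
proof -
  obtain \<phi> where \<phi>: "continuous_on {c..d} \<phi>" "mono_on {c..d} \<phi>" "\<phi> c = 0" "\<phi> d = 1"
    "\<And>s. s \<in> {c..d} \<Longrightarrow> \<eta> s = \<sigma> (\<phi> s)"
    using \<sigma> unfolding standard_parametrization_def reparametrization_def by blast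
  have cd: "c < d" "\<eta> c = a" "\<eta> d = b" "\<eta> ` {c..d} \<subseteq> A" using \<eta> by (auto simp: curve_connecting_def)
  have len: "curve_length 0 t \<sigma> = ennreal (t * L)" if "t \<in> {0..1}" for t
    using \<sigma> that L by (simp add: standard_parametrization_def ennreal_mult)
  have lip: "norm (\<sigma> t - \<sigma> s) \<le> L * (t - s)" if "0 \<le> s" "s \<le> t" "t \<le> 1" for s t
  proof -
    have "ennreal (s * L + norm (\<sigma> t - \<sigma> s)) = curve_length 0 s \<sigma> + ennreal (norm (\<sigma> t - \<sigma> s))"
      using that L by (simp add: len)
    also have "\<dots> \<le> curve_length 0 s \<sigma> + curve_length s t \<sigma>"
      using that by (intro add_left_mono norm_le_curve_length)
    also have "\<dots> \<le> curve_length 0 t \<sigma>" using that by (intro curve_length_add_le)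
    also have "\<dots> = ennreal (t * L)" using that by (simp add: len)
    finally have "s * L + norm (\<sigma> t - \<sigma> s) \<le> t * L"
      by (subst (asm) ennreal_le_iff) (use that L in auto)
    then show ?thesis by (simp add: algebra_simps)
  qed
  have "\<sigma> x \<in> A" if x: "x \<in> {0..1}" for x
  proof -
    have "\<exists>s\<ge>c. s \<le> d \<and> \<phi> s = x" by (rule IVT') (use \<phi> cd x in auto)
    then show ?thesis using \<phi>(5) cd by (auto simp: image_subset_iff)
  qed
  moreover have "\<sigma> 0 = a" "\<sigma> 1 = b" using \<phi>(3-5) \<phi>(5)[of c] \<phi>(5)[of d] cd by auto
  moreover have "norm (\<sigma> s - \<sigma> t) \<le> L * \<bar>s - t\<bar>" if "s \<in> {0..1}" "t \<in> {0..1}" for s t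
    using lip[of s t] lip[of t s] that by (cases "s \<le> t") (auto simp: norm_minus_commute)
  ultimately show ?thesis by (auto simp: lip_curve_def)
qed

text \<open>The length function of a shortest curve is continuous because nearby points of \<open>A\<close> are joined by
  short paths. This allows the curve to be parametrized by its length.\<close>

lemma shortest_curve_reparametrization:
  fixes A :: "'a::real_inner set"
  assumes A: "prox_regular R A" and R: "R > 0" and \<rho>: "\<rho> > 0"
    and min: "\<And>c. path_dist_le A a b c \<Longrightarrow> \<rho> \<le> c"
    and \<eta>: "curve_connecting A a b c d \<eta>" "curve_length c d \<eta> = ennreal \<rho>"
    and uniq: "\<And>\<sigma>. lip_curve A \<rho> a b \<sigma> \<Longrightarrow> (\<forall>t\<in>{0..1}. \<sigma> t = \<gamma> t)"
  shows "reparametrization c d \<eta> 0 1 \<gamma>"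
proof -
  have cd: "c < d" "\<eta> c = a" "\<eta> d = b" "\<eta> ` {c..d} \<subseteq> A" "continuous_on {c..d} \<eta>"
    using \<eta>(1) by (auto simp: curve_connecting_def)
  have fin: "curve_length u v \<eta> \<le> ennreal \<rho>" if "c \<le> u" "u \<le> v" "v \<le> d" for u v
  proof -
    have "curve_length u v \<eta> \<le> curve_length c u \<eta> + curve_length u v \<eta>" by simp
    also have "\<dots> \<le> curve_length c v \<eta>" using that by (intro curve_length_add_le)
    also have "\<dots> \<le> curve_length c d \<eta>" using that by (intro curve_length_mono) auto
    finally show ?thesis using \<eta>(2) by simp
  qed
  define \<Lambda> where "\<Lambda> t = enn2real (curve_length c t \<eta>)" for t
  have \<Lambda>: "curve_length c t \<eta> = ennreal (\<Lambda> t)" if "c \<le> t" "t \<le> d" for t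
    using fin[of c t] that unfolding \<Lambda>_def by (metis ennreal_enn2real ennreal_less_top order_le_less_trans order_refl)
  have \<Lambda>0: "\<Lambda> t \<ge> 0" for t by (simp add: \<Lambda>_def)
  have lip: "norm (\<eta> t - \<eta> s) \<le> \<Lambda> t - \<Lambda> s" if "c \<le> s" "s \<le> t" "t \<le> d" for s t
  proof -
    have "ennreal (\<Lambda> s + norm (\<eta> t - \<eta> s)) = curve_length c s \<eta> + ennreal (norm (\<eta> t - \<eta> s))"
      using that \<Lambda>0 by (simp add: \<Lambda>)
    also have "\<dots> \<le> curve_length c s \<eta> + curve_length s t \<eta>"
      using that by (intro add_left_mono norm_le_curve_length)
    also have "\<dots> \<le> ennreal (\<Lambda> t)" using that curve_length_add_le[of c s t \<eta>] by (simp add: \<Lambda>)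
    finally have "\<Lambda> s + norm (\<eta> t - \<eta> s) \<le> \<Lambda> t"
      by (subst (asm) ennreal_le_iff) (use \<Lambda>0 in auto)
    then show ?thesis by simp
  qed
  have mono: "\<Lambda> s \<le> \<Lambda> t" if "c \<le> s" "s \<le> t" "t \<le> d" for s t
    using lip[OF that] norm_ge_zero[of "\<eta> t - \<eta> s"] by linarith
  \<comment> \<open>Replacing the part between \<open>s\<close> and \<open>t\<close> by a short path
    in \<open>A\<close> cannot undercut \<open>\<rho>\<close>, so that part is no longer than the
    path. The factor 2 is \<open>1 + e\<close> with \<open>e = 1\<close>, admissible for chords
    below \<open>R\<close>.\<close>
  have upper: "\<Lambda> t - \<Lambda> s \<le> 2 * norm (\<eta> t - \<eta> s)"
    if st: "c \<le> s" "s \<le> t" "t \<le> d" and near: "norm (\<eta> t - \<eta> s) < R" for s t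
  proof -
    have sA: "\<eta> s \<in> A" "\<eta> t \<in> A" using cd st by (auto simp: image_subset_iff)
    have "path_dist_le A (\<eta> c) (\<eta> s) (\<Lambda> s)"
      using st cd \<Lambda>0 by (intro path_dist_le_of_curve[OF A R]) (auto simp: \<Lambda> intro: continuous_on_subset)
    moreover have "path_dist_le A (\<eta> s) (\<eta> t) (2 * norm (\<eta> t - \<eta> s))"
    proof -
      have "(norm (\<eta> s - \<eta> t))\<^sup>2 \<le> R\<^sup>2" using near by (intro power_mono) (auto simp: norm_minus_commute)
      then have "(norm (\<eta> s - \<eta> t))\<^sup>2 * 2 \<le> 4 * R\<^sup>2" using zero_le_power2[of R] by linarith
      then have "(norm (\<eta> s - \<eta> t))\<^sup>2 * (1 + 1) \<le> 4 * R\<^sup>2 * 1" by simp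
      moreover have "norm (\<eta> s - \<eta> t) < 2 * R" using near R by (simp add: norm_minus_commute)
      ultimately have "lip_joined A (\<eta> s) (\<eta> t) ((1 + 1) * norm (\<eta> s - \<eta> t))"
        by (intro lip_joined_near'[OF A R sA]) auto
      then show ?thesis by (simp add: path_dist_le_of_lip_joined norm_minus_commute)
    qed
    moreover have "path_dist_le A (\<eta> t) (\<eta> d) (\<rho> - \<Lambda> t)"
    proof (rule path_dist_le_of_curve[OF A R])
      have "ennreal (\<Lambda> t) + curve_length t d \<eta> \<le> ennreal \<rho>"
        using curve_length_add_le[of c t d \<eta>] st \<eta>(2) by (simp add: \<Lambda>)
      moreover have "curve_length t d \<eta> = ennreal (enn2real (curve_length t d \<eta>))"
        using fin[of t d] st by (metis ennreal_enn2real ennreal_less_top order_le_less_trans order_refl order_trans)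
      ultimately have "\<Lambda> t + enn2real (curve_length t d \<eta>) \<le> \<rho>"
        using \<Lambda>0[of t] \<rho> by (metis enn2real_nonneg ennreal_le_iff ennreal_plus less_imp_le)
      then show "curve_length t d \<eta> \<le> ennreal (\<rho> - \<Lambda> t)" "0 \<le> \<rho> - \<Lambda> t"
        using \<open>curve_length t d \<eta> = _\<close> enn2real_nonneg[of "curve_length t d \<eta>"]
        by (metis add.commute ennreal_leI le_diff_eq, linarith)
    qed (use st cd in \<open>auto intro: continuous_on_subset\<close>)
    ultimately have "path_dist_le A (\<eta> c) (\<eta> d) (\<Lambda> s + 2 * norm (\<eta> t - \<eta> s) + (\<rho> - \<Lambda> t))"
      by (intro path_dist_le_trans)
    then show ?thesis using min cd by fastforce
  qed
  have \<Lambda>cont: "continuous_on {c..d} \<Lambda>"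
    unfolding continuous_on_iff
  proof (intro ballI allI impI)
    fix x e :: real assume x: "x \<in> {c..d}" and e: "e > 0"
    have "min R (e / 2) > 0" using R e by simp
    with cd(5) x obtain h where h: "h > 0" "\<And>y. y \<in> {c..d} \<Longrightarrow> dist y x < h \<Longrightarrow> dist (\<eta> y) (\<eta> x) < min R (e / 2)"
      unfolding continuous_on_iff by metis
    have "dist (\<Lambda> y) (\<Lambda> x) < e" if y: "y \<in> {c..d}" "dist y x < h" for y
    proof -
      have n: "norm (\<eta> y - \<eta> x) < R" "norm (\<eta> y - \<eta> x) < e / 2" using h(2)[OF y] by (auto simp: dist_norm)
      show ?thesis
      proof (cases "x \<le> y")
        case True
        then show ?thesis using upper[of x y] mono[of x y] n x y by (simp add: dist_real_def)
      next
        case False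
        then show ?thesis using upper[of y x] mono[of y x] n x y by (simp add: dist_real_def norm_minus_commute)
      qed
    qed
    then show "\<exists>h>0. \<forall>y\<in>{c..d}. dist y x < h \<longrightarrow> dist (\<Lambda> y) (\<Lambda> x) < e" using h(1) by blast
  qed
  have \<Lambda>c: "\<Lambda> c = 0"
  proof -
    have "curve_length c c \<eta> \<le> ennreal (0 * (c - c))" by (rule curve_length_lipschitz_le) auto
    then show ?thesis by (simp add: \<Lambda>_def)
  qed
  have \<Lambda>d: "\<Lambda> d = \<rho>" using \<eta>(2) \<rho> by (simp add: \<Lambda>_def)
  have surj: "\<exists>t. t \<in> {c..d} \<and> \<Lambda> t = x * \<rho>" if "x \<in> {0..1}" for x
  proof -
    have "\<exists>t\<ge>c. t \<le> d \<and> \<Lambda> t = x * \<rho>"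
      by (rule IVT') (use \<Lambda>c \<Lambda>d \<Lambda>cont cd \<rho> that in auto)
    then show ?thesis by auto
  qed
  \<comment> \<open>A right inverse of the length function. Where that function is constant so is
    \<open>\<eta>\<close>, hence the choice does not affect \<open>\<eta> (T x)\<close>.\<close>
  define T where "T x = (SOME t. t \<in> {c..d} \<and> \<Lambda> t = x * \<rho>)" for x
  have T: "T x \<in> {c..d}" "\<Lambda> (T x) = x * \<rho>" if "x \<in> {0..1}" for x
    using someI_ex[OF surj[OF that]] by (auto simp: T_def)
  have lip': "norm (\<eta> t - \<eta> s) \<le> \<bar>\<Lambda> t - \<Lambda> s\<bar>" if "s \<in> {c..d}" "t \<in> {c..d}" for s t
    using lip[of s t] lip[of t s] that by (cases "s \<le> t") (auto simp: norm_minus_commute)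
  define \<sigma> where "\<sigma> x = \<eta> (T x)" for x
  have \<sigma>: "\<eta> t = \<sigma> (\<Lambda> t / \<rho>)" if t: "t \<in> {c..d}" for t
  proof -
    have "\<Lambda> t / \<rho> \<in> {0..1}" using mono[of t d] \<Lambda>0[of t] \<Lambda>d t \<rho> by simp
    from T[OF this] have "norm (\<eta> t - \<sigma> (\<Lambda> t / \<rho>)) \<le> 0"
      using lip'[of "T (\<Lambda> t / \<rho>)" t] t \<rho> by (simp add: \<sigma>_def)
    then show ?thesis by simp
  qed
  have "lip_curve A \<rho> a b \<sigma>" unfolding lip_curve_def
  proof (intro conjI ballI image_subsetI)
    show "\<sigma> 0 = a" using \<sigma>[of c] cd \<Lambda>c by simp
    show "\<sigma> 1 = b" using \<sigma>[of d] cd \<Lambda>d \<rho> by simp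
    show "\<sigma> t \<in> A" if "t \<in> {0..1}" for t using T(1)[OF that] cd by (auto simp: \<sigma>_def)
    fix s t :: real assume st: "s \<in> {0..1}" "t \<in> {0..1}"
    have "norm (\<sigma> s - \<sigma> t) \<le> \<bar>s * \<rho> - t * \<rho>\<bar>" using lip'[OF T(1) T(1)] T(2) st by (simp add: \<sigma>_def)
    also have "\<dots> = \<rho> * \<bar>s - t\<bar>" using \<rho> by (simp add: abs_mult flip: left_diff_distrib)
    finally show "norm (\<sigma> s - \<sigma> t) \<le> \<rho> * \<bar>s - t\<bar>" .
  qed
  then have eq: "\<sigma> t = \<gamma> t" if "t \<in> {0..1}" for t using uniq that by blast
  show ?thesis unfolding reparametrization_def
  proof (intro exI[of _ "\<lambda>t. \<Lambda> t / \<rho>"] conjI ballI)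
    show "continuous_on {c..d} (\<lambda>t. \<Lambda> t / \<rho>)" using \<rho> by (intro continuous_intros \<Lambda>cont) auto
    show "mono_on {c..d} (\<lambda>t. \<Lambda> t / \<rho>)" using mono \<rho> by (auto intro!: mono_onI divide_right_mono)
    show "\<eta> t = \<gamma> (\<Lambda> t / \<rho>)" if "t \<in> {c..d}" for t
      using \<sigma>[OF that] eq mono[of t d] \<Lambda>0[of t] \<Lambda>d that \<rho> by simp
  qed (use \<Lambda>c \<Lambda>d \<rho> in auto)
qed

lemma V2_leI:
  assumes "\<And>n t. subdivision 0 1 n t \<Longrightarrow> (\<Sum>k<n. (norm (f (t (Suc k)) - f (t k)))\<^sup>2 / (t (Suc k) - t k)) \<le> e\<^sup>2" "e \<ge> 0"
  shows "V2 f \<le> ennreal e"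
  unfolding V2_def
proof (rule SUP_least, clarify)
  fix n t assume "subdivision 0 1 n t"
  from real_sqrt_le_mono[OF assms(1)[OF this]]
  show "ennreal (sqrt (\<Sum>k<n. (norm (f (t (Suc k)) - f (t k)))\<^sup>2 / (t (Suc k) - t k))) \<le> ennreal e"
    using assms(2) by (intro ennreal_leI) simp
qed

theorem theorem6p8:
  fixes A :: "'a::{real_inner, complete_space} set" and a b :: 'a and R :: real
  assumes "\<exists>S :: 'a set. independent S \<and> card S = 2"
    and "R > 0"
    and "proximally_smooth R A"
    and "a \<in> A" and "b \<in> A" and "a \<noteq> b"
    and "norm (a - b) < 2 * R"
  shows "\<exists>\<gamma>. shortest_curve A a b 0 1 \<gamma> \<and> standard_parametrization \<gamma> 0 1 \<gamma> \<and>
    (\<forall>c d \<eta>. shortest_curve A a b c d \<eta> \<longrightarrow> reparametrization c d \<eta> 0 1 \<gamma>) \<and>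
    proximally_smooth R (\<gamma> ` {0..1}) \<and>
    curve_length 0 1 \<gamma> \<le> ennreal (2 * R * arcsin (norm (a - b) / (2 * R))) \<and>
    (\<forall>c d \<eta> \<sigma>. (\<forall>i::nat. curve_connecting A a b (c i) (d i) (\<eta> i) \<and>
          standard_parametrization (\<sigma> i) (c i) (d i) (\<eta> i)) \<longrightarrow>
      (\<lambda>i. curve_length (c i) (d i) (\<eta> i)) \<longlonglongrightarrow> intrinsic_dist A a b \<longrightarrow>
      (\<lambda>i. V2 (\<lambda>t. \<sigma> i t - \<gamma> t)) \<longlonglongrightarrow> 0)"
proof -
  note R = assms(2) and ab = assms(4-7)
  have A: "prox_regular R A" using assms by (intro proximally_smooth_imp_prox_regular) auto
  obtain \<rho> \<gamma> where \<rho>: "0 < \<rho>" "\<rho> \<le> 2 * R * arcsin (norm (a - b) / (2 * R))"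
    and \<gamma>: "lip_curve A \<rho> a b \<gamma>" and pd: "path_dist_le A a b \<rho>"
    and min: "\<And>c. path_dist_le A a b c \<Longrightarrow> \<rho> \<le> c"
    using shortest_lip_curve_exists[OF A R ab] by blast
  have idist: "intrinsic_dist A a b = ennreal \<rho>"
  proof (rule antisym)
    show le: "intrinsic_dist A a b \<le> ennreal \<rho>"
      using pd \<rho> by (simp add: intrinsic_dist_le_iff[OF A R ab(3)])
    define r where "r = enn2real (intrinsic_dist A a b)"
    have r: "intrinsic_dist A a b = ennreal r" "r \<ge> 0"
      using le by (auto simp: r_def) (metis ennreal_enn2real ennreal_less_top order_le_less_trans)
    then have "path_dist_le A a b r" using intrinsic_dist_le_iff[OF A R ab(3), of r] by simp
    then show "ennreal \<rho> \<le> intrinsic_dist A a b" using min r by (simp add: ennreal_leI)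
  qed
  have conn: "curve_connecting A a b 0 1 \<gamma>"
    using \<gamma> lip_curve_continuous[OF \<gamma>] by (auto simp: curve_connecting_def lip_curve_def)
  have len: "curve_length 0 t \<gamma> = ennreal (t * \<rho>)" if t: "t \<in> {0..1}" for t
  proof (rule antisym)
    have "curve_length 0 t \<gamma> \<le> ennreal (\<rho> * (t - 0))"
      using \<gamma> t by (intro curve_length_lipschitz_le) (auto simp: lip_curve_def)
    then show le: "curve_length 0 t \<gamma> \<le> ennreal (t * \<rho>)" by (simp add: mult.commute)
    define V where "V = enn2real (curve_length 0 t \<gamma>)"
    have V: "curve_length 0 t \<gamma> = ennreal V" "V \<ge> 0"
      using le by (auto simp: V_def) (metis ennreal_enn2real ennreal_less_top order_le_less_trans)
    \<comment> \<open>A shorter initial part would yield a competitor below \<open>\<rho>\<close>;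
      hence the speed is constant, which makes \<open>\<gamma>\<close> its own standard
      parametrization.\<close>
    have "path_dist_le A (\<gamma> 0) (\<gamma> t) V"
      using t V conn by (intro path_dist_le_of_curve[OF A R])
        (auto simp: curve_connecting_def intro: continuous_on_subset)
    then have "\<rho> * (t - 0) \<le> V" using geodesic_le_path_dist[OF \<gamma> _ min, of 0 t V] \<rho> t by auto
    then show "ennreal (t * \<rho>) \<le> curve_length 0 t \<gamma>" unfolding V(1) by (intro ennreal_leI) (simp add: mult.commute)
  qed
  have len1: "curve_length 0 1 \<gamma> = ennreal \<rho>" using len[of 1] by simp
  have "arcsin (norm (a - b) / (2 * R)) < arcsin 1"
  proof (rule arcsin_less_arcsin)
    have "0 \<le> norm (a - b) / (2 * R)" using R by simp
    then show "- 1 \<le> norm (a - b) / (2 * R)" by linarith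
  qed (use R ab in auto)
  then have "2 * R * arcsin (norm (a - b) / (2 * R)) < 2 * R * (pi / 2)"
    using R by (intro mult_strict_left_mono) auto
  then have \<rho>pi: "\<rho> < pi * R" using \<rho>(2) by (simp add: mult.commute)
  \<comment> \<open>Strictly above \<open>\<rho> / R\<close>, so that the comparison also covers
    curves slightly longer than \<open>\<gamma>\<close>.\<close>
  define \<kappa> where "\<kappa> = (\<rho> / R + pi) / 2"
  have \<rho>R: "0 < \<rho> / R" "\<rho> / R < pi" using \<rho> R \<rho>pi by (auto simp: pos_divide_less_eq)
  have \<rho>R\<kappa>: "\<rho> / R < \<kappa>"
    unfolding \<kappa>_def using less_half_sum[OF \<rho>R(2)] by simp
  have "\<kappa> < pi"
    unfolding \<kappa>_def using gt_half_sum[OF \<rho>R(2)] by simp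
  note \<kappa> = less_trans[OF \<rho>R(1) \<rho>R\<kappa>] this \<rho>R\<kappa>
  then have \<rho>\<kappa>: "\<rho> < \<kappa> * R" using R by (simp add: pos_divide_less_eq)
  have uniq: "\<forall>t\<in>{0..1}. \<sigma> t = \<gamma> t" if \<sigma>: "lip_curve A \<rho> a b \<sigma>" for \<sigma>
  proof
    fix t :: real assume t: "t \<in> {0..1}"
    have "norm (\<sigma> t - \<gamma> t) \<le> 0"
    proof (rule field_le_epsilon)
      fix e :: real assume "e > 0"
      show "norm (\<sigma> t - \<gamma> t) \<le> 0 + e"
      proof (rule near_minimizers_uniformly_close[OF A R \<kappa>(1,2) \<open>e > 0\<close>])
        fix h :: real
        assume h: "h > 0"
        and close: "\<And>M a b \<sigma> \<tau> t. 0 < M \<Longrightarrow> M \<le> \<kappa> * R \<Longrightarrow> lip_curve A M a b \<sigma> \<Longrightarrow> lip_curve A M a b \<tau> \<Longrightarrow>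
          (\<And>c. path_dist_le A a b c \<Longrightarrow> M - h \<le> c) \<Longrightarrow> t \<in> {0..1} \<Longrightarrow> norm (\<sigma> t - \<tau> t) \<le> e"
        have "\<rho> - h \<le> c" if "path_dist_le A a b c" for c using min[OF that] h by simp
        from close[OF \<rho>(1) less_imp_le[OF \<rho>\<kappa>] \<sigma> \<gamma> this t]
        show "norm (\<sigma> t - \<gamma> t) \<le> 0 + e" by simp
      qed
    qed
    then show "\<sigma> t = \<gamma> t" by simp
  qed
  have v2: "(\<lambda>i. V2 (\<lambda>t. \<sigma> i t - \<gamma> t)) \<longlonglongrightarrow> 0"
    if \<sigma>: "\<And>i::nat. curve_connecting A a b (c i) (d i) (\<eta> i) \<and> standard_parametrization (\<sigma> i) (c i) (d i) (\<eta> i)"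
      and lim: "(\<lambda>i. curve_length (c i) (d i) (\<eta> i)) \<longlonglongrightarrow> intrinsic_dist A a b" for c d \<eta> \<sigma>
  proof (rule tendsto_zero_ennreal)
    fix r :: real assume r: "r > 0"
    \<comment> \<open>Squared because \<open>V2\<close> is the root of the sums; halved to end with
      a strict inequality.\<close>
    then have "(r / 2)\<^sup>2 > 0" by simp
    show "\<forall>\<^sub>F i in sequentially. V2 (\<lambda>t. \<sigma> i t - \<gamma> t) < ennreal r"
    proof (rule near_minimizers_close[OF A R \<kappa>(1,2) \<open>(r / 2)\<^sup>2 > 0\<close>])
      fix h :: real
      assume h: "h > 0"
      and close: "\<And>M a b \<sigma> \<tau> n t. 0 < M \<Longrightarrow> M \<le> \<kappa> * R \<Longrightarrow> lip_curve A M a b \<sigma> \<Longrightarrow> lip_curve A M a b \<tau> \<Longrightarrow>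
      (\<And>c. path_dist_le A a b c \<Longrightarrow> M - h \<le> c) \<Longrightarrow> subdivision 0 1 n t \<Longrightarrow>
      (\<Sum>k<n. (norm ((\<sigma> (t (Suc k)) - \<tau> (t (Suc k))) - (\<sigma> (t k) - \<tau> (t k))))\<^sup>2 / (t (Suc k) - t k)) \<le> (r / 2)\<^sup>2"
      \<comment> \<open>The first bound makes the curve a near minimizer for \<open>h\<close>, the
        second makes its length admissible for \<open>close\<close>.\<close>
      have "intrinsic_dist A a b < ennreal (min (\<rho> + h) (\<kappa> * R))"
        unfolding idist using \<rho> h \<rho>\<kappa> by (intro ennreal_lessI) auto
      from order_tendstoD(2)[OF lim this]
      show "\<forall>\<^sub>F i in sequentially. V2 (\<lambda>t. \<sigma> i t - \<gamma> t) < ennreal r"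
      proof eventually_elim
        case (elim i)
        define L where "L = enn2real (curve_length (c i) (d i) (\<eta> i))"
        have L: "curve_length (c i) (d i) (\<eta> i) = ennreal L" "L \<ge> 0"
          using elim by (auto simp: L_def) (metis ennreal_enn2real ennreal_less_top order.strict_trans)
        have Lub: "L < \<rho> + h" "L < \<kappa> * R" using elim L by (auto simp: ennreal_less_iff)
        have "intrinsic_dist A a b \<le> ennreal L"
          unfolding L(1)[symmetric] intrinsic_dist_def using \<sigma>[of i] by (intro INF_lower2[of "(c i, d i, \<eta> i)"]) auto
        then have \<rho>L: "\<rho> \<le> L" using L \<rho> by (simp add: idist)
        have \<sigma>i: "lip_curve A L a b (\<sigma> i)" using \<sigma>[of i] L by (intro standard_parametrization_lip_curve) auto
        have "V2 (\<lambda>t. \<sigma> i t - \<gamma> t) \<le> ennreal (r / 2)"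
        proof (rule V2_leI)
          fix n t assume sub: "subdivision 0 1 n t"
          show "(\<Sum>k<n. (norm ((\<sigma> i (t (Suc k)) - \<gamma> (t (Suc k))) - (\<sigma> i (t k) - \<gamma> (t k))))\<^sup>2 / (t (Suc k) - t k)) \<le> (r / 2)\<^sup>2"
          proof (rule close[OF _ _ \<sigma>i lip_curve_mono[OF \<gamma> \<rho>L] _ sub])
            show "L - h \<le> c" if "path_dist_le A a b c" for c using min[OF that] Lub(1) by simp
          qed (use Lub \<rho> \<rho>L in auto)
        qed (use r in auto)
        also have "\<dots> < ennreal r" using r by (simp add: ennreal_lessI)
        finally show ?case .
      qed
    qed
  qed
  show ?thesis
  proof (intro exI[of _ \<gamma>] conjI allI impI)
    show "shortest_curve A a b 0 1 \<gamma>" using conn len1 idist by (simp add: shortest_curve_def)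
    have "reparametrization 0 1 \<gamma> 0 1 \<gamma>" unfolding reparametrization_def
      by (intro exI[of _ "\<lambda>t. t"]) (auto intro: mono_onI)
    then show "standard_parametrization \<gamma> 0 1 \<gamma>"
      using len \<rho> by (auto simp: standard_parametrization_def len1 ennreal_mult)
    show "reparametrization c d \<eta> 0 1 \<gamma>" if "shortest_curve A a b c d \<eta>" for c d \<eta>
      using that idist by (intro shortest_curve_reparametrization[OF A R \<rho>(1) min _ _ uniq])
        (auto simp: shortest_curve_def)
    show "proximally_smooth R (\<gamma> ` {0..1})"
      by (intro prox_regular_imp_proximally_smooth R prox_regular_geodesic[OF A R \<gamma> \<rho>(1) min])
    show "curve_length 0 1 \<gamma> \<le> ennreal (2 * R * arcsin (norm (a - b) / (2 * R)))"
      unfolding len1 using \<rho>(2) by (rule ennreal_leI)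
  qed (rule v2, auto)
qed

end
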